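(* Let $G$ be a group, $M$ a right $\mathbb Z[G]$-module, $\varphi:G\to Z(G)$ a group homomorphism into the center of $G$, $X=\bigsqcup_{m\in M}(\{m\}\times G)=M\times G$ the $G$-Alexander multiple conjugation biquandle of $(M,\varphi)$, regarded also as an $X$-set with action $*:=\underline{*}$, $A$ an abelian group and $\lambda:G\to A$ a group homomorphism. Let $n\ge1$. For any normalized group $(n+1)$-cocycle $f:C_{n+1}^{\rm norgp}(M;\mathbb Z)_G\to A$, the maps $$\Phi_f:=f\circ\psi_n\circ\gamma_n\circ{\rm proj}_n:\ C_n(X;\mathbb Z)_X\to A$$ and $$\Phi_{f,\lambda}:=(f\otimes{\rm id}_A)\circ\psi_{n,\lambda}\circ\gamma_n\circ{\rm proj}_n:\ C_n(X;\mathbb Z)_X\to A\otimes_{\mathbb Z}A$$ are (well defined on $C_n(X;\mathbb Z)_X=P_n(X;\mathbb Z)_X/D_n(X;\mathbb Z)_X$ and are) $n$-cocycles of the multiple conjugation biquandle $X$ with the $X$-set $X$.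
   Context: **$G$-Alexander multiple conjugation biquandle (MCB).** $X=M\times G$ with $(m,g)\,\underline{*}\,(n,h)=(mh+n(\varphi(h)-h),\,h^{-1}gh)$, $(m,g)\,\overline{*}\,(n,h)=(m\varphi(h),\,g)$, decomposed as the disjoint union of the groups $G_m:=\{m\}\times G$ ($m\in M$) with product $(m,g)(m,h)=(m,gh)$. **MCB complex with the $X$-set $X$.** For $n\ge0$, $P_n(X;\mathbb Z)_X$ is the free abelian group on symbols $\langle x_0\rangle\langle\bm x_1\rangle\cdots\langle\bm x_k\rangle$, where $x_0\in X$, $\langle\bm x_i\rangle=\langle x_{i1},\dots,x_{in_i}\rangle$ with $n_i\ge1$, all entries of a given $\bm x_i$ ($i\ge1$) lie in one and the same group $G_m$ ($m$ may depend on $i$), and $n_1+\cdots+n_k=n$; $P_n=0$ for $n<0$. Operations with an element apply entrywise. For $n\ge1$, $$\partial_n(\langle x_0\rangle\langle\bm x_1\rangle\cdots\langle\bm x_k\rangle)=\sum_{i=1}^k(-1)^{n_1+\cdots+n_{i-1}}\Bigl\{\langle x_0\underline{*}x_{i1}\rangle\langle\bm x_1\underline{*}x_{i1}\rangle\cdots\langle\bm x_{i-1}\underline{*}x_{i1}\rangle\langle\widetilde{\bm x}_i\overline{*}x_{i1}\rangle\langle\bm x_{i+1}\overline{*}x_{i1}\rangle\cdots\langle\bm x_k\overline{*}x_{i1}\rangle+\sum_{j=1}^{n_i}(-1)^j\langle x_0\rangle\langle\bm x_1\rangle\cdots\langle x_{i1},\dots,x_{i(j-1)},x_{i(j+1)},\dots,x_{in_i}\rangle\cdots\langle\bm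 x_k\rangle\Bigr\},$$ with $\langle\widetilde{\bm x}_i\overline{*}x_{i1}\rangle=\langle(x_{i1}^{-1}x_{i2})\overline{*}x_{i1},\dots,(x_{i1}^{-1}x_{in_i})\overline{*}x_{i1}\rangle$; factors that become empty are omitted. For $\langle\bm a\rangle=\langle a_1,\dots,a_s\rangle$, $\langle\bm b\rangle=\langle b_1,\dots,b_t\rangle$ with all entries in one group $G_m$, put $$\langle\langle\bm a\rangle\langle\bm b\rangle\rangle=\sum_\mu(-1)^{\sum_{l=1}^s(\mu(l)-l)}\langle c_1,\dots,c_{s+t}\rangle,\qquad c_j=a_{\lfloor j;\mu\rfloor}\,b_{j-\lfloor j;\mu\rfloor},$$ over strictly increasing $\mu:\{1,\dots,s\}\to\{1,\dots,s+t\}$, where $\lfloor j;\mu\rfloor$ is the number of $l$ with $\mu(l)\le j$ and $a_0=b_0$ is the identity of $G_m$. $D_n(X;\mathbb Z)_X\subset P_n(X;\mathbb Z)_X$ is generated by all $\langle x_0\rangle\langle\bm a_1\rangle\cdots\langle\bm a\rangle\langle\bm b\rangle\cdots\langle\bm a_k\rangle-\langle x_0\rangle\langle\bm a_1\rangle\cdots\langle\langle\bm a\rangle\langle\bm b\rangle\rangle\cdots\langle\bm a_k\rangle$ (with $\bm a,\bm b$ having all entries in one $G_m$) for $n\ge2$, and $D_n=0$ for $n\le1$. It is known that $D_*$ is a subcomplex of the chain complex $P_*$; $C_*(X;\mathbb Z)_X=P_*/D_*$. An $n$-cocycle with values in an abelian group $B$ is a homomorphism $\Phi:C_n(X;\mathbb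 Z)_X\to B$ with $\Phi\circ\partial_{n+1}=0$. **Group complex.** $C_n^{\rm gp}(M;\mathbb Z)_G$ is the free abelian group on $M^n$ ($n\ge1$) modulo all $(m_1g,\dots,m_ng)-(m_1,\dots,m_n)$, $g\in G$, with boundary ($n\ge2$) $$\partial_n^{\rm gp}(m_1,\dots,m_n)=(m_2,\dots,m_n)+\sum_{i=1}^{n-1}(-1)^i(m_1,\dots,m_i+m_{i+1},\dots,m_n)+(-1)^n(m_1,\dots,m_{n-1}).$$ $D_n^{\rm gp}(M;\mathbb Z)_G$ ($n\ge2$) is the subgroup generated by the tuples $(m_1,\dots,m_n)$ with $m_i=0$ for some $1\le i\le n-1$, and $C_n^{\rm norgp}(M;\mathbb Z)_G=C_n^{\rm gp}(M;\mathbb Z)_G/D_n^{\rm gp}(M;\mathbb Z)_G$. A normalized group $n$-cocycle is a homomorphism $f:C_n^{\rm gp}(M;\mathbb Z)_G\to A$ vanishing on $D_n^{\rm gp}(M;\mathbb Z)_G$ (equivalently, defined on $C_n^{\rm norgp}(M;\mathbb Z)_G$) with $f\circ\partial_{n+1}^{\rm gp}=0$. **The maps.** For $n\ge1$, $C_n^{\rm BR}(X;\mathbb Z)_X$ is the free abelian group on $X\times X^n$, and $C_n^{\rm BR_U}(X;\mathbb Z)_X$ is the free abelian group on $G^{n+1}\times M^{n+1}$. - ${\rm proj}_n:P_n(X;\mathbb Z)_X\to C_n^{\rm BR}(X;\mathbb Z)_X$, for $n\ge2$, sends $\langle x_0\rangle\langle\bm x_1\rangle\cdots\langle\bm x_k\rangle$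 to $(x_0,x_{11},\dots,x_{k1})$ if $k=n$ and to $0$ otherwise; ${\rm proj}_n=0$ for $n\le1$. - $\gamma_n((m_0,g_0),\dots,(m_n,g_n))=(g_0,\dots,g_n;\,m_0-m_1,\dots,m_{n-1}-m_n,\,m_n)$. - $\psi_n(g_0,\dots,g_n;m_0,\dots,m_n)=\sum_{k\in\{0,1\}^n}(-1)^{k_1+\cdots+k_n}(m_0\bm g_{k,0},\dots,m_n\bm g_{k,n})\in C_{n+1}^{\rm gp}(M;\mathbb Z)_G$, where $\bm g_{k,0}=g_1^{k_1}\cdots g_n^{k_n}$ and $\bm g_{k,i}=\varphi(g_1^{k_1}\cdots g_i^{k_i})g_{i+1}^{k_{i+1}}\cdots g_n^{k_n}$ for $1\le i\le n$. - $\psi_{n,\lambda}(g_0,\dots,g_n;\bm m)=\psi_n(g_0,\dots,g_n;\bm m)\otimes\lambda(g_0)\in C_{n+1}^{\rm gp}(M;\mathbb Z)_G\otimes_{\mathbb Z}A$. The composites are formed on $P_n(X;\mathbb Z)_X$ and then regarded on the quotient $C_n(X;\mathbb Z)_X$. *)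

theory Defs
  imports "HOL-Algebra.Ring" "HOL-Algebra.Generated_Groups" "HOL-Algebra.Free_Abelian_Groups"
begin

text \<open>
  Free abelian groups are \<^const>\<open>free_Abelian_group\<close>, with formal integer
  combinations of type \<open>'a \<Rightarrow>\<^sub>0 int\<close>; quotients are \<^const>\<open>FactGroup\<close>, so that their
  elements are cosets.  A group homomorphism out of a free abelian group into another one is
  given on symbols and extended by \<^const>\<open>frag_extend\<close>.
\<close>

text \<open>
  The map \<open>F/N \<rightarrow> H/K\<close> induced by \<open>h : F \<rightarrow> H\<close> with \<open>h(N) \<subseteq> K\<close>.  Under this inclusion the
  value at the coset of \<open>c\<close> is the coset of \<open>h c\<close>.
\<close>
definition induced_map ::
    "('b, 'c) monoid_scheme \<Rightarrow> 'b set \<Rightarrow> ('a \<Rightarrow> 'b) \<Rightarrow> 'a set \<Rightarrow> 'b set" where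
  "induced_map H K h C = K <#>\<^bsub>H\<^esub> (h ` C)"


section \<open>Right modules over the integral group ring\<close>

definition group_ring :: "('g, 'r) monoid_scheme \<Rightarrow> ('g \<Rightarrow>\<^sub>0 int) ring" where
  "group_ring G =
     \<lparr>carrier = {c. Poly_Mapping.keys c \<subseteq> carrier G},
      monoid.mult = (\<lambda>c d. frag_extend (\<lambda>g. frag_extend (\<lambda>h. frag_of (g \<otimes>\<^bsub>G\<^esub> h)) d) c),
      one = frag_of \<one>\<^bsub>G\<^esub>,
      ring.zero = 0,
      ring.add = (+)\<rparr>"

locale right_module = R?: ring R + M?: abelian_group M
  for R :: "('r, 'a) ring_scheme" and M :: "('m, 'b) ring_scheme"
    and act :: "'m \<Rightarrow> 'r \<Rightarrow> 'm" +
  assumes act_closed: "\<lbrakk>m \<in> carrier M; r \<in> carrier R\<rbrakk> \<Longrightarrow> act m r \<in> carrier M"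
    and act_add_left: "\<lbrakk>m \<in> carrier M; n \<in> carrier M; r \<in> carrier R\<rbrakk>
          \<Longrightarrow> act (m \<oplus>\<^bsub>M\<^esub> n) r = act m r \<oplus>\<^bsub>M\<^esub> act n r"
    and act_add_right: "\<lbrakk>m \<in> carrier M; r \<in> carrier R; s \<in> carrier R\<rbrakk>
          \<Longrightarrow> act m (r \<oplus>\<^bsub>R\<^esub> s) = act m r \<oplus>\<^bsub>M\<^esub> act m s"
    and act_mult: "\<lbrakk>m \<in> carrier M; r \<in> carrier R; s \<in> carrier R\<rbrakk>
          \<Longrightarrow> act m (r \<otimes>\<^bsub>R\<^esub> s) = act (act m r) s"
    and act_one: "m \<in> carrier M \<Longrightarrow> act m \<one>\<^bsub>R\<^esub> = m"

lemma frag_extend_plus_fun: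
  "frag_extend (\<lambda>x. f x + g x) c = frag_extend f c + frag_extend g c"
  by (simp add: frag_extend_def frag_cmul_distrib2 sum.distrib)

lemma ring_group_ring:
  assumes "group G"
  shows "ring (group_ring G)"
proof -
  interpret G: group G by fact
  define mu where "mu = (\<lambda>c d. frag_extend (\<lambda>g. frag_extend (\<lambda>h. frag_of (g \<otimes>\<^bsub>G\<^esub> h)) d) c)"
  let ?C = "{c. Poly_Mapping.keys c \<subseteq> carrier G}"
  have R: "carrier (group_ring G) = ?C" "monoid.mult (group_ring G) = mu"
    "monoid.one (group_ring G) = frag_of \<one>\<^bsub>G\<^esub>" "ring.zero (group_ring G) = 0" "ring.add (group_ring G) = (+)"
    by (simp_all add: group_ring_def mu_def)
  have sg: "mu (frag_of g) (frag_of h) = frag_of (g \<otimes>\<^bsub>G\<^esub> h)" for g h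
    by (simp add: mu_def)
  have l: "mu (a + b) c = mu a c + mu b c" "mu c (a + b) = mu c a + mu c b"
    "mu (a - b) c = mu a c - mu b c" "mu c (a - b) = mu c a - mu c b"
    "mu 0 c = 0" "mu c 0 = 0" for a b c
  proof -
    show add: "mu (a + b) c = mu a c + mu b c" "mu c (a + b) = mu c a + mu c b" for a b c
      by (simp_all add: mu_def frag_extend_add frag_extend_plus_fun)
    show "mu (a - b) c = mu a c - mu b c" "mu c (a - b) = mu c a - mu c b"
      using add(1)[of "a - b" b c] add(2)[of c "a - b" b] by (simp_all add: algebra_simps)
    show "mu 0 c = 0" "mu c 0 = 0"
      using add(1)[of 0 0 c] add(2)[of c 0 0] by simp_all
  qed
  have closed: "mu a b \<in> ?C" if "a \<in> ?C" "b \<in> ?C" for a b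
  proof -
    have inner: "Poly_Mapping.keys (frag_extend (\<lambda>h. frag_of (g \<otimes>\<^bsub>G\<^esub> h)) b) \<subseteq> carrier G"
      if "g \<in> carrier G" for g
      by (rule order_trans[OF keys_frag_extend]) (use that \<open>b \<in> ?C\<close> in auto)
    have "Poly_Mapping.keys (mu a b) \<subseteq> carrier G"
      unfolding mu_def
      by (rule order_trans[OF keys_frag_extend], rule UN_least, rule inner)
        (use \<open>a \<in> ?C\<close> in auto)
    then show ?thesis by simp
  qed
  have assoc: "mu (mu a b) c = mu a (mu b c)" if "a \<in> ?C" "b \<in> ?C" "c \<in> ?C" for a b c
  proof -
    have 1: "mu (mu (frag_of x) (frag_of y)) c = mu (frag_of x) (mu (frag_of y) c)"
      if "x \<in> carrier G" "y \<in> carrier G" for x y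
      using \<open>c \<in> ?C\<close>[simplified]
      by (induction c rule: frag_induction) (use that in \<open>auto simp: l sg G.m_assoc\<close>)
    have 2: "mu (mu (frag_of x) b) c = mu (frag_of x) (mu b c)" if "x \<in> carrier G" for x
      using \<open>b \<in> ?C\<close>[simplified]
      by (induction b rule: frag_induction) (use that 1 in \<open>auto simp: l\<close>)
    show ?thesis
      using \<open>a \<in> ?C\<close>[simplified]
      by (induction a rule: frag_induction) (use 2 in \<open>auto simp: l\<close>)
  qed
  have one: "mu (frag_of \<one>\<^bsub>G\<^esub>) a = a" "mu a (frag_of \<one>\<^bsub>G\<^esub>) = a" if "a \<in> ?C" for a
    using that[simplified]
    by (induction a rule: frag_induction) (auto simp: l sg)
  have "abelian_group (group_ring G)"
  proof (rule abelian_groupI)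
    fix x assume "x \<in> carrier (group_ring G)"
    then show "\<exists>y\<in>carrier (group_ring G). y \<oplus>\<^bsub>group_ring G\<^esub> x = \<zero>\<^bsub>group_ring G\<^esub>"
      by (intro bexI[of _ "- x"]) (simp_all add: R)
  next
    fix x y assume "x \<in> carrier (group_ring G)" "y \<in> carrier (group_ring G)"
    then show "x \<oplus>\<^bsub>group_ring G\<^esub> y \<in> carrier (group_ring G)"
      using keys_add[of x y] by (auto simp: R)
  qed (simp_all add: R add_ac)
  moreover have "monoid (group_ring G)"
    by (rule monoidI) (use closed assoc one in \<open>simp_all add: R\<close>)
  ultimately show ?thesis
    by (rule ringI) (simp_all add: R l(1,2))
qed


section \<open>Tensor products of abelian groups\<close>

definition tensor_rel ::
    "('a, 'r) monoid_scheme \<Rightarrow> ('b, 's) monoid_scheme \<Rightarrow> (('a \<times> 'b) \<Rightarrow>\<^sub>0 int) set" where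
  "tensor_rel A B = generate (free_Abelian_group (carrier A \<times> carrier B))
     ({frag_of (a \<otimes>\<^bsub>A\<^esub> a', b) - frag_of (a, b) - frag_of (a', b) | a a' b.
         a \<in> carrier A \<and> a' \<in> carrier A \<and> b \<in> carrier B} \<union>
      {frag_of (a, b \<otimes>\<^bsub>B\<^esub> b') - frag_of (a, b) - frag_of (a, b') | a b b'.
         a \<in> carrier A \<and> b \<in> carrier B \<and> b' \<in> carrier B})"

definition tensor ::
    "('a, 'r) monoid_scheme \<Rightarrow> ('b, 's) monoid_scheme \<Rightarrow> (('a \<times> 'b) \<Rightarrow>\<^sub>0 int) set monoid" where
  "tensor A B = free_Abelian_group (carrier A \<times> carrier B) Mod tensor_rel A B"

text \<open>The homomorphism \<open>f \<otimes> g\<close> with values in \<open>tensor A' B'\<close>.\<close>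
definition tensor_map ::
    "('c, 'r) monoid_scheme \<Rightarrow> ('d, 's) monoid_scheme \<Rightarrow> ('a \<Rightarrow> 'c) \<Rightarrow> ('b \<Rightarrow> 'd)
     \<Rightarrow> (('a \<times> 'b) \<Rightarrow>\<^sub>0 int) set \<Rightarrow> (('c \<times> 'd) \<Rightarrow>\<^sub>0 int) set" where
  "tensor_map A' B' f g =
     induced_map (free_Abelian_group (carrier A' \<times> carrier B')) (tensor_rel A' B')
       (frag_extend (\<lambda>(a, b). frag_of (f a, g b)))"


section \<open>Multiple conjugation biquandles and their chain complex\<close>

text \<open>
  The operations of a multiple conjugation biquandle; \<open>component X x\<close> is the group
  containing \<open>x\<close> in the decomposition of \<open>X\<close> into a disjoint union of groups.
\<close>
record 'x mcb = "'x partial_object" +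
  component :: "'x \<Rightarrow> 'x monoid"
  under_op :: "'x \<Rightarrow> 'x \<Rightarrow> 'x"
  over_op :: "'x \<Rightarrow> 'x \<Rightarrow> 'x"

definition alexander_component ::
    "('g, 'r) monoid_scheme \<Rightarrow> 'm \<Rightarrow> ('m \<times> 'g) monoid" where
  "alexander_component G m =
     \<lparr>carrier = {m} \<times> carrier G,
      monoid.mult = (\<lambda>(_, g) (_, h). (m, g \<otimes>\<^bsub>G\<^esub> h)),
      one = (m, \<one>\<^bsub>G\<^esub>)\<rparr>"

text \<open>Here \<open>frag_of g\<close> is the group element \<open>g\<close> regarded in the group ring.\<close>
definition alexander_mcb ::
    "('g, 'r) monoid_scheme \<Rightarrow> ('m, 's) ring_scheme \<Rightarrow> ('m \<Rightarrow> ('g \<Rightarrow>\<^sub>0 int) \<Rightarrow> 'm)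
     \<Rightarrow> ('g \<Rightarrow> 'g) \<Rightarrow> ('m \<times> 'g) mcb" where
  "alexander_mcb G M act \<phi> =
     \<lparr>carrier = carrier M \<times> carrier G,
      component = (\<lambda>(m, g). alexander_component G m),
      under_op = (\<lambda>(m, g) (n, h).
        (act m (frag_of h) \<oplus>\<^bsub>M\<^esub> act n (frag_of (\<phi> h) - frag_of h),
         inv\<^bsub>G\<^esub> h \<otimes>\<^bsub>G\<^esub> g \<otimes>\<^bsub>G\<^esub> h)),
      over_op = (\<lambda>(m, g) (n, h). (act m (frag_of (\<phi> h)), g))\<rparr>"

text \<open>
  A symbol \<open>\<langle>x\<^sub>0\<rangle>\<langle>\<^bold>x\<^sub>1\<rangle>\<dots>\<langle>\<^bold>x\<^sub>k\<rangle>\<close> is the pair \<open>(x\<^sub>0, [\<^bold>x\<^sub>1, \<dots>, \<^bold>x\<^sub>k])\<close>.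
\<close>
type_synonym 'x symb = "'x \<times> 'x list list"

definition in_one_component :: "('x, 'z) mcb_scheme \<Rightarrow> 'x set \<Rightarrow> bool" where
  "in_one_component X S \<longleftrightarrow> (\<exists>x\<in>carrier X. S \<subseteq> carrier (component X x))"

definition mcb_symbols :: "('x, 'z) mcb_scheme \<Rightarrow> nat \<Rightarrow> 'x symb set" where
  "mcb_symbols X n =
     {(x\<^sub>0, xss). x\<^sub>0 \<in> carrier X \<and>
        (\<forall>xs\<in>set xss. xs \<noteq> [] \<and> in_one_component X (set xs)) \<and>
        sum_list (map length xss) = n}"

definition mcb_P :: "('x, 'z) mcb_scheme \<Rightarrow> nat \<Rightarrow> ('x symb \<Rightarrow>\<^sub>0 int) monoid" where
  "mcb_P X n = free_Abelian_group (mcb_symbols X n)"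

definition mk_symb :: "'x \<Rightarrow> 'x list list \<Rightarrow> 'x symb \<Rightarrow>\<^sub>0 int" where
  "mk_symb x\<^sub>0 xss = frag_of (x\<^sub>0, filter (\<lambda>xs. xs \<noteq> []) xss)"

text \<open>
  The summand of the boundary belonging to \<open>xss ! i\<close>, where \<open>i\<close> counts from 0, without its
  sign: first the face involving the operations, then the deletions of the \<open>j\<close>-th entry
  (\<open>j\<close> counts from 1).
\<close>
definition mcb_face :: "('x, 'z) mcb_scheme \<Rightarrow> 'x symb \<Rightarrow> nat \<Rightarrow> 'x symb \<Rightarrow>\<^sub>0 int" where
  "mcb_face X = (\<lambda>(x\<^sub>0, xss) i.
     let xs = xss ! i; y = hd xs; H = component X y in
       mk_symb (under_op X x\<^sub>0 y)
         (map (map (\<lambda>x. under_op X x y)) (take i xss) @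
          [map (\<lambda>x. over_op X (inv\<^bsub>H\<^esub> y \<otimes>\<^bsub>H\<^esub> x) y) (tl xs)] @
          map (map (\<lambda>x. over_op X x y)) (drop (Suc i) xss)) +
       (\<Sum>j = 1..length xs.
          frag_cmul ((-1) ^ j) (mk_symb x\<^sub>0 (xss[i := take (j - 1) xs @ drop j xs]))))"

text \<open>One formula serves all degrees; it vanishes on symbols of degree 0.\<close>
definition mcb_boundary ::
    "('x, 'z) mcb_scheme \<Rightarrow> ('x symb \<Rightarrow>\<^sub>0 int) \<Rightarrow> ('x symb \<Rightarrow>\<^sub>0 int)" where
  "mcb_boundary X = frag_extend (\<lambda>(x\<^sub>0, xss).
     \<Sum>i<length xss.
       frag_cmul ((-1) ^ sum_list (map length (take i xss))) (mcb_face X (x\<^sub>0, xss) i))"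

text \<open>
  Strictly increasing \<open>\<mu>\<close> satisfy \<open>\<mu> l \<ge> l\<close>, so the truncated subtraction in the sign is exact.
  The \<open>j\<close>-th entry \<open>c\<^sub>j = a\<^bsub>\<lfloor>j;\<mu>\<rfloor>\<^esub> b\<^bsub>j - \<lfloor>j;\<mu>\<rfloor>\<^esub>\<close> uses the convention \<open>a\<^sub>0 = b\<^sub>0 = \<one>\<close>.
\<close>
definition increasing_maps :: "nat \<Rightarrow> nat \<Rightarrow> (nat \<Rightarrow> nat) set" where
  "increasing_maps s N = {\<mu> \<in> {1..s} \<rightarrow>\<^sub>E {1..N}. strict_mono_on {1..s} \<mu>}"

definition shuffle_sign :: "nat \<Rightarrow> (nat \<Rightarrow> nat) \<Rightarrow> int" where
  "shuffle_sign s \<mu> = (-1) ^ (\<Sum>l = 1..s. \<mu> l - l)"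

definition shuffle_word ::
    "('x, 'r) monoid_scheme \<Rightarrow> 'x list \<Rightarrow> 'x list \<Rightarrow> (nat \<Rightarrow> nat) \<Rightarrow> 'x list" where
  "shuffle_word H as bs \<mu> =
     map (\<lambda>j. let p = card {l \<in> {1..length as}. \<mu> l \<le> j} in
              (\<one>\<^bsub>H\<^esub> # as) ! p \<otimes>\<^bsub>H\<^esub> (\<one>\<^bsub>H\<^esub> # bs) ! (j - p))
       [1..<Suc (length as + length bs)]"

text \<open>
  The generating set is empty for \<open>n \<le> 1\<close>, as both \<open>as\<close> and \<open>bs\<close> are nonempty.
\<close>
definition mcb_D :: "('x, 'z) mcb_scheme \<Rightarrow> nat \<Rightarrow> ('x symb \<Rightarrow>\<^sub>0 int) set" where
  "mcb_D X n = generate (mcb_P X n)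
     {frag_of (x\<^sub>0, uss @ [as, bs] @ vss) -
      (\<Sum>\<mu> \<in> increasing_maps (length as) (length as + length bs).
         frag_cmul (shuffle_sign (length as) \<mu>)
           (frag_of (x\<^sub>0, uss @ [shuffle_word (component X (hd as)) as bs \<mu>] @ vss)))
      | x\<^sub>0 uss as bs vss.
        (x\<^sub>0, uss @ [as, bs] @ vss) \<in> mcb_symbols X n \<and> in_one_component X (set as \<union> set bs)}"

definition mcb_C :: "('x, 'z) mcb_scheme \<Rightarrow> nat \<Rightarrow> ('x symb \<Rightarrow>\<^sub>0 int) set monoid" where
  "mcb_C X n = mcb_P X n Mod mcb_D X n"

text \<open>The boundary from degree \<open>n\<close> to degree \<open>n - 1\<close>, for \<open>n \<ge> 1\<close>.\<close>
definition mcb_C_boundary ::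
    "('x, 'z) mcb_scheme \<Rightarrow> nat \<Rightarrow> ('x symb \<Rightarrow>\<^sub>0 int) set \<Rightarrow> ('x symb \<Rightarrow>\<^sub>0 int) set" where
  "mcb_C_boundary X n = induced_map (mcb_P X (n - 1)) (mcb_D X (n - 1)) (mcb_boundary X)"

definition mcb_cocycle ::
    "('x, 'z) mcb_scheme \<Rightarrow> nat \<Rightarrow> ('b, 'r) monoid_scheme \<Rightarrow> (('x symb \<Rightarrow>\<^sub>0 int) set \<Rightarrow> 'b) \<Rightarrow> bool"
  where
  "mcb_cocycle X n B \<Phi> \<longleftrightarrow>
     \<Phi> \<in> hom (mcb_C X n) B \<and>
     (\<forall>c\<in>carrier (mcb_C X (n + 1)). \<Phi> (mcb_C_boundary X (n + 1) c) = \<one>\<^bsub>B\<^esub>)"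


section \<open>The group complex of a right module\<close>

definition tuples :: "('m, 's) ring_scheme \<Rightarrow> nat \<Rightarrow> 'm list set" where
  "tuples M n = {ms. length ms = n \<and> set ms \<subseteq> carrier M}"

definition gp_rel ::
    "('g, 'r) monoid_scheme \<Rightarrow> ('m, 's) ring_scheme \<Rightarrow> ('m \<Rightarrow> ('g \<Rightarrow>\<^sub>0 int) \<Rightarrow> 'm) \<Rightarrow> nat
     \<Rightarrow> ('m list \<Rightarrow>\<^sub>0 int) set" where
  "gp_rel G M act n = generate (free_Abelian_group (tuples M n))
     {frag_of (map (\<lambda>m. act m (frag_of g)) ms) - frag_of ms | ms g.
        ms \<in> tuples M n \<and> g \<in> carrier G}"

definition gp_C ::
    "('g, 'r) monoid_scheme \<Rightarrow> ('m, 's) ring_scheme \<Rightarrow> ('m \<Rightarrow> ('g \<Rightarrow>\<^sub>0 int) \<Rightarrow> 'm) \<Rightarrow> nat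
     \<Rightarrow> ('m list \<Rightarrow>\<^sub>0 int) set monoid" where
  "gp_C G M act n = free_Abelian_group (tuples M n) Mod gp_rel G M act n"

definition gp_class ::
    "('g, 'r) monoid_scheme \<Rightarrow> ('m, 's) ring_scheme \<Rightarrow> ('m \<Rightarrow> ('g \<Rightarrow>\<^sub>0 int) \<Rightarrow> 'm) \<Rightarrow> nat
     \<Rightarrow> ('m list \<Rightarrow>\<^sub>0 int) \<Rightarrow> ('m list \<Rightarrow>\<^sub>0 int) set" where
  "gp_class G M act n c = gp_rel G M act n #>\<^bsub>free_Abelian_group (tuples M n)\<^esub> c"

text \<open>The list \<open>ms\<close> counts from 0: \<open>m\<^sub>i\<close> is \<open>ms ! (i - 1)\<close>.\<close>
definition gp_boundary_tuple :: "('m, 's) ring_scheme \<Rightarrow> 'm list \<Rightarrow> ('m list \<Rightarrow>\<^sub>0 int)" where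
  "gp_boundary_tuple M ms =
     frag_of (tl ms) +
     (\<Sum>i = 1..<length ms. frag_cmul ((-1) ^ i)
        (frag_of (take (i - 1) ms @ [ms ! (i - 1) \<oplus>\<^bsub>M\<^esub> ms ! i] @ drop (i + 1) ms))) +
     frag_cmul ((-1) ^ length ms) (frag_of (butlast ms))"

text \<open>The boundary from degree \<open>n\<close> to degree \<open>n - 1\<close>, for \<open>n \<ge> 2\<close>.\<close>
definition gp_boundary ::
    "('g, 'r) monoid_scheme \<Rightarrow> ('m, 's) ring_scheme \<Rightarrow> ('m \<Rightarrow> ('g \<Rightarrow>\<^sub>0 int) \<Rightarrow> 'm) \<Rightarrow> nat
     \<Rightarrow> ('m list \<Rightarrow>\<^sub>0 int) set \<Rightarrow> ('m list \<Rightarrow>\<^sub>0 int) set" where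
  "gp_boundary G M act n =
     induced_map (free_Abelian_group (tuples M (n - 1))) (gp_rel G M act (n - 1))
       (frag_extend (gp_boundary_tuple M))"

text \<open>The last entry of a tuple is deliberately not required to be nonzero.\<close>
definition gp_D ::
    "('g, 'r) monoid_scheme \<Rightarrow> ('m, 's) ring_scheme \<Rightarrow> ('m \<Rightarrow> ('g \<Rightarrow>\<^sub>0 int) \<Rightarrow> 'm) \<Rightarrow> nat
     \<Rightarrow> ('m list \<Rightarrow>\<^sub>0 int) set set" where
  "gp_D G M act n = generate (gp_C G M act n)
     {gp_class G M act n (frag_of ms) | ms.
        ms \<in> tuples M n \<and> (\<exists>i\<in>{1..n - 1}. ms ! (i - 1) = \<zero>\<^bsub>M\<^esub>)}"

definition normalized_gp_cocycle ::
    "('g, 'r) monoid_scheme \<Rightarrow> ('m, 's) ring_scheme \<Rightarrow> ('m \<Rightarrow> ('g \<Rightarrow>\<^sub>0 int) \<Rightarrow> 'm) \<Rightarrow> nat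
     \<Rightarrow> ('a, 't) monoid_scheme \<Rightarrow> (('m list \<Rightarrow>\<^sub>0 int) set \<Rightarrow> 'a) \<Rightarrow> bool" where
  "normalized_gp_cocycle G M act n A f \<longleftrightarrow>
     f \<in> hom (gp_C G M act n) A \<and>
     (\<forall>c\<in>gp_D G M act n. f c = \<one>\<^bsub>A\<^esub>) \<and>
     (\<forall>c\<in>carrier (gp_C G M act (n + 1)). f (gp_boundary G M act (n + 1) c) = \<one>\<^bsub>A\<^esub>)"


section \<open>The comparison maps\<close>

definition group_center :: "('g, 'r) monoid_scheme \<Rightarrow> 'g set" where
  "group_center G = {z \<in> carrier G. \<forall>g\<in>carrier G. z \<otimes>\<^bsub>G\<^esub> g = g \<otimes>\<^bsub>G\<^esub> z}"

text \<open>
  A basis element \<open>(x\<^sub>0, x\<^sub>1, \<dots>, x\<^sub>n)\<close> of the middle complex is the pair \<open>(x\<^sub>0, [x\<^sub>1, \<dots>, x\<^sub>n])\<close>,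
  and \<open>(g\<^sub>0, \<dots>, g\<^sub>n; m\<^sub>0, \<dots>, m\<^sub>n)\<close> is the pair \<open>([g\<^sub>0, \<dots>, g\<^sub>n], [m\<^sub>0, \<dots>, m\<^sub>n])\<close>.
\<close>
definition proj_map :: "nat \<Rightarrow> ('x symb \<Rightarrow>\<^sub>0 int) \<Rightarrow> (('x \<times> 'x list) \<Rightarrow>\<^sub>0 int)" where
  "proj_map n =
     (if n \<le> 1 then (\<lambda>c. 0)
      else frag_extend (\<lambda>(x\<^sub>0, xss).
        if length xss = n then frag_of (x\<^sub>0, map hd xss) else 0))"

definition gamma_map ::
    "('m, 's) ring_scheme \<Rightarrow> nat \<Rightarrow> ((('m \<times> 'g) \<times> ('m \<times> 'g) list) \<Rightarrow>\<^sub>0 int)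
     \<Rightarrow> (('g list \<times> 'm list) \<Rightarrow>\<^sub>0 int)" where
  "gamma_map M n = frag_extend (\<lambda>(x\<^sub>0, xs).
     let m = (\<lambda>i. fst ((x\<^sub>0 # xs) ! i)) in
       frag_of (map snd (x\<^sub>0 # xs),
         map (\<lambda>i. m i \<ominus>\<^bsub>M\<^esub> m (i + 1)) [0..<n] @ [m n]))"

text \<open>The ordered product \<open>g\<^sub>a\<^bsup>k\<^sub>a\<^esup> \<dots> g\<^sub>b\<^bsup>k\<^sub>b\<^esup>\<close>, which is \<open>\<one>\<close> if \<open>b < a\<close>.\<close>
definition power_prod ::
    "('g, 'r) monoid_scheme \<Rightarrow> 'g list \<Rightarrow> (nat \<Rightarrow> nat) \<Rightarrow> nat \<Rightarrow> nat \<Rightarrow> 'g" where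
  "power_prod G gs k a b =
     foldr (\<lambda>i x. (gs ! i) [^]\<^bsub>G\<^esub> k i \<otimes>\<^bsub>G\<^esub> x) [a..<Suc b] \<one>\<^bsub>G\<^esub>"

definition psi_weight ::
    "('g, 'r) monoid_scheme \<Rightarrow> ('g \<Rightarrow> 'g) \<Rightarrow> nat \<Rightarrow> 'g list \<Rightarrow> (nat \<Rightarrow> nat) \<Rightarrow> nat \<Rightarrow> 'g" where
  "psi_weight G \<phi> n gs k i =
     (if i = 0 then power_prod G gs k 1 n
      else \<phi> (power_prod G gs k 1 i) \<otimes>\<^bsub>G\<^esub> power_prod G gs k (i + 1) n)"

definition psi_map ::
    "('g, 'r) monoid_scheme \<Rightarrow> ('m, 's) ring_scheme \<Rightarrow> ('m \<Rightarrow> ('g \<Rightarrow>\<^sub>0 int) \<Rightarrow> 'm)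
     \<Rightarrow> ('g \<Rightarrow> 'g) \<Rightarrow> nat \<Rightarrow> (('g list \<times> 'm list) \<Rightarrow>\<^sub>0 int) \<Rightarrow> ('m list \<Rightarrow>\<^sub>0 int) set" where
  "psi_map G M act \<phi> n c = gp_class G M act (n + 1)
     (frag_extend (\<lambda>(gs, ms).
        \<Sum>k \<in> {1..n} \<rightarrow>\<^sub>E {0, 1}. frag_cmul ((-1) ^ (\<Sum>i = 1..n. k i))
          (frag_of (map (\<lambda>i. act (ms ! i) (frag_of (psi_weight G \<phi> n gs k i))) [0..<Suc n])))
      c)"

text \<open>
  The homomorphism with values in \<open>tensor (gp_C G M act (n + 1)) A\<close> that sends
  \<open>(g\<^sub>0, \<dots>, g\<^sub>n; \<^bold>m)\<close> to the class of \<open>\<psi>\<^sub>n(g\<^sub>0, \<dots>, g\<^sub>n; \<^bold>m) \<otimes> lam g\<^sub>0\<close>.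
\<close>
definition psi_lam_map ::
    "('g, 'r) monoid_scheme \<Rightarrow> ('m, 's) ring_scheme \<Rightarrow> ('m \<Rightarrow> ('g \<Rightarrow>\<^sub>0 int) \<Rightarrow> 'm)
     \<Rightarrow> ('g \<Rightarrow> 'g) \<Rightarrow> ('a, 't) monoid_scheme \<Rightarrow> ('g \<Rightarrow> 'a) \<Rightarrow> nat
     \<Rightarrow> (('g list \<times> 'm list) \<Rightarrow>\<^sub>0 int) \<Rightarrow> ((('m list \<Rightarrow>\<^sub>0 int) set \<times> 'a) \<Rightarrow>\<^sub>0 int) set" where
  "psi_lam_map G M act \<phi> A lam n c =
     tensor_rel (gp_C G M act (n + 1)) A
       #>\<^bsub>free_Abelian_group (carrier (gp_C G M act (n + 1)) \<times> carrier A)\<^esub>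
     frag_extend (\<lambda>(gs, ms). frag_of (psi_map G M act \<phi> n (frag_of (gs, ms)), lam (gs ! 0))) c"

end

theory Submission
  imports Defs
begin

text \<open>
  Let \<open>x\<^sub>0, \<dots>, x\<^sub>n\<close> be points \<open>x\<^sub>i = (m\<^sub>i, g\<^sub>i)\<close> of the Alexander biquandle.  The composite
  \<open>\<psi>\<^sub>n \<circ> \<gamma>\<^sub>n \<circ> proj\<^sub>n\<close> sends \<open>\<langle>x\<^sub>0\<rangle>\<langle>x\<^sub>1\<rangle>\<dots>\<langle>x\<^sub>n\<rangle>\<close> to an alternating sum over the vertices of an
  \<open>n\<close>-cube.  A vertex chooses \<open>e\<^sub>i \<in> {\<one>, g\<^sub>i}\<close> for \<open>1 \<le> i \<le> n\<close>, and its summand is the tuple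
  \<open>T = (d\<^sub>0 w\<^sub>0, \<dots>, d\<^sub>n w\<^sub>n)\<close> with \<open>d\<^sub>i = m\<^sub>i - m\<^bsub>i+1\<^esub>\<close>, \<open>d\<^sub>n = m\<^sub>n\<close> and
  \<open>w\<^sub>i = \<phi>(e\<^sub>1 \<dots> e\<^sub>i) e\<^bsub>i+1\<^esub> \<dots> e\<^sub>n\<close>.  The theorem comes from three properties of this tuple.

  \<^item> Faces (\<open>diff_tuple_face\<close>).  Acting on the other points by \<open>(m\<^sub>i, e\<^sub>i)\<close>, with the lower operation
    to the left of position \<open>i\<close> and the upper one to the right, and then dropping position \<open>i\<close>, replaces
    the entries \<open>i - 1\<close> and \<open>i\<close> of \<open>T\<close> by their sum.  Since \<open>(m\<^sub>i, \<one>)\<close> acts trivially, the case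
    \<open>e\<^sub>i = \<one>\<close> is the plain deletion of \<open>x\<^sub>i\<close>.  So the two faces that remove \<open>x\<^sub>i\<close> are the two halves of
    the cube in direction \<open>i\<close>, and for symbols with singleton blocks the biquandle boundary becomes
    the inner part of the group boundary.  The two outer terms of the group boundary, which drop the
    first or the last entry, cancel in pairs of opposite vertices: \<open>e\<^sub>1\<close> affects the entries after the
    first only through the common factor \<open>\<phi>(e\<^sub>1)\<close>, and \<open>e\<^sub>n\<close> affects those before the last only
    through the common factor \<open>e\<^sub>n\<close>, and group chains are coinvariants of \<open>G\<close>.
  \<^item> Splitting (\<open>diff_tuple_split\<close>).  For a block \<open>\<langle>(m, a), (m, b)\<rangle>\<close> the face with the operations
    leaves the point \<open>(m \<phi>(a), a\<^sup>-\<^sup>1 b)\<close>, whose two choices \<open>\<one>\<close> and \<open>a\<^sup>-\<^sup>1 b\<close> give the tuples of the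
    choices \<open>a\<close> and \<open>b\<close> at this position.  Hence the three faces of such a block cancel.
  \<^item> Degeneracy (\<open>diff_tuple_zero\<close>).  Adjacent blocks in one component have equal module parts, so
    some \<open>d\<^sub>i\<close> with \<open>1 \<le> i < n\<close> is \<open>0\<close> and the normalized cocycle vanishes on \<open>T\<close>.  The shuffles of
    the two blocks have too few blocks to survive the projection.

  The factor \<open>\<lambda>(g\<^sub>0)\<close> is carried along as a label of the tuples.  The boundary at most conjugates
  \<open>g\<^sub>0\<close>, which does not change \<open>\<lambda>(g\<^sub>0)\<close>.  Both maps of the theorem are therefore instances of
  \<open>cocycle_of_labelled_group_cocycle\<close>, which concerns homomorphisms on the free abelian group of
  labelled tuples: for the first map the label is forgotten, for the second it becomes the right
  tensor factor.
\<close>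

section \<open>Alternating sums over the vertices of a cube\<close>

text \<open>
  The alternating sum of \<open>F\<close> over the vertices of a cube with one direction per entry of the list: a
  vertex keeps the second component of an entry, with sign \<open>-1\<close>, or replaces it by \<open>u\<close>.  The recursion,
  in contrast to a sum over exponent functions, lets a direction at any position be split off by
  \<open>cube_append\<close>.
\<close>
fun cube :: "'g \<Rightarrow> (('m \<times> 'g) list \<Rightarrow> 'w::ab_group_add) \<Rightarrow> ('m \<times> 'g) list \<Rightarrow> 'w" where
  "cube u F [] = F []"
| "cube u F (x # xs) = cube u (\<lambda>ps. F ((fst x, u) # ps) - F (x # ps)) xs"

lemma cube_cong:
  assumes "\<And>ps. list_all2 (\<lambda>p x. p = (fst x, u) \<or> p = x) ps xs \<Longrightarrow> F ps = F' ps"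
  shows "cube u F xs = cube u F' xs"
  using assms
proof (induction xs arbitrary: F F')
  case (Cons x xs)
  show ?case
    unfolding cube.simps by (rule Cons.IH) (auto intro!: arg_cong2[of _ _ _ _ "(-)"] Cons.prems)
qed simp

lemma cube_diff: "cube u (\<lambda>ps. F ps - F' ps) xs = cube u F xs - cube u F' xs"
proof (induction xs arbitrary: F F')
  case (Cons x xs)
  show ?case
    unfolding cube.simps Cons.IH[symmetric] by (simp add: algebra_simps)
qed simp

lemma cube_zero [simp]: "cube u (\<lambda>ps. 0) xs = 0"
  using cube_diff[of u "\<lambda>ps. 0" "\<lambda>ps. 0" xs] by simp

lemma cube_uminus: "cube u (\<lambda>ps. - F ps) xs = - cube u F xs"
  using cube_diff[of u "\<lambda>ps. 0" F xs] by simp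

lemma cube_add: "cube u (\<lambda>ps. F ps + F' ps) xs = cube u F xs + cube u F' xs"
  using cube_diff[of u F "\<lambda>ps. - F' ps" xs] by (simp add: cube_uminus)

lemma cube_of_sum: "cube u (\<lambda>ps. \<Sum>i\<in>I. F i ps) xs = (\<Sum>i\<in>I. cube u (F i) xs)"
  by (induction I rule: infinite_finite_induct) (simp_all add: cube_add)

lemma cube_frag_extend: "cube u (\<lambda>ps. frag_extend h (F ps)) xs = frag_extend h (cube u F xs)"
  by (induction xs arbitrary: F) (simp_all flip: frag_extend_diff)

lemma frag_cmul_uminus: "frag_cmul c (- x) = - frag_cmul c x"
  by (simp flip: frag_cmul_minus_one)

lemma frag_cmul_diff: "frag_cmul c (x - y) = frag_cmul c x - frag_cmul c y"
  using frag_cmul_distrib2[of c x "- y"] by (simp add: frag_cmul_uminus del: minus_frag_cmul)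

lemma cube_frag_cmul:
  fixes F :: "('m \<times> 'g) list \<Rightarrow> 'b \<Rightarrow>\<^sub>0 int"
  shows "cube u (\<lambda>ps. frag_cmul c (F ps)) xs = frag_cmul c (cube u F xs)"
proof -
  have "frag_extend (\<lambda>x. frag_cmul c (frag_of x)) a = frag_cmul c a" for a :: "'b \<Rightarrow>\<^sub>0 int"
    by (induction a rule: frag_induction[OF subset_UNIV]) (simp_all add: frag_extend_diff frag_cmul_diff)
  then show ?thesis
    using cube_frag_extend[of u "\<lambda>x. frag_cmul c (frag_of x)" F xs] by simp
qed

lemma cube_append: "cube u F (xs @ ys) = cube u (\<lambda>ps. cube u (\<lambda>qs. F (ps @ qs)) ys) xs"
  by (induction xs arbitrary: F) (simp_all add: cube_diff)

text \<open>
  A map of the entries acts on the vertices of the cube as soon as it respects the replacement of a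
  second component by \<open>u\<close>.
\<close>
lemma cube_map:
  assumes "\<And>x. x \<in> set xs \<Longrightarrow> h (fst x, u) = (fst (h x), u)"
  shows "cube u F (map h xs) = cube u (\<lambda>ps. F (map h ps)) xs"
  using assms by (induction xs arbitrary: F) simp_all

lemma cube_closed:
  assumes "\<And>x y. x \<in> N \<Longrightarrow> y \<in> N \<Longrightarrow> x - y \<in> N"
    and "\<And>ps. list_all2 (\<lambda>p x. p = (fst x, u) \<or> p = x) ps xs \<Longrightarrow> F ps \<in> N"
  shows "cube u F xs \<in> N"
  using assms(2)
proof (induction xs arbitrary: F)
  case (Cons x xs)
  show ?case
    unfolding cube.simps by (rule Cons.IH, rule assms(1); rule Cons.prems; simp)
qed simp

lemma list_all2_cube_subset:
  assumes "list_all2 (\<lambda>p x. p = (fst x, u) \<or> p = x) ps xs" "set xs \<subseteq> A \<times> B" "u \<in> B"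
  shows "set ps \<subseteq> A \<times> B \<and> length ps = length xs \<and> map fst ps = map fst xs"
  using assms by (induction rule: list_all2_induct) auto

text \<open>
  Fubini for a sum over extensional functions: the value at the new argument is summed separately.
\<close>
lemma sum_PiE_insert:
  assumes "x \<notin> S"
  shows "sum F (insert x S \<rightarrow>\<^sub>E T) = (\<Sum>k\<in>S \<rightarrow>\<^sub>E T. \<Sum>y\<in>T. F (k(x := y)))"
proof -
  have "sum F (insert x S \<rightarrow>\<^sub>E T) = (\<Sum>(y, k)\<in>T \<times> (S \<rightarrow>\<^sub>E T). F (k(x := y)))"
    unfolding PiE_insert_eq
    by (subst sum.reindex) (use assms in \<open>auto intro!: inj_combinator sum.cong\<close>)
  also have "\<dots> = (\<Sum>y\<in>T. \<Sum>k\<in>S \<rightarrow>\<^sub>E T. F (k(x := y)))"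
    by (rule sum.cartesian_product[symmetric])
  also have "\<dots> = (\<Sum>k\<in>S \<rightarrow>\<^sub>E T. \<Sum>y\<in>T. F (k(x := y)))"
    by (rule sum.swap)
  finally show ?thesis .
qed

text \<open>
  In the induction the last entry contributes the value of the exponent function at the new argument,
  so the cube grows by its two faces in that direction.
\<close>
lemma cube_conv_sum:
  fixes F :: "('m \<times> 'g) list \<Rightarrow> 'b \<Rightarrow>\<^sub>0 int"
  shows "cube u F xs = (\<Sum>k\<in>{1..length xs} \<rightarrow>\<^sub>E {0, 1::nat}. frag_cmul ((-1) ^ (\<Sum>i = 1..length xs. k i))
      (F (map (\<lambda>i. (fst (xs ! (i - 1)), if k i = 0 then u else snd (xs ! (i - 1)))) [1..<Suc (length xs)])))"
proof (induction xs arbitrary: F rule: rev_induct)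
  case (snoc x xs)
  let ?n = "length xs"
  let ?m = "\<lambda>xs k n. map (\<lambda>i. (fst (xs ! (i - 1)), if k i = 0 then u else snd (xs ! (i - 1)))) [1..<Suc n]"
  have m: "?m (xs @ [x]) (k(Suc ?n := y)) (Suc ?n) = ?m xs k ?n @ [(fst x, if y = 0 then u else snd x)]"
    for k and y :: nat
    by (auto simp: nth_append)
  have s: "(\<Sum>i = 1..Suc ?n. (k(Suc ?n := y)) i) = (\<Sum>i = 1..?n. k i) + y" for k and y :: nat
    by simp
  have ins: "{1..Suc ?n} = insert (Suc ?n) {1..?n}"
    by auto
  have "cube u F (xs @ [x]) = cube u (\<lambda>ps. F (ps @ [(fst x, u)]) - F (ps @ [x])) xs"
    by (simp add: cube_append)
  also have "\<dots> = (\<Sum>k\<in>{1..?n} \<rightarrow>\<^sub>E {0, 1::nat}. frag_cmul ((-1) ^ (\<Sum>i = 1..?n. k i))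
      (F (?m xs k ?n @ [(fst x, u)]) - F (?m xs k ?n @ [x])))"
    by (rule snoc.IH)
  also have "\<dots> = (\<Sum>k\<in>{1..?n} \<rightarrow>\<^sub>E {0, 1::nat}. \<Sum>y\<in>{0, 1::nat}.
      frag_cmul ((-1) ^ (\<Sum>i = 1..Suc ?n. (k(Suc ?n := y)) i)) (F (?m (xs @ [x]) (k(Suc ?n := y)) (Suc ?n))))"
    unfolding m s
    by (intro sum.cong refl)
       (simp add: frag_cmul_diff)
  also have "\<dots> = (\<Sum>k\<in>{1..Suc ?n} \<rightarrow>\<^sub>E {0, 1::nat}.
      frag_cmul ((-1) ^ (\<Sum>i = 1..Suc ?n. k i)) (F (?m (xs @ [x]) k (Suc ?n))))"
    unfolding ins by (rule sum_PiE_insert[symmetric]) auto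
  finally show ?case
    by simp
qed simp

section \<open>Difference tuples in a module with a central twist\<close>

text \<open>
  A module over the integral group ring, seen through the action of the group elements, together with an
  endomorphism of the group whose values are central.
\<close>
locale twisted_module = G: group G + M: abelian_group M
  for G :: "('g, 'r) monoid_scheme" (structure) and M :: "('m, 's) ring_scheme" +
  fixes sm :: "'m \<Rightarrow> 'g \<Rightarrow> 'm" (infixl "\<triangleleft>" 75) and \<phi> :: "'g \<Rightarrow> 'g"
  assumes sm_closed [simp, intro]: "\<lbrakk>m \<in> carrier M; g \<in> carrier G\<rbrakk> \<Longrightarrow> m \<triangleleft> g \<in> carrier M"
    and sm_add: "\<lbrakk>m \<in> carrier M; n \<in> carrier M; g \<in> carrier G\<rbrakk> \<Longrightarrow> (m \<oplus>\<^bsub>M\<^esub> n) \<triangleleft> g = m \<triangleleft> g \<oplus>\<^bsub>M\<^esub> n \<triangleleft> g"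
    and sm_sm: "\<lbrakk>m \<in> carrier M; g \<in> carrier G; h \<in> carrier G\<rbrakk> \<Longrightarrow> m \<triangleleft> g \<triangleleft> h = m \<triangleleft> (g \<otimes> h)"
    and sm_one [simp]: "m \<in> carrier M \<Longrightarrow> m \<triangleleft> \<one> = m"
    and phi_closed [simp, intro]: "g \<in> carrier G \<Longrightarrow> \<phi> g \<in> carrier G"
    and phi_mult: "\<lbrakk>g \<in> carrier G; h \<in> carrier G\<rbrakk> \<Longrightarrow> \<phi> (g \<otimes> h) = \<phi> g \<otimes> \<phi> h"
    and phi_central: "\<lbrakk>g \<in> carrier G; h \<in> carrier G\<rbrakk> \<Longrightarrow> \<phi> g \<otimes> h = h \<otimes> \<phi> g"
begin

lemma sm_zero [simp]: "g \<in> carrier G \<Longrightarrow> \<zero>\<^bsub>M\<^esub> \<triangleleft> g = \<zero>\<^bsub>M\<^esub>"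
  using sm_add[of "\<zero>\<^bsub>M\<^esub>" "\<zero>\<^bsub>M\<^esub>" g] by (metis M.add.l_cancel_one' M.l_zero M.zero_closed sm_closed)

lemma sm_minus:
  assumes "m \<in> carrier M" "n \<in> carrier M" "g \<in> carrier G"
  shows "(m \<ominus>\<^bsub>M\<^esub> n) \<triangleleft> g = m \<triangleleft> g \<ominus>\<^bsub>M\<^esub> n \<triangleleft> g"
proof -
  have "(\<ominus>\<^bsub>M\<^esub> n) \<triangleleft> g = \<ominus>\<^bsub>M\<^esub> (n \<triangleleft> g)"
    using sm_add[of "\<ominus>\<^bsub>M\<^esub> n" n g] assms by (simp add: M.l_neg M.minus_equality)
  then show ?thesis
    using assms by (simp add: M.minus_eq sm_add)
qed

lemma phi_one [simp]: "\<phi> \<one> = \<one>"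
  using phi_mult[of \<one> \<one>] by (simp add: G.l_cancel_one')

lemma phi_inv: "g \<in> carrier G \<Longrightarrow> \<phi> (inv g) = inv (\<phi> g)"
  using phi_mult[of "inv g" g] by (simp add: G.inv_equality)

text \<open>
  The lower operation conjugates the group parts, and this is invisible to \<open>\<phi>\<close>, whose values are
  central.
\<close>
lemma phi_conj: "\<lbrakk>g \<in> carrier G; h \<in> carrier G\<rbrakk> \<Longrightarrow> \<phi> (inv h \<otimes> g \<otimes> h) = \<phi> g"
  by (simp add: phi_mult phi_inv G.m_assoc phi_central[of g "\<phi> h"])
     (simp flip: G.m_assoc)

text \<open>
  The lower operation of the Alexander biquandle, with the action of \<open>\<phi>(h) - h\<close> in the group ring written
  as a difference of two actions.
\<close>
definition under :: "'m \<times> 'g \<Rightarrow> 'm \<times> 'g \<Rightarrow> 'm \<times> 'g" where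
  "under x y = (fst x \<triangleleft> snd y \<oplus>\<^bsub>M\<^esub> (fst y \<triangleleft> \<phi> (snd y) \<ominus>\<^bsub>M\<^esub> fst y \<triangleleft> snd y),
     inv (snd y) \<otimes> snd x \<otimes> snd y)"

definition over :: "'m \<times> 'g \<Rightarrow> 'm \<times> 'g \<Rightarrow> 'm \<times> 'g" where
  "over x y = (fst x \<triangleleft> \<phi> (snd y), snd x)"

definition prod_snd :: "('m \<times> 'g) list \<Rightarrow> 'g" where
  "prod_snd ps = foldr (\<lambda>p x. snd p \<otimes> x) ps \<one>"

lemma prod_snd_simps [simp]: "prod_snd [] = \<one>" "prod_snd (p # ps) = snd p \<otimes> prod_snd ps"
  by (simp_all add: prod_snd_def)

abbreviation points :: "('m \<times> 'g) set" where
  "points \<equiv> carrier M \<times> carrier G"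

lemma prod_snd_closed [simp, intro]: "set ps \<subseteq> points \<Longrightarrow> prod_snd ps \<in> carrier G"
  by (induction ps) auto

lemma prod_snd_append: "set ps \<subseteq> points \<Longrightarrow> set qs \<subseteq> points \<Longrightarrow> prod_snd (ps @ qs) = prod_snd ps \<otimes> prod_snd qs"
  by (induction ps) (auto simp: G.m_assoc)

text \<open>
  The tuple \<open>T\<close> of the introduction for \<open>m = m\<^sub>0\<close> and the list of the \<open>(m\<^sub>i, e\<^sub>i)\<close>.  The
  weights after the first all contain \<open>e\<^sub>1\<close> inside \<open>\<phi>\<close>, so the corresponding entries form the tuple
  that starts at \<open>m\<^sub>1\<close>, acted on by \<open>\<phi>(e\<^sub>1)\<close>; \<open>diff_tuple_nth\<close> is the closed form.
\<close>
fun diff_tuple :: "'m \<Rightarrow> ('m \<times> 'g) list \<Rightarrow> 'm list" where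
  "diff_tuple m [] = [m]"
| "diff_tuple m (p # ps) =
     (m \<ominus>\<^bsub>M\<^esub> fst p) \<triangleleft> prod_snd (p # ps) # map (\<lambda>x. x \<triangleleft> \<phi> (snd p)) (diff_tuple (fst p) ps)"

lemma length_diff_tuple [simp]: "length (diff_tuple m ps) = Suc (length ps)"
  by (induction m ps rule: diff_tuple.induct) auto

lemma diff_tuple_closed:
  "m \<in> carrier M \<Longrightarrow> set ps \<subseteq> points \<Longrightarrow> set (diff_tuple m ps) \<subseteq> carrier M"
  by (induction m ps rule: diff_tuple.induct) (auto simp: subset_iff)

lemma diff_tuple_in_tuples:
  "m \<in> carrier M \<Longrightarrow> set ps \<subseteq> points \<Longrightarrow> diff_tuple m ps \<in> tuples M (Suc (length ps))"
  using diff_tuple_closed by (simp add: tuples_def)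

lemma conj_cancel:
  assumes "g \<in> carrier G" "c \<in> carrier G" "x \<in> carrier G"
  shows "c \<otimes> (inv c \<otimes> g \<otimes> c \<otimes> x) = g \<otimes> (c \<otimes> x)"
proof -
  have "c \<otimes> (inv c \<otimes> g \<otimes> c \<otimes> x) = (c \<otimes> inv c) \<otimes> (g \<otimes> (c \<otimes> x))"
    using assms by (simp only: G.m_assoc G.m_closed G.inv_closed)
  then show ?thesis
    using assms by simp
qed

lemma under_closed [simp]:
  "x \<in> points \<Longrightarrow> y \<in> points \<Longrightarrow> under x y \<in> points"
  by (auto simp: under_def intro!: M.minus_closed)

lemma over_closed [simp]: "x \<in> points \<Longrightarrow> y \<in> points \<Longrightarrow> over x y \<in> points"
  by (auto simp: over_def)

lemma snd_under: "snd (under x y) = inv (snd y) \<otimes> snd x \<otimes> snd y"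
  by (simp add: under_def)

lemma fst_under: "fst (under x y) = fst x \<triangleleft> snd y \<oplus>\<^bsub>M\<^esub> (fst y \<triangleleft> \<phi> (snd y) \<ominus>\<^bsub>M\<^esub> fst y \<triangleleft> snd y)"
  by (simp add: under_def)

lemma fst_over: "fst (over x y) = fst x \<triangleleft> \<phi> (snd y)" and snd_over: "snd (over x y) = snd x"
  by (simp_all add: over_def)

lemma map_under_closed: "set ps \<subseteq> points \<Longrightarrow> y \<in> points \<Longrightarrow> set (map (\<lambda>x. under x y) ps) \<subseteq> points"
  by (simp add: image_subset_iff subsetD under_closed del: mem_Sigma_iff)

lemma map_over_closed: "set ps \<subseteq> points \<Longrightarrow> y \<in> points \<Longrightarrow> set (map (\<lambda>x. over x y) ps) \<subseteq> points"
  by (simp add: image_subset_iff subsetD over_closed del: mem_Sigma_iff)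

lemma prod_snd_map_under:
  assumes "set ps \<subseteq> points" "y \<in> points"
  shows "snd y \<otimes> prod_snd (map (\<lambda>x. under x y) ps) = prod_snd ps \<otimes> snd y"
  using assms
proof (induction ps)
  case (Cons p ps)
  have cl: "prod_snd (map (\<lambda>x. under x y) ps) \<in> carrier G"
    using Cons.prems by (intro prod_snd_closed map_under_closed) auto
  have "snd y \<otimes> prod_snd (map (\<lambda>x. under x y) (p # ps)) = snd p \<otimes> (snd y \<otimes> prod_snd (map (\<lambda>x. under x y) ps))"
    using Cons.prems cl by (auto simp: snd_under conj_cancel)
  also have "\<dots> = snd p \<otimes> prod_snd ps \<otimes> snd y"
    using Cons by (auto simp: G.m_assoc)
  finally show ?case
    by simp
qed auto

lemma prod_snd_map_over: "prod_snd (map (\<lambda>x. over x y) ps) = prod_snd ps"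
  by (induction ps) (auto simp: over_def)

lemma sm_phi_commute:
  assumes "x \<in> carrier M" "g \<in> carrier G" "h \<in> carrier G"
  shows "x \<triangleleft> \<phi> g \<triangleleft> h = x \<triangleleft> h \<triangleleft> \<phi> g"
  using assms by (simp add: sm_sm phi_central[of g h])

text \<open>
  The upper operation acts on all module parts by the central element \<open>\<phi>(h)\<close> and fixes the group
  parts, so it acts on the whole tuple.
\<close>
lemma diff_tuple_over:
  assumes "m \<in> carrier M" "set ps \<subseteq> points" "y \<in> points"
  shows "diff_tuple (m \<triangleleft> \<phi> (snd y)) (map (\<lambda>x. over x y) ps) = map (\<lambda>x. x \<triangleleft> \<phi> (snd y)) (diff_tuple m ps)"
  using assms
proof (induction m ps rule: diff_tuple.induct)
  case (2 m p ps)
  have cl: "fst p \<in> carrier M" "snd p \<in> carrier G" "snd y \<in> carrier G" "m \<in> carrier M"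
    "prod_snd (p # ps) \<in> carrier G" "set (diff_tuple (fst p) ps) \<subseteq> carrier M"
    using 2 diff_tuple_closed[of "fst p" ps] by (auto simp del: prod_snd_simps)
  have "(m \<triangleleft> \<phi> (snd y) \<ominus>\<^bsub>M\<^esub> fst p \<triangleleft> \<phi> (snd y)) \<triangleleft> prod_snd (p # ps) = (m \<ominus>\<^bsub>M\<^esub> fst p) \<triangleleft> prod_snd (p # ps) \<triangleleft> \<phi> (snd y)"
    using cl by (simp add: sm_phi_commute flip: sm_minus del: prod_snd_simps)
  moreover have "map (\<lambda>x. x \<triangleleft> \<phi> (snd p)) (map (\<lambda>x. x \<triangleleft> \<phi> (snd y)) (diff_tuple (fst p) ps)) =
      map (\<lambda>x. x \<triangleleft> \<phi> (snd y)) (map (\<lambda>x. x \<triangleleft> \<phi> (snd p)) (diff_tuple (fst p) ps))"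
    using cl(2,3,6) by (auto simp: subset_iff sm_phi_commute[of _ "snd p" "\<phi> (snd y)"])
  moreover have "prod_snd (over p y # map (\<lambda>x. over x y) ps) = prod_snd (p # ps)"
    using prod_snd_map_over[of y "p # ps"] by simp
  moreover have "diff_tuple (fst p \<triangleleft> \<phi> (snd y)) (map (\<lambda>x. over x y) ps) = map (\<lambda>x. x \<triangleleft> \<phi> (snd y)) (diff_tuple (fst p) ps)"
    using 2 by (intro 2) auto
  ultimately show ?case
    by (simp add: fst_over snd_over del: prod_snd_simps map_map)
qed auto

text \<open>
  The inner faces of the group boundary.
\<close>
definition merge :: "nat \<Rightarrow> 'm list \<Rightarrow> 'm list" where
  "merge i ts = take (i - 1) ts @ [ts ! (i - 1) \<oplus>\<^bsub>M\<^esub> ts ! i] @ drop (i + 1) ts"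

lemma merge_Cons_Cons: "merge (Suc 0) (x # y # ts) = (x \<oplus>\<^bsub>M\<^esub> y) # ts"
  by (simp add: merge_def)

lemma merge_Cons: "merge (Suc (Suc i)) (x # ts) = x # merge (Suc i) ts"
  by (simp add: merge_def)

lemma map_merge:
  assumes "set ts \<subseteq> carrier M" "g \<in> carrier G" "0 < i" "i < length ts"
  shows "map (\<lambda>x. x \<triangleleft> g) (merge i ts) = merge i (map (\<lambda>x. x \<triangleleft> g) ts)"
proof -
  have "ts ! i \<in> carrier M" "ts ! (i - 1) \<in> carrier M"
    using assms by (auto simp: subset_iff)
  then show ?thesis
    using assms by (simp add: merge_def take_map drop_map sm_add)
qed

lemma minus_rearrange:
  assumes "a \<in> carrier M" "b \<in> carrier M" "d \<in> carrier M"
  shows "(a \<oplus>\<^bsub>M\<^esub> d) \<ominus>\<^bsub>M\<^esub> (b \<oplus>\<^bsub>M\<^esub> d) = a \<ominus>\<^bsub>M\<^esub> b"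
    and "(a \<ominus>\<^bsub>M\<^esub> b) \<oplus>\<^bsub>M\<^esub> d = a \<oplus>\<^bsub>M\<^esub> (d \<ominus>\<^bsub>M\<^esub> b)"
    and "(a \<oplus>\<^bsub>M\<^esub> (b \<ominus>\<^bsub>M\<^esub> d)) \<ominus>\<^bsub>M\<^esub> b = a \<ominus>\<^bsub>M\<^esub> d"
  using assms by (simp_all add: M.minus_eq M.minus_add M.a_ac M.r_neg M.l_neg M.r_neg1 M.r_neg2)

text \<open>
  The second summand of the lower operation depends only on the acting point and cancels in
  differences.
\<close>
lemma diff_tuple_under_head:
  assumes "m \<in> carrier M" "n \<in> carrier M" "y \<in> points" "h \<in> carrier G" "x \<in> carrier G"
    and "snd y \<otimes> h = x"
  shows "(fst (under (m, g) y) \<ominus>\<^bsub>M\<^esub> fst (under (n, g') y)) \<triangleleft> h = (m \<ominus>\<^bsub>M\<^esub> n) \<triangleleft> x"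
proof -
  have cl: "fst y \<in> carrier M" "snd y \<in> carrier G"
    using assms by auto
  have "fst (under (m, g) y) \<ominus>\<^bsub>M\<^esub> fst (under (n, g') y) = (m \<ominus>\<^bsub>M\<^esub> n) \<triangleleft> snd y"
    using cl assms(1,2) by (simp add: fst_under minus_rearrange sm_minus)
  then show ?thesis
    using cl assms by (simp add: sm_sm)
qed

lemma prod_snd_map_under_append:
  assumes "set ps \<subseteq> points" "y \<in> points" "set qs \<subseteq> points"
  shows "snd y \<otimes> prod_snd (map (\<lambda>x. under x y) ps @ qs) = prod_snd ps \<otimes> (snd y \<otimes> prod_snd qs)"
proof -
  have cl: "snd y \<in> carrier G" "prod_snd qs \<in> carrier G" "prod_snd ps \<in> carrier G" "prod_snd (map (\<lambda>x. under x y) ps) \<in> carrier G"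
    using assms map_under_closed by (auto simp del: set_map)
  have "snd y \<otimes> prod_snd (map (\<lambda>x. under x y) ps @ qs) = (snd y \<otimes> prod_snd (map (\<lambda>x. under x y) ps)) \<otimes> prod_snd qs"
    using cl prod_snd_append[OF map_under_closed[OF assms(1,2)] assms(3)] by (simp add: G.m_assoc)
  then show ?thesis
    using cl assms by (simp add: prod_snd_map_under G.m_assoc)
qed

lemma phi_snd_under: "p \<in> points \<Longrightarrow> y \<in> points \<Longrightarrow> \<phi> (snd (under p y)) = \<phi> (snd p)"
  by (auto simp: snd_under phi_conj)

text \<open>
  Induction on the points to the left of \<open>y\<close>.  They are conjugated by the group part \<open>c\<close> of \<open>y\<close>, and
  the product of the conjugates telescopes to \<open>c\<^sup>-\<^sup>1 (\<dots>) c\<close>; the factor \<open>c\<^sup>-\<^sup>1\<close> is absorbed by the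
  differences of the module parts, which were multiplied by \<open>c\<close>, and the factor \<open>c\<close> is the missing
  contribution of \<open>y\<close>.  In the base case the difference across \<open>y\<close> is
  \<open>(m - n) c + (n - n') \<phi>(c)\<close>, the sum of the two entries next to \<open>y\<close>.
\<close>
lemma diff_tuple_face:
  assumes "m \<in> carrier M" "set ps \<subseteq> points" "y \<in> points" "set qs \<subseteq> points"
  shows "diff_tuple (fst (under (m, g) y)) (map (\<lambda>x. under x y) ps @ map (\<lambda>x. over x y) qs) =
    merge (Suc (length ps)) (diff_tuple m (ps @ y # qs))"
  using assms
proof (induction m ps arbitrary: g rule: diff_tuple.induct)
  case (1 m)
  have cl: "fst y \<in> carrier M" "snd y \<in> carrier G" "m \<in> carrier M"
    using 1 by auto
  show ?case
  proof (cases qs)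
    case Nil
    then show ?thesis
      using cl by (simp add: merge_Cons_Cons fst_under sm_minus minus_rearrange)
  next
    case (Cons q qs')
    then have q: "fst q \<in> carrier M" "snd q \<in> carrier G" "prod_snd qs \<in> carrier G" "prod_snd qs' \<in> carrier G" "set qs' \<subseteq> points"
      using 1 by auto
    have "m \<triangleleft> snd y \<oplus>\<^bsub>M\<^esub> (fst y \<triangleleft> \<phi> (snd y) \<ominus>\<^bsub>M\<^esub> fst y \<triangleleft> snd y) \<ominus>\<^bsub>M\<^esub> fst q \<triangleleft> \<phi> (snd y) =
      (m \<triangleleft> snd y \<ominus>\<^bsub>M\<^esub> fst y \<triangleleft> snd y) \<oplus>\<^bsub>M\<^esub> (fst y \<triangleleft> \<phi> (snd y) \<ominus>\<^bsub>M\<^esub> fst q \<triangleleft> \<phi> (snd y))"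
      using cl q by (simp add: M.minus_eq M.a_ac)
    then have "(m \<triangleleft> snd y \<oplus>\<^bsub>M\<^esub> (fst y \<triangleleft> \<phi> (snd y) \<ominus>\<^bsub>M\<^esub> fst y \<triangleleft> snd y) \<ominus>\<^bsub>M\<^esub> fst q \<triangleleft> \<phi> (snd y)) \<triangleleft> prod_snd qs =
      (m \<ominus>\<^bsub>M\<^esub> fst y) \<triangleleft> (snd y \<otimes> prod_snd qs) \<oplus>\<^bsub>M\<^esub> (fst y \<ominus>\<^bsub>M\<^esub> fst q) \<triangleleft> prod_snd qs \<triangleleft> \<phi> (snd y)"
      using cl q by (simp add: sm_add sm_minus sm_sm phi_central[of "snd y" "prod_snd qs"])
    then show ?thesis
      using diff_tuple_over[of "fst q" qs' y] 1 q cl Cons prod_snd_map_over[of y qs']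
      by (simp add: merge_Cons_Cons fst_under fst_over snd_over sm_phi_commute[of _ "snd q"] diff_tuple_closed[THEN subsetD] cong: map_cong)
  qed
next
  case (2 m p ps)
  let ?us = "map (\<lambda>x. under x y)" and ?os = "map (\<lambda>x. over x y)"
  have cl: "fst p \<in> carrier M" "snd p \<in> carrier G" "set ps \<subseteq> points" "p \<in> points"
    "set (ps @ y # qs) \<subseteq> points" "set (p # ps) \<subseteq> points" "set (?os qs) \<subseteq> points"
    using 2 map_over_closed[of qs y] by auto
  have "prod_snd (?us (p # ps) @ ?os qs) \<in> carrier G"
    using map_under_closed[of "p # ps" y] 2 cl by (intro prod_snd_closed) auto
  then have "(fst (under (m, g) y) \<ominus>\<^bsub>M\<^esub> fst (under p y)) \<triangleleft> prod_snd (?us (p # ps) @ ?os qs) =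
      (m \<ominus>\<^bsub>M\<^esub> fst p) \<triangleleft> prod_snd (p # ps @ y # qs)"
    using diff_tuple_under_head[of m "fst p" y "prod_snd (?us (p # ps) @ ?os qs)" "prod_snd (p # ps @ y # qs)" g "snd p"]
      prod_snd_map_under_append[of "p # ps" y "?os qs"] prod_snd_append[of "p # ps" "y # qs"] prod_snd_closed[of "p # ps @ y # qs"] cl 2
    by (simp add: prod_snd_map_over del: set_map)
  moreover have "diff_tuple (fst (under p y)) (?us ps @ ?os qs) = merge (Suc (length ps)) (diff_tuple (fst p) (ps @ y # qs))"
    using 2(1)[of "snd p"] 2(2-) cl by simp
  moreover have "map (\<lambda>x. x \<triangleleft> \<phi> (snd p)) (merge (Suc (length ps)) (diff_tuple (fst p) (ps @ y # qs))) =
      merge (Suc (length ps)) (map (\<lambda>x. x \<triangleleft> \<phi> (snd p)) (diff_tuple (fst p) (ps @ y # qs)))"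
    using cl by (intro map_merge diff_tuple_closed) auto
  ultimately show ?case
    using 2 cl by (simp add: merge_Cons phi_snd_under)
qed

text \<open>
  As in \<open>diff_tuple_face\<close>, except that a point stays at the position of \<open>y\<close>; its choice \<open>e\<close> is
  multiplied by the group part of \<open>y\<close>, both in the weights to its left and inside \<open>\<phi>\<close> in those to
  its right.
\<close>
lemma diff_tuple_split:
  assumes "m \<in> carrier M" "set ps \<subseteq> points" "y \<in> points" "e \<in> carrier G" "set qs \<subseteq> points"
  shows "diff_tuple (fst (under (m, g) y)) (map (\<lambda>x. under x y) ps @ (fst y \<triangleleft> \<phi> (snd y), e) # map (\<lambda>x. over x y) qs) =
    diff_tuple m (ps @ (fst y, snd y \<otimes> e) # qs)"
  using assms
proof (induction m ps arbitrary: g rule: diff_tuple.induct)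
  case (1 m)
  have cl: "fst y \<in> carrier M" "snd y \<in> carrier G" "m \<in> carrier M" "prod_snd qs \<in> carrier G"
    "set (diff_tuple (fst y) qs) \<subseteq> carrier M"
    using 1 diff_tuple_closed[of "fst y" qs] by auto
  then have "(fst (under (m, g) y) \<ominus>\<^bsub>M\<^esub> fst y \<triangleleft> \<phi> (snd y)) \<triangleleft> (e \<otimes> prod_snd qs) = (m \<ominus>\<^bsub>M\<^esub> fst y) \<triangleleft> (snd y \<otimes> e \<otimes> prod_snd qs)"
    using 1(4) by (simp add: fst_under minus_rearrange sm_minus[symmetric] sm_sm G.m_assoc)
  then show ?case
    using 1 cl by (auto simp: diff_tuple_over prod_snd_map_over subset_iff sm_sm phi_mult)
next
  case (2 m p ps)
  let ?us = "map (\<lambda>x. under x y)"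
  let ?os = "(fst y \<triangleleft> \<phi> (snd y), e) # map (\<lambda>x. over x y) qs"
  let ?ys = "(fst y, snd y \<otimes> e) # qs"
  have cl: "fst p \<in> carrier M" "snd p \<in> carrier G" "set ps \<subseteq> points" "p \<in> points" "snd y \<in> carrier G" "prod_snd qs \<in> carrier G"
    "set (ps @ ?ys) \<subseteq> points" "set (p # ps) \<subseteq> points" "set ?os \<subseteq> points" "set ?ys \<subseteq> points"
    using 2 map_over_closed[of qs y] by auto
  have "prod_snd (?us (p # ps) @ ?os) \<in> carrier G"
    using map_under_closed[of "p # ps" y] 2 cl by (intro prod_snd_closed) auto
  then have "(fst (under (m, g) y) \<ominus>\<^bsub>M\<^esub> fst (under p y)) \<triangleleft> prod_snd (?us (p # ps) @ ?os) =
      (m \<ominus>\<^bsub>M\<^esub> fst p) \<triangleleft> prod_snd (p # ps @ ?ys)"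
    using diff_tuple_under_head[of m "fst p" y "prod_snd (?us (p # ps) @ ?os)" "prod_snd (p # ps @ ?ys)" g "snd p"]
      prod_snd_map_under_append[of "p # ps" y "?os"] prod_snd_append[of "p # ps" "?ys"] prod_snd_closed[of "p # ps @ ?ys"] cl 2
    by (simp add: prod_snd_map_over G.m_assoc del: set_map)
  moreover have "diff_tuple (fst (under p y)) (?us ps @ ?os) = diff_tuple (fst p) (ps @ ?ys)"
    using 2(1)[of "snd p"] 2(2-) cl by simp
  ultimately show ?case
    using 2 cl by (simp add: phi_snd_under)
qed

text \<open>
  All weights but the last end with the choice at the last point.
\<close>
lemma diff_tuple_butlast:
  assumes "m \<in> carrier M" "set ps \<subseteq> points" "n \<in> carrier M" "g \<in> carrier G"
  shows "butlast (diff_tuple m (ps @ [(n, g)])) = map (\<lambda>x. x \<triangleleft> g) (butlast (diff_tuple m (ps @ [(n, \<one>)])))"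
  using assms
proof (induction m ps rule: diff_tuple.induct)
  case (2 m p ps)
  let ?t = "\<lambda>h. diff_tuple (fst p) (ps @ [(n, h)])"
  have cl: "fst p \<in> carrier M" "snd p \<in> carrier G" "set ps \<subseteq> points" "prod_snd ps \<in> carrier G"
    using 2 by auto
  have t: "set (butlast (?t \<one>)) \<subseteq> carrier M"
    using diff_tuple_closed[of "fst p" "ps @ [(n, \<one>)]"] 2 by (auto dest!: in_set_butlastD)
  have "(m \<ominus>\<^bsub>M\<^esub> fst p) \<triangleleft> prod_snd (p # ps @ [(n, g)]) = (m \<ominus>\<^bsub>M\<^esub> fst p) \<triangleleft> prod_snd (p # ps @ [(n, \<one>)]) \<triangleleft> g"
    using cl 2 by (simp add: prod_snd_append sm_sm G.m_assoc)
  moreover have "map (\<lambda>x. x \<triangleleft> \<phi> (snd p)) (butlast (?t g)) = map (\<lambda>x. x \<triangleleft> g) (map (\<lambda>x. x \<triangleleft> \<phi> (snd p)) (butlast (?t \<one>)))"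
    using t cl 2 by (auto simp: subset_iff sm_phi_commute)
  moreover have "?t h \<noteq> []" for h
    using length_diff_tuple[of "fst p" "ps @ [(n, h)]"] by (metis list.size(3) nat.distinct(1))
  ultimately show ?case
    by (simp add: map_butlast[symmetric] del: prod_snd_simps map_map)
qed auto

text \<open>
  The position \<open>Suc i\<close> is never the last one, so the vanishing entry is one to which the
  normalization condition applies.
\<close>
lemma diff_tuple_zero:
  assumes "m \<in> carrier M" "set ps \<subseteq> points" "Suc i < length ps" "fst (ps ! i) = fst (ps ! Suc i)"
  shows "diff_tuple m ps ! Suc i = \<zero>\<^bsub>M\<^esub>"
  using assms
proof (induction m ps arbitrary: i rule: diff_tuple.induct)
  case (2 m p ps)
  have "diff_tuple (fst p) ps ! i = \<zero>\<^bsub>M\<^esub>"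
  proof (cases i)
    case 0
    then show ?thesis
      using 2 by (cases ps) (auto simp: M.r_neg M.minus_eq)
  next
    case (Suc j)
    then show ?thesis using 2 by auto
  qed
  then show ?case
    using 2 by auto
qed auto

end

section \<open>Alternating sums of difference tuples\<close>

context twisted_module
begin

text \<open>
  The value of \<open>\<psi>\<^sub>n \<circ> \<gamma>\<^sub>n\<close> on \<open>(x\<^sub>0, \<dots>, x\<^sub>n)\<close> with \<open>m = m\<^sub>0\<close>, followed by the function \<open>W\<close> on tuples.
\<close>
definition cube_sum :: "('m list \<Rightarrow> 'w::ab_group_add) \<Rightarrow> 'm \<Rightarrow> ('m \<times> 'g) list \<Rightarrow> 'w" where
  "cube_sum W m xs = cube \<one> (\<lambda>ps. W (diff_tuple m ps)) xs"

lemma cube_cong_points: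
  assumes "set xs \<subseteq> points"
    and "\<And>ps. \<lbrakk>set ps \<subseteq> points; length ps = length xs; map fst ps = map fst xs\<rbrakk> \<Longrightarrow> F ps = F' ps"
  shows "cube \<one> F xs = cube \<one> F' xs"
  using list_all2_cube_subset[OF _ assms(1) G.one_closed] by (intro cube_cong assms(2)) auto

lemma cube_map_under:
  assumes "y \<in> points"
  shows "cube \<one> F (map (\<lambda>x. under x y) xs) = cube \<one> (\<lambda>ps. F (map (\<lambda>x. under x y) ps)) xs"
  by (rule cube_map) (use assms in \<open>auto simp: under_def\<close>)

lemma cube_map_over: "cube \<one> F (map (\<lambda>x. over x y) xs) = cube \<one> (\<lambda>ps. F (map (\<lambda>x. over x y) ps)) xs"
  by (rule cube_map) (auto simp: over_def)

text \<open>
  Deleting a point is the face \<open>diff_tuple_face\<close> for the point with trivial group part, which acts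
  as the identity from both sides.
\<close>
lemma diff_tuple_omit:
  assumes "m \<in> carrier M" "set ps \<subseteq> points" "n \<in> carrier M" "set qs \<subseteq> points" "length ps = k"
  shows "diff_tuple m (ps @ qs) = merge (Suc k) (diff_tuple m (ps @ (n, \<one>) # qs))"
proof -
  have "under x (n, \<one>) = x" "over x (n, \<one>) = x" if "x \<in> points" for x
    using that assms by (auto simp: under_def over_def M.minus_eq M.r_neg)
  then have "map (\<lambda>x. under x (n, \<one>)) ps = ps" "map (\<lambda>x. over x (n, \<one>)) qs = qs" "fst (under (m, \<one>) (n, \<one>)) = m"
    using assms by (auto intro!: map_idI)
  then show ?thesis
    using diff_tuple_face[of m ps "(n, \<one>)" qs \<one>] assms by simp
qed

text \<open>
  Both faces are sums over the cube without direction \<open>i\<close>, and they evaluate the same function on the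
  two opposite faces of the full cube.
\<close>
lemma cube_sum_face_minus_omit:
  assumes "m \<in> carrier M" "set us \<subseteq> points" "y \<in> points" "set vs \<subseteq> points"
  shows "cube_sum W (fst (under (m, g) y)) (map (\<lambda>x. under x y) us @ map (\<lambda>x. over x y) vs) - cube_sum W m (us @ vs) =
    - cube \<one> (\<lambda>ps. W (merge (Suc (length us)) (diff_tuple m ps))) (us @ y # vs)"
proof -
  let ?F = "\<lambda>ps. W (merge (Suc (length us)) (diff_tuple m ps))"
  have "cube_sum W (fst (under (m, g) y)) (map (\<lambda>x. under x y) us @ map (\<lambda>x. over x y) vs) =
      cube \<one> (\<lambda>ps. cube \<one> (\<lambda>qs. ?F (ps @ y # qs)) vs) us"
    unfolding cube_sum_def cube_append cube_map_under[OF assms(3)] cube_map_over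
    using assms by (intro cube_cong_points) (simp_all add: diff_tuple_face)
  moreover have "cube_sum W m (us @ vs) = cube \<one> (\<lambda>ps. cube \<one> (\<lambda>qs. ?F (ps @ (fst y, \<one>) # qs)) vs) us"
    unfolding cube_sum_def cube_append
    using assms by (intro cube_cong_points arg_cong[where f = W] diff_tuple_omit) auto
  ultimately show ?thesis
    by (simp add: cube_append cube_diff)
qed

text \<open>
  The two cubes on the right share the vertices with the trivial choice at the position of \<open>y\<close>, and
  these cancel.  The remaining vertices, with the choices \<open>snd y\<close> and \<open>snd y \<otimes> e\<close>, are those of the
  cube on the left by \<open>diff_tuple_split\<close>.
\<close>
lemma cube_sum_split:
  assumes "m \<in> carrier M" "set us \<subseteq> points" "y \<in> points" "e \<in> carrier G" "set vs \<subseteq> points"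
  shows "cube_sum W (fst (under (m, g) y)) (map (\<lambda>x. under x y) us @ (fst y \<triangleleft> \<phi> (snd y), e) # map (\<lambda>x. over x y) vs) =
    cube_sum W m (us @ (fst y, snd y \<otimes> e) # vs) - cube_sum W m (us @ y # vs)"
proof -
  have y: "(fst y, snd y \<otimes> \<one>) = y" "fst y \<in> carrier M"
    using assms(3) by auto
  have "cube_sum W (fst (under (m, g) y)) (map (\<lambda>x. under x y) us @ (fst y \<triangleleft> \<phi> (snd y), e) # map (\<lambda>x. over x y) vs) =
    cube \<one> (\<lambda>ps. cube \<one> (\<lambda>qs. W (diff_tuple m (ps @ (fst y, snd y \<otimes> \<one>) # qs)) -
        W (diff_tuple m (ps @ (fst y, snd y \<otimes> e) # qs))) vs) us"
    unfolding cube_sum_def cube_append cube_map_under[OF assms(3)] cube.simps cube_map_over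
    using assms(1,2,3,5) G.one_closed assms(4)
    by (intro cube_cong_points) (simp_all add: diff_tuple_split)
  then show ?thesis
    unfolding y(1) by (simp add: cube_sum_def cube_append cube_diff)
qed

lemma cube_sum_closed:
  assumes "\<And>ms. ms \<in> tuples M (Suc (length xs)) \<Longrightarrow> W ms \<in> N"
    and diff: "\<And>x y. x \<in> N \<Longrightarrow> y \<in> N \<Longrightarrow> x - y \<in> N"
    and m: "m \<in> carrier M" and xs: "set xs \<subseteq> points"
  shows "cube_sum W m xs \<in> N"
  unfolding cube_sum_def
proof (rule cube_closed[OF diff])
  fix ps assume "list_all2 (\<lambda>p x. p = (fst x, \<one>) \<or> p = x) ps xs"
  from list_all2_cube_subset[OF this xs G.one_closed]
  show "W (diff_tuple m ps) \<in> N"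
    using diff_tuple_in_tuples[OF m, of ps] by (intro assms(1)) auto
qed

text \<open>
  Opposite vertices in the first direction differ by the action of \<open>\<phi>(e\<^sub>1)\<close> on the tuple without its
  first entry.
\<close>
lemma cube_sum_tl_closed:
  assumes diff: "\<And>x y. x \<in> N \<Longrightarrow> y \<in> N \<Longrightarrow> x - y \<in> N"
    and inv: "\<And>ms g. ms \<in> tuples M (length xs) \<Longrightarrow> g \<in> carrier G \<Longrightarrow> W (map (\<lambda>x. x \<triangleleft> g) ms) - W ms \<in> N"
    and "m \<in> carrier M" "set xs \<subseteq> points" "xs \<noteq> []"
  shows "cube \<one> (\<lambda>ps. W (tl (diff_tuple m ps))) xs \<in> N"
proof (cases xs)
  case (Cons x xs')
  have x: "fst x \<in> carrier M" "snd x \<in> carrier G" "set xs' \<subseteq> points"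
    using assms Cons by auto
  have *: "W (tl (diff_tuple m ((fst x, \<one>) # ps))) - W (tl (diff_tuple m (x # ps))) \<in> N"
    if "set ps \<subseteq> points" "length ps = length xs'" for ps
  proof -
    let ?t = "diff_tuple (fst x) ps"
    have t: "?t \<in> tuples M (length xs)"
      using diff_tuple_in_tuples[of "fst x" ps] that x Cons by simp
    have "map (\<lambda>a. a \<triangleleft> \<one>) ?t = ?t"
      using t by (auto simp: tuples_def intro!: map_idI)
    moreover have "0 - (W (map (\<lambda>a. a \<triangleleft> \<phi> (snd x)) ?t) - W ?t) \<in> N"
      using inv[OF t, of "\<phi> (snd x)"] diff x by (metis diff_self phi_closed)
    ultimately show ?thesis
      by simp
  qed
  show ?thesis
    unfolding Cons cube.simps
    by (intro cube_closed[OF diff] *) (use list_all2_cube_subset[OF _ x(3) G.one_closed] in blast)+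
qed (use assms in simp)

text \<open>
  Opposite vertices in the last direction differ by the action of \<open>e\<^sub>n\<close> on the tuple without its last
  entry.
\<close>
lemma cube_sum_butlast_closed:
  assumes diff: "\<And>x y. x \<in> N \<Longrightarrow> y \<in> N \<Longrightarrow> x - y \<in> N"
    and inv: "\<And>ms g. ms \<in> tuples M (length xs) \<Longrightarrow> g \<in> carrier G \<Longrightarrow> W (map (\<lambda>x. x \<triangleleft> g) ms) - W ms \<in> N"
    and "m \<in> carrier M" "set xs \<subseteq> points" "xs \<noteq> []"
  shows "cube \<one> (\<lambda>ps. W (butlast (diff_tuple m ps))) xs \<in> N"
proof (cases xs rule: rev_cases)
  case (snoc xs' x)
  have x: "fst x \<in> carrier M" "snd x \<in> carrier G" "set xs' \<subseteq> points"
    using assms snoc by auto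
  have *: "W (butlast (diff_tuple m (ps @ [(fst x, \<one>)]))) - W (butlast (diff_tuple m (ps @ [x]))) \<in> N"
    if "set ps \<subseteq> points" "length ps = length xs'" for ps
  proof -
    let ?t = "butlast (diff_tuple m (ps @ [(fst x, \<one>)]))"
    have t: "?t \<in> tuples M (length xs)"
      using diff_tuple_in_tuples[of m "ps @ [(fst x, \<one>)]"] that x snoc assms
      by (auto simp: tuples_def dest: in_set_butlastD)
    have "butlast (diff_tuple m (ps @ [x])) = map (\<lambda>a. a \<triangleleft> snd x) ?t"
      using diff_tuple_butlast[of m ps "fst x" "snd x"] assms that x by simp
    moreover have "0 - (W (map (\<lambda>a. a \<triangleleft> snd x) ?t) - W ?t) \<in> N"
      using inv[OF t, of "snd x"] diff x by (metis diff_self)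
    ultimately show ?thesis
      by simp
  qed
  show ?thesis
    unfolding snoc cube_append cube.simps
    by (intro cube_closed[OF diff] *) (use list_all2_cube_subset[OF _ x(3) G.one_closed] in blast)+
qed (use assms in simp)

lemma merge_sum_eq_boundary:
  assumes "length ts = Suc n"
  shows "(\<Sum>i<n. frag_cmul ((-1) ^ i) (- W (merge (Suc i) ts))) =
    frag_extend W (gp_boundary_tuple M ts) - W (tl ts) - frag_cmul ((-1) ^ Suc n) (W (butlast ts))"
proof -
  have *: "(\<Sum>i = 1..<Suc n. frag_cmul ((-1) ^ i) (W (merge i ts))) = (\<Sum>i<n. frag_cmul ((-1) ^ Suc i) (W (merge (Suc i) ts)))"
    using sum.shift_bounds_Suc_ivl[of "\<lambda>i. frag_cmul ((-1) ^ i) (W (merge i ts))" 0 n]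
    by (simp only: One_nat_def lessThan_atLeast0)
  have "gp_boundary_tuple M ts = frag_of (tl ts) + (\<Sum>i = 1..<Suc n. frag_cmul ((-1) ^ i) (frag_of (merge i ts))) +
      frag_cmul ((-1) ^ Suc n) (frag_of (butlast ts))"
    unfolding gp_boundary_tuple_def assms merge_def by simp
  moreover have "(\<Sum>i<n. frag_cmul ((-1) ^ i) (- W (merge (Suc i) ts))) = (\<Sum>i<n. frag_cmul ((-1) ^ Suc i) (W (merge (Suc i) ts)))"
    by (simp add: frag_cmul_uminus)
  ultimately show ?thesis
    unfolding *[symmetric]
    by (simp only: frag_extend_add frag_extend_sum frag_extend_cmul frag_extend_of comp_def finite_atLeastLessThan) simp
qed

end

section \<open>Comparison with the explicit formula\<close>

context twisted_module
begin

text \<open>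
  This is the formula by which \<open>\<psi>\<^sub>n\<close> is defined; the recursion of \<open>diff_tuple\<close> multiplies by the values
  of \<open>\<phi>\<close> on the right, and centrality moves them to the front.
\<close>
lemma diff_tuple_nth:
  assumes "m \<in> carrier M" "set ps \<subseteq> points" "i \<le> length ps"
  shows "diff_tuple m ps ! i =
    (if i < length ps then (m # map fst ps) ! i \<ominus>\<^bsub>M\<^esub> (m # map fst ps) ! Suc i else (m # map fst ps) ! i) \<triangleleft>
      (\<phi> (prod_snd (take i ps)) \<otimes> prod_snd (drop i ps))"
  using assms
proof (induction m ps arbitrary: i rule: diff_tuple.induct)
  case (2 m p ps)
  have cl: "fst p \<in> carrier M" "snd p \<in> carrier G" "set ps \<subseteq> points" "prod_snd ps \<in> carrier G"
    using 2 by auto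
  show ?case
  proof (cases i)
    case 0
    then show ?thesis
      using cl by simp
  next
    case (Suc j)
    have j: "j \<le> length ps" "set (take j ps) \<subseteq> points" "set (drop j ps) \<subseteq> points"
      using 2 Suc cl(3) set_take_subset[of j ps] set_drop_subset[of j ps] by auto
    define d where "d = (if j < length ps then (fst p # map fst ps) ! j \<ominus>\<^bsub>M\<^esub> (fst p # map fst ps) ! Suc j else (fst p # map fst ps) ! j)"
    have mem: "(fst p # map fst ps) ! l \<in> carrier M" if "l \<le> length ps" for l
    proof (cases l)
      case (Suc l')
      then have "ps ! l' \<in> points"
        using that by (intro subsetD[OF cl(3)] nth_mem) simp
      then show ?thesis
        using Suc that by auto
    qed (use cl in simp)
    have d: "d \<in> carrier M"
      unfolding d_def using mem[of j] mem[of "Suc j"] j(1) by auto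
    have P: "prod_snd (take j ps) \<in> carrier G" "prod_snd (drop j ps) \<in> carrier G"
      using j by auto
    have "diff_tuple m (p # ps) ! i = d \<triangleleft> (\<phi> (prod_snd (take j ps)) \<otimes> prod_snd (drop j ps)) \<triangleleft> \<phi> (snd p)"
      using Suc 2(1)[OF cl(1,3) j(1)] j(1) by (simp add: d_def)
    also have "\<dots> = d \<triangleleft> (\<phi> (snd p \<otimes> prod_snd (take j ps)) \<otimes> prod_snd (drop j ps))"
      using d P cl(2) phi_central[of "snd p" "\<phi> (prod_snd (take j ps)) \<otimes> prod_snd (drop j ps)"]
        G.m_assoc[of "\<phi> (snd p)" "\<phi> (prod_snd (take j ps))" "prod_snd (drop j ps)"]
      by (simp add: sm_sm phi_mult)
    finally show ?thesis
      using Suc j(1) by (auto simp: d_def)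
  qed
qed auto

lemma power_prod_eq_prod_snd:
  assumes "\<And>i. i \<in> {a..b} \<Longrightarrow> gs ! i \<in> carrier G \<and> k i \<in> {0, 1} \<and> g i = (if k i = 0 then \<one> else gs ! i)"
  shows "power_prod G gs k a b = prod_snd (map (\<lambda>i. (m i, g i)) [a..<Suc b])"
proof -
  have "(gs ! i) [^] k i = g i" if "i \<in> {a..b}" for i
    using assms[OF that] by auto
  then show ?thesis
    unfolding power_prod_def prod_snd_def foldr_map by (intro foldr_cong) (auto simp: less_Suc_eq_le)
qed

text \<open>
  Here \<open>gs\<close> and \<open>ms\<close> are the two components of \<open>\<gamma>\<^sub>n(x\<^sub>0, \<dots>, x\<^sub>n)\<close>, and the left-hand side is the
  formula for \<open>\<psi>\<^sub>n\<close>.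
\<close>
lemma cube_sum_conv_psi:
  assumes "x\<^sub>0 \<in> points" "set xs \<subseteq> points" "length xs = n"
  defines "gs \<equiv> map snd (x\<^sub>0 # xs)"
    and "ms \<equiv> map (\<lambda>i. fst ((x\<^sub>0 # xs) ! i) \<ominus>\<^bsub>M\<^esub> fst ((x\<^sub>0 # xs) ! (i + 1))) [0..<n] @ [fst ((x\<^sub>0 # xs) ! n)]"
  shows "(\<Sum>k \<in> {1..n} \<rightarrow>\<^sub>E {0, 1}. frag_cmul ((-1) ^ (\<Sum>i = 1..n. k i))
      (frag_of (map (\<lambda>i. ms ! i \<triangleleft> psi_weight G \<phi> n gs k i) [0..<Suc n]))) = cube_sum frag_of (fst x\<^sub>0) xs"
  unfolding cube_sum_def cube_conv_sum assms(3)
proof (intro sum.cong refl arg_cong2[where f = frag_cmul] arg_cong[where f = frag_of])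
  fix k :: "nat \<Rightarrow> nat" assume k: "k \<in> {1..n} \<rightarrow>\<^sub>E {0, 1}"
  define g where "g = (\<lambda>i. if k i = 0 then \<one> else snd (xs ! (i - 1)))"
  define ps where "ps = map (\<lambda>i. (fst (xs ! (i - 1)), g i)) [1..<Suc n]"
  have xs: "xs ! i \<in> points" if "i < n" for i
    using that assms(2,3) nth_mem by blast
  have ps: "set ps \<subseteq> points" "length ps = n"
    using xs by (auto simp: ps_def g_def mem_Times_iff)
  have fst_ps: "map fst ps = map fst xs"
    unfolding ps_def map_map comp_def fst_conv by (rule nth_equalityI) (simp_all add: assms(3) del: upt_Suc)
  have pp: "power_prod G gs k a b = prod_snd (map (\<lambda>i. (fst (xs ! (i - 1)), g i)) [a..<Suc b])" if "1 \<le> a" "b \<le> n" for a b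
  proof (rule power_prod_eq_prod_snd)
    fix i assume i: "i \<in> {a..b}"
    then have "gs ! i = snd (xs ! (i - 1))" "i - 1 < n"
      using that assms(3) by (cases i; simp add: gs_def)+
    moreover have "k i \<in> {0, 1}"
      using PiE_mem[OF k, of i] i that by auto
    ultimately show "gs ! i \<in> carrier G \<and> k i \<in> {0, 1} \<and> g i = (if k i = 0 then \<one> else gs ! i)"
      using xs[of "i - 1"] by (auto simp: g_def mem_Times_iff)
  qed
  have x0: "fst x\<^sub>0 \<in> carrier M"
    using assms(1) by auto
  have "ms ! i \<triangleleft> psi_weight G \<phi> n gs k i = diff_tuple (fst x\<^sub>0) ps ! i" if i: "i \<le> n" for i
  proof -
    have "take i ps = map (\<lambda>i. (fst (xs ! (i - 1)), g i)) [1..<Suc i]" "drop i ps = map (\<lambda>i. (fst (xs ! (i - 1)), g i)) [i + 1..<Suc n]"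
      using i by (simp_all add: ps_def take_map drop_map del: upt_Suc)
    then have "psi_weight G \<phi> n gs k i = \<phi> (prod_snd (take i ps)) \<otimes> prod_snd (drop i ps)"
      using i prod_snd_closed[OF ps(1)] pp[of 1 i] pp[of "i + 1" n] pp[of 1 n] by (auto simp: psi_weight_def ps_def)
    moreover have "ms ! i = (if i < length ps then (fst x\<^sub>0 # map fst ps) ! i \<ominus>\<^bsub>M\<^esub> (fst x\<^sub>0 # map fst ps) ! Suc i else (fst x\<^sub>0 # map fst ps) ! i)"
    proof -
      have e: "(fst x\<^sub>0 # map fst ps) ! l = fst ((x\<^sub>0 # xs) ! l)" if "l \<le> n" for l
        unfolding fst_ps using that assms(3) by (cases l) auto
      show ?thesis
        using i ps(2) e[of i] e[of "Suc i"] by (auto simp: ms_def nth_append simp del: nth_Cons_Suc)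
    qed
    ultimately show ?thesis
      using diff_tuple_nth[OF x0 ps(1), of i] i ps(2) by simp
  qed
  then show "map (\<lambda>i. ms ! i \<triangleleft> psi_weight G \<phi> n gs k i) [0..<Suc n] =
      diff_tuple (fst x\<^sub>0) (map (\<lambda>i. (fst (xs ! (i - 1)), if k i = 0 then \<one> else snd (xs ! (i - 1)))) [1..<Suc n])"
    unfolding ps_def[unfolded g_def, symmetric]
    by (intro nth_equalityI) (auto simp: ps(2) nth_append less_Suc_eq_le simp del: upt_Suc)
qed

end

section \<open>Values on the symbols of the biquandle complex\<close>

context twisted_module
begin

text \<open>
  The subgroup \<open>N\<close> stands for the kernel of a cocycle.  The left-hand side is an alternating sum of
  inner faces over the cube; it differs from the alternating sum of the full group boundaries by two
  sums that lie in \<open>N\<close> because they cancel in pairs.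
\<close>
lemma cube_sum_boundary_closed:
  fixes W :: "'m list \<Rightarrow> 'b \<Rightarrow>\<^sub>0 int"
  assumes zero: "0 \<in> N" and diff: "\<And>x y. x \<in> N \<Longrightarrow> y \<in> N \<Longrightarrow> x - y \<in> N"
    and inv: "\<And>ms g. ms \<in> tuples M (length xs) \<Longrightarrow> g \<in> carrier G \<Longrightarrow> W (map (\<lambda>x. x \<triangleleft> g) ms) - W ms \<in> N"
    and bd: "\<And>ms. ms \<in> tuples M (Suc (length xs)) \<Longrightarrow> frag_extend W (gp_boundary_tuple M ms) \<in> N"
    and m: "m \<in> carrier M" and xs: "set xs \<subseteq> points" "xs \<noteq> []"
  shows "(\<Sum>i<length xs. frag_cmul ((-1) ^ i)
     (cube_sum W (fst (under (m, g) (xs ! i))) (map (\<lambda>x. under x (xs ! i)) (take i xs) @ map (\<lambda>x. over x (xs ! i)) (drop (Suc i) xs))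
      - cube_sum W m (take i xs @ drop (Suc i) xs))) \<in> N"
    (is "?S \<in> N")
proof -
  let ?n = "length xs"
  have "?S = (\<Sum>i<?n. cube \<one> (\<lambda>ps. frag_cmul ((-1) ^ i) (- W (merge (Suc i) (diff_tuple m ps)))) xs)"
  proof (rule sum.cong[OF refl])
    fix i assume "i \<in> {..<?n}"
    then have i: "i < ?n" by simp
    have "xs = take i xs @ xs ! i # drop (Suc i) xs"
      using i by (rule id_take_nth_drop)
    moreover have "set (take i xs) \<subseteq> points" "xs ! i \<in> points" "set (drop (Suc i) xs) \<subseteq> points"
      using xs i by (auto dest: in_set_takeD in_set_dropD simp del: mem_Sigma_iff)
    ultimately have "cube_sum W (fst (under (m, g) (xs ! i))) (map (\<lambda>x. under x (xs ! i)) (take i xs) @ map (\<lambda>x. over x (xs ! i)) (drop (Suc i) xs))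
      - cube_sum W m (take i xs @ drop (Suc i) xs) = - cube \<one> (\<lambda>ps. W (merge (Suc i) (diff_tuple m ps))) xs"
      using cube_sum_face_minus_omit[OF m, of "take i xs" "xs ! i" "drop (Suc i) xs" W g] i by simp
    then show "frag_cmul ((-1) ^ i) (cube_sum W (fst (under (m, g) (xs ! i))) (map (\<lambda>x. under x (xs ! i)) (take i xs) @ map (\<lambda>x. over x (xs ! i)) (drop (Suc i) xs))
      - cube_sum W m (take i xs @ drop (Suc i) xs)) = cube \<one> (\<lambda>ps. frag_cmul ((-1) ^ i) (- W (merge (Suc i) (diff_tuple m ps)))) xs"
      by (simp only: cube_frag_cmul cube_uminus)
  qed
  also have "\<dots> = cube \<one> (\<lambda>ps. \<Sum>i<?n. frag_cmul ((-1) ^ i) (- W (merge (Suc i) (diff_tuple m ps)))) xs"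
    by (rule cube_of_sum[symmetric])
  also have "\<dots> = cube \<one> (\<lambda>ps. frag_extend W (gp_boundary_tuple M (diff_tuple m ps)) - W (tl (diff_tuple m ps))
      - frag_cmul ((-1) ^ Suc ?n) (W (butlast (diff_tuple m ps)))) xs"
    by (rule cube_cong_points[OF xs(1)], rule merge_sum_eq_boundary) simp
  also have "\<dots> \<in> N"
    unfolding cube_diff cube_frag_cmul
  proof (intro diff frag_closure_minus_cmul[where P = "\<lambda>x. x \<in> N"] zero)
    show "cube \<one> (\<lambda>ps. frag_extend W (gp_boundary_tuple M (diff_tuple m ps))) xs \<in> N"
    proof (rule cube_closed[OF diff])
      fix ps assume "list_all2 (\<lambda>p x. p = (fst x, \<one>) \<or> p = x) ps xs"
      then show "frag_extend W (gp_boundary_tuple M (diff_tuple m ps)) \<in> N"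
        using list_all2_cube_subset[OF _ xs(1) G.one_closed] diff_tuple_in_tuples[OF m, of ps] by (intro bd) auto
    qed
    show "cube \<one> (\<lambda>ps. W (tl (diff_tuple m ps))) xs \<in> N"
      by (rule cube_sum_tl_closed[OF diff inv m xs])
    show "cube \<one> (\<lambda>ps. W (butlast (diff_tuple m ps))) xs \<in> N"
      by (rule cube_sum_butlast_closed[OF diff inv m xs])
  qed
  finally show ?thesis .
qed

end

text \<open>
  The operations of \<open>X\<close> are prescribed on points only: outside its carrier the module has no laws
  that would turn the action of \<open>\<phi>(h) - h\<close> into a difference.
\<close>
locale twisted_mcb = twisted_module G M sm \<phi>
  for G :: "('g, 'r) monoid_scheme" (structure) and M :: "('m, 's) ring_scheme"
    and sm :: "'m \<Rightarrow> 'g \<Rightarrow> 'm" (infixl "\<triangleleft>" 75) and \<phi> :: "'g \<Rightarrow> 'g" +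
  fixes X :: "('m \<times> 'g, 'z) mcb_scheme"
  assumes carrier_X: "carrier X = carrier M \<times> carrier G"
    and component_X: "component X (m, g) = alexander_component G m"
    and under_X: "\<lbrakk>x \<in> carrier M \<times> carrier G; y \<in> carrier M \<times> carrier G\<rbrakk> \<Longrightarrow> under_op X x y = under x y"
    and over_X: "\<lbrakk>x \<in> carrier M \<times> carrier G; y \<in> carrier M \<times> carrier G\<rbrakk> \<Longrightarrow> over_op X x y = over x y"
begin

lemma component_simps [simp]:
  "carrier (alexander_component G m) = {m} \<times> carrier G"
  "\<one>\<^bsub>alexander_component G m\<^esub> = (m, \<one>)"
  "(a, g) \<otimes>\<^bsub>alexander_component G m\<^esub> (b, h) = (m, g \<otimes> h)"
  by (simp_all add: alexander_component_def)

lemma group_component: "group (alexander_component G m)"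
  by (rule groupI) (auto simp: G.m_assoc intro!: exI[of _ "inv _"])

lemma inv_component: "g \<in> carrier G \<Longrightarrow> inv\<^bsub>alexander_component G m\<^esub> (m, g) = (m, inv g)"
  by (rule group.inv_equality[OF group_component]) auto

lemma in_one_component_iff: "in_one_component X S \<longleftrightarrow> (\<exists>m\<in>carrier M. S \<subseteq> {m} \<times> carrier G)"
  unfolding in_one_component_def carrier_X
  by (auto simp: component_X subset_iff intro!: bexI[of _ "\<one>"])

text \<open>
  The composite \<open>\<psi>\<^sub>n \<circ> \<gamma>\<^sub>n \<circ> proj\<^sub>n\<close> on a symbol, with \<open>W\<close> recording the group part of \<open>x\<^sub>0\<close> next to each
  tuple.  The projection is zero in degrees below 2.
\<close>
definition symb_val :: "nat \<Rightarrow> ('g \<Rightarrow> 'm list \<Rightarrow> 'b \<Rightarrow>\<^sub>0 int) \<Rightarrow> ('m \<times> 'g) symb \<Rightarrow> 'b \<Rightarrow>\<^sub>0 int" where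
  "symb_val n W = (\<lambda>(x\<^sub>0, xss).
     if 2 \<le> n \<and> length xss = n then cube_sum (W (snd x\<^sub>0)) (fst x\<^sub>0) (map hd xss) else 0)"

abbreviation blocks :: "('m \<times> 'g) list list \<Rightarrow> bool" where
  "blocks xss \<equiv> \<forall>xs\<in>set xss. xs \<noteq> [] \<and> in_one_component X (set xs)"

lemma block_subset: "in_one_component X (set xs) \<Longrightarrow> set xs \<subseteq> points"
  by (auto simp: in_one_component_iff)

lemma hd_blocks: "blocks xss \<Longrightarrow> set (map hd xss) \<subseteq> points"
  using block_subset hd_in_set by (simp add: image_subset_iff del: mem_Sigma_iff) blast

lemma frag_extend_mk_symb:
  "frag_extend F (mk_symb x\<^sub>0 xss) = F (x\<^sub>0, filter (\<lambda>xs. xs \<noteq> []) xss)"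
  by (simp add: mk_symb_def)

text \<open>
  Splitting the list of blocks at the block that is being removed or shortened avoids index
  computations in what follows.
\<close>
lemma mcb_face_append:
  "mcb_face X (x\<^sub>0, us @ xs # vs) (length us) =
     mk_symb (under_op X x\<^sub>0 (hd xs))
       (map (map (\<lambda>x. under_op X x (hd xs))) us @
        map (\<lambda>x. over_op X (inv\<^bsub>component X (hd xs)\<^esub> (hd xs) \<otimes>\<^bsub>component X (hd xs)\<^esub> x) (hd xs)) (tl xs) #
        map (map (\<lambda>x. over_op X x (hd xs))) vs) +
     (\<Sum>j = 1..length xs. frag_cmul ((-1) ^ j) (mk_symb x\<^sub>0 (us @ (take (j - 1) xs @ drop j xs) # vs)))"
  by (simp add: mcb_face_def Let_def)

lemma filter_blocks: "blocks xss \<Longrightarrow> filter (\<lambda>xs. xs \<noteq> []) xss = xss"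
  by (simp add: filter_id_conv)

lemma filter_map_blocks: "blocks xss \<Longrightarrow> filter (\<lambda>xs. xs \<noteq> []) (map (map f) xss) = map (map f) xss"
  by (simp add: filter_id_conv)

lemma map_hd_under:
  assumes "blocks xss" "y \<in> points"
  shows "map hd (map (map (\<lambda>x. under_op X x y)) xss) = map (\<lambda>x. under x y) (map hd xss)"
proof -
  have "hd xs \<in> points" if "xs \<in> set xss" for xs
    using hd_blocks[OF assms(1)] that by (simp add: image_subset_iff del: mem_Sigma_iff)
  then show ?thesis
    using assms by (simp add: hd_map under_X del: mem_Sigma_iff)
qed

lemma map_hd_over:
  assumes "blocks xss" "y \<in> points"
  shows "map hd (map (map (\<lambda>x. over_op X x y)) xss) = map (\<lambda>x. over x y) (map hd xss)"
proof -
  have "hd xs \<in> points" if "xs \<in> set xss" for xs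
    using hd_blocks[OF assms(1)] that by (simp add: image_subset_iff del: mem_Sigma_iff)
  then show ?thesis
    using assms by (simp add: hd_map over_X del: mem_Sigma_iff)
qed

text \<open>
  A face never has more blocks than the symbol, and one block less if it empties a singleton block.
\<close>
lemma symb_val_face_low:
  assumes "length us + length vs + 1 < n \<or> (length us + length vs + 1 = n \<and> length xs = 1)"
  shows "frag_extend (symb_val n W) (mcb_face X (x\<^sub>0, us @ xs # vs) (length us)) = 0"
proof -
  have 0: "frag_extend (symb_val n W) (mk_symb y (us' @ zs # vs')) = 0"
    if "length us' = length us" "length vs' = length vs" "length xs = 1 \<Longrightarrow> zs = []" for y us' vs' zs
  proof -
    have "length (filter (\<lambda>xs. xs \<noteq> []) us') \<le> length us" "length (filter (\<lambda>xs. xs \<noteq> []) vs') \<le> length vs"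
      using that(1,2) length_filter_le[of "\<lambda>xs. xs \<noteq> []" us'] length_filter_le[of "\<lambda>xs. xs \<noteq> []" vs']
      by simp_all
    then show ?thesis
      using assms that by (auto simp: frag_extend_mk_symb symb_val_def)
  qed
  have "length xs = 1 \<Longrightarrow> tl xs = []"
    by (cases xs) auto
  then show ?thesis
    unfolding mcb_face_append frag_extend_add
    by (subst 0) (auto simp: frag_extend_sum frag_extend_cmul 0 intro!: sum.neutral)
qed

text \<open>
  The label of \<open>x\<^sub>0\<close> is conjugated in the first face, so \<open>W\<close> has to be invariant under conjugation.
\<close>
lemma symb_val_face_single:
  assumes inv: "\<And>g h. g \<in> carrier G \<Longrightarrow> h \<in> carrier G \<Longrightarrow> W (inv h \<otimes> g \<otimes> h) = W g"
    and "2 \<le> n" "length us + length vs = n" "blocks us" "blocks vs" "x\<^sub>0 \<in> points" "y \<in> points"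
  shows "frag_extend (symb_val n W) (mcb_face X (x\<^sub>0, us @ [y] # vs) (length us)) =
    cube_sum (W (snd x\<^sub>0)) (fst (under x\<^sub>0 y)) (map (\<lambda>x. under x y) (map hd us) @ map (\<lambda>x. over x y) (map hd vs)) -
    cube_sum (W (snd x\<^sub>0)) (fst x\<^sub>0) (map hd us @ map hd vs)"
proof -
  have "W (snd (under x\<^sub>0 y)) = W (snd x\<^sub>0)"
    using assms by (auto simp: snd_under inv)
  then show ?thesis
    using assms(2-)
    by (simp add: mcb_face_append frag_extend_add frag_extend_minus frag_extend_diff frag_extend_mk_symb filter_blocks filter_map_blocks symb_val_def
        map_hd_under[unfolded map_map] map_hd_over[unfolded map_map] under_X del: mem_Sigma_iff)
qed

text \<open>
  The faces are those of \<open>cube_sum_split\<close> for \<open>xs = [(m, a), (m, b)]\<close>, where \<open>a \<otimes> (inv a \<otimes> b) = b\<close>; the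
  two deletions leave \<open>b\<close> with sign \<open>-1\<close> and \<open>a\<close> with sign \<open>1\<close>.
\<close>
lemma symb_val_face_pair:
  assumes inv: "\<And>g h. g \<in> carrier G \<Longrightarrow> h \<in> carrier G \<Longrightarrow> W (inv h \<otimes> g \<otimes> h) = W g"
    and "length us + length vs + 1 = n" "blocks us" "blocks vs" "x\<^sub>0 \<in> points" "length xs = 2" "in_one_component X (set xs)"
  shows "frag_extend (symb_val n W) (mcb_face X (x\<^sub>0, us @ xs # vs) (length us)) = 0"
proof (cases "2 \<le> n")
  case True
  obtain m a b where xs: "xs = [(m, a), (m, b)]" and mab: "m \<in> carrier M" "a \<in> carrier G" "b \<in> carrier G"
  proof -
    obtain y z where "xs = [y, z]"
      using assms(6) by (auto simp: length_Suc_conv numeral_2_eq_2)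
    then show thesis
      using assms(7) that by (auto simp: in_one_component_iff)
  qed
  let ?C = "cube_sum (W (snd x\<^sub>0)) (fst x\<^sub>0)"
  let ?us = "map hd us" and ?vs = "map hd vs"
  have x: "under_op X x\<^sub>0 (m, a) = under x\<^sub>0 (m, a)" "fst x\<^sub>0 \<in> carrier M"
    using assms(5) mab by (auto simp: under_X)
  have W: "W (snd (under x\<^sub>0 (m, a))) = W (snd x\<^sub>0)"
    using assms mab by (auto simp: snd_under inv)
  have o: "over_op X (inv\<^bsub>component X (m, a)\<^esub> (m, a) \<otimes>\<^bsub>component X (m, a)\<^esub> (m, b)) (m, a) = (m \<triangleleft> \<phi> a, inv a \<otimes> b)"
    using mab by (simp add: component_X inv_component over_X over_def)
  have sp: "cube_sum (W (snd x\<^sub>0)) (fst (under x\<^sub>0 (m, a))) (map (\<lambda>x. under x (m, a)) ?us @ (m \<triangleleft> \<phi> a, inv a \<otimes> b) # map (\<lambda>x. over x (m, a)) ?vs) =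
      ?C (?us @ (m, b) # ?vs) - ?C (?us @ (m, a) # ?vs)"
    using cube_sum_split[of "fst x\<^sub>0" ?us "(m, a)" "inv a \<otimes> b" ?vs "W (snd x\<^sub>0)" "snd x\<^sub>0"] x(2) mab
      hd_blocks[OF assms(3)] hd_blocks[OF assms(4)]
    by (simp flip: G.m_assoc del: set_map map_map)
  have "frag_extend (symb_val n W) (mcb_face X (x\<^sub>0, us @ xs # vs) (length us)) =
      cube_sum (W (snd x\<^sub>0)) (fst (under x\<^sub>0 (m, a))) (map (\<lambda>x. under x (m, a)) ?us @ (m \<triangleleft> \<phi> a, inv a \<otimes> b) # map (\<lambda>x. over x (m, a)) ?vs)
      - ?C (?us @ (m, b) # ?vs) + ?C (?us @ (m, a) # ?vs)"
    using assms(2-5) True mab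
    by (simp add: xs mcb_face_append o x(1) W numeral_2_eq_2 frag_extend_add frag_extend_minus frag_extend_diff frag_extend_mk_symb filter_blocks filter_map_blocks
        symb_val_def map_hd_under[unfolded map_map] map_hd_over[unfolded map_map])
  then show ?thesis
    unfolding sp by simp
qed (auto simp: symb_val_def frag_extend_def)

lemma length_le_sum_list_length: "\<forall>xs\<in>set xss. xs \<noteq> [] \<Longrightarrow> length xss \<le> sum_list (map length xss)"
proof (induction xss)
  case (Cons xs xss)
  then have "length xss \<le> sum_list (map length xss)" "0 < length xs"
    by auto
  then show ?case
    unfolding list.map sum_list.Cons list.size by linarith
qed simp

lemma all_singletons:
  assumes "\<forall>xs\<in>set xss. xs \<noteq> []" "sum_list (map length xss) = length xss"
  shows "\<forall>xs\<in>set xss. length xs = 1"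
  using assms
proof (induction xss)
  case (Cons xs xss)
  have "length xss \<le> sum_list (map length xss)" "0 < length xs" "length xs + sum_list (map length xss) = Suc (length xss)"
    using Cons.prems length_le_sum_list_length[of xss] by auto
  then have "length xs = 1" "sum_list (map length xss) = length xss"
    by linarith+
  then show ?case
    using Cons by auto
qed simp

text \<open>
  A symbol of degree \<open>n + 1\<close> has at most \<open>n + 1\<close> blocks.  With \<open>n + 1\<close> blocks all of them are singletons
  and the group boundary appears; with \<open>n\<close> blocks exactly one of them has two entries and its faces
  cancel, while a face at a singleton loses a block; with fewer blocks no face reaches the \<open>n\<close> blocks seen by the projection.
\<close>
lemma symb_val_boundary_closed:
  assumes zero: "0 \<in> N" and diff: "\<And>x y. x \<in> N \<Longrightarrow> y \<in> N \<Longrightarrow> x - y \<in> N"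
    and conj: "\<And>g h. g \<in> carrier G \<Longrightarrow> h \<in> carrier G \<Longrightarrow> W (inv h \<otimes> g \<otimes> h) = W g"
    and inv: "\<And>ms g h. \<lbrakk>ms \<in> tuples M (Suc n); g \<in> carrier G; h \<in> carrier G\<rbrakk> \<Longrightarrow> W h (map (\<lambda>x. x \<triangleleft> g) ms) - W h ms \<in> N"
    and bd: "\<And>ms h. \<lbrakk>ms \<in> tuples M (Suc (Suc n)); h \<in> carrier G\<rbrakk> \<Longrightarrow> frag_extend (W h) (gp_boundary_tuple M ms) \<in> N"
    and symb: "(x\<^sub>0, xss) \<in> mcb_symbols X (Suc n)"
  shows "frag_extend (symb_val n W) (mcb_boundary X (frag_of (x\<^sub>0, xss))) \<in> N"
proof (cases "2 \<le> n")
  case True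
  let ?L = "\<lambda>i. sum_list (map length (take i xss))"
  have x0: "x\<^sub>0 \<in> points" and bl: "blocks xss" and sl: "sum_list (map length xss) = Suc n"
    using symb by (auto simp: mcb_symbols_def carrier_X)
  have eq: "frag_extend (symb_val n W) (mcb_boundary X (frag_of (x\<^sub>0, xss))) =
      (\<Sum>i<length xss. frag_cmul ((-1) ^ ?L i) (frag_extend (symb_val n W) (mcb_face X (x\<^sub>0, xss) i)))"
    by (simp add: mcb_boundary_def frag_extend_sum frag_extend_cmul comp_def)
  have split: "take i xss @ xss ! i # drop (Suc i) xss = xss" "blocks (take i xss)" "blocks (drop (Suc i) xss)"
    "length (take i xss) = i" "length xss = i + length (drop (Suc i) xss) + 1" "xss ! i \<noteq> []" "in_one_component X (set (xss ! i))"
    "length (xss ! i) + length xss \<le> n + 2"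
    if "i < length xss" for i
  proof -
    show s: "take i xss @ xss ! i # drop (Suc i) xss = xss"
      using that by (rule id_take_nth_drop[symmetric])
    show t: "blocks (take i xss)" "blocks (drop (Suc i) xss)"
      using bl by (auto dest: in_set_takeD in_set_dropD)
    show l: "length (take i xss) = i" "length xss = i + length (drop (Suc i) xss) + 1" "xss ! i \<noteq> []" "in_one_component X (set (xss ! i))"
      using that bl by auto
    have "sum_list (map length xss) = sum_list (map length (take i xss)) + length (xss ! i) + sum_list (map length (drop (Suc i) xss))"
      by (subst s[symmetric]) (simp only: map_append sum_list.append list.map sum_list.Cons add.assoc)
    moreover have "length (take i xss) \<le> sum_list (map length (take i xss))" "length (drop (Suc i) xss) \<le> sum_list (map length (drop (Suc i) xss))"
      using t by (intro length_le_sum_list_length; blast)+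
    ultimately show "length (xss ! i) + length xss \<le> n + 2"
      using sl l(1,2) by linarith
  qed
  show ?thesis
  proof (cases "length xss = Suc n")
    case False
    have "frag_extend (symb_val n W) (mcb_face X (x\<^sub>0, xss) i) = 0" if i: "i < length xss" for i
    proof -
      note s = split[OF i]
      have le: "length xss \<le> n"
        using length_le_sum_list_length[of xss] bl sl False by force
      have l: "length (take i xss) + length (drop (Suc i) xss) + 1 = length xss"
        using s(4,5) by linarith
      have "frag_extend (symb_val n W) (mcb_face X (x\<^sub>0, take i xss @ xss ! i # drop (Suc i) xss) (length (take i xss))) = 0"
      proof (cases "length xss = n \<and> length (xss ! i) \<noteq> 1")
        case True
        then have "length (xss ! i) = 2"
          using s(8) length_greater_0_conv[of "xss ! i"] s(6) by linarith
        moreover have "length (take i xss) + length (drop (Suc i) xss) + 1 = n"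
          using True l by linarith
        ultimately show ?thesis
          using s(2,3,7) by (intro symb_val_face_pair[OF conj _ _ _ x0]) assumption+
      next
        case False
        show ?thesis
          by (rule symb_val_face_low, unfold l) (use le False in auto)
      qed
      then show ?thesis
        using s(1,4) by simp
    qed
    then show ?thesis
      unfolding eq using zero by simp
  next
    case len: True
    define xs where "xs = map hd xss"
    have "[hd zs] = zs" if "zs \<in> set xss" for zs
      using all_singletons[of xss] bl sl len that by (cases zs) auto
    then have xss: "xss = map (\<lambda>x. [x]) xs"
      by (simp add: xs_def comp_def map_idI)
    have xs: "set xs \<subseteq> points" "length xs = Suc n"
      unfolding xs_def using hd_blocks[OF bl] len by simp_all
    have "frag_extend (symb_val n W) (mcb_face X (x\<^sub>0, xss) i) =
      cube_sum (W (snd x\<^sub>0)) (fst (under (fst x\<^sub>0, snd x\<^sub>0) (xs ! i))) (map (\<lambda>x. under x (xs ! i)) (take i xs) @ map (\<lambda>x. over x (xs ! i)) (drop (Suc i) xs))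
      - cube_sum (W (snd x\<^sub>0)) (fst x\<^sub>0) (take i xs @ drop (Suc i) xs)" if i: "i < length xs" for i
    proof -
      have i': "i < length xss"
        using i len xs by simp
      note s = split[OF i']
      have y: "xss ! i = [xs ! i]" "xs ! i \<in> points"
        using i xs by (auto simp: xss simp del: mem_Sigma_iff)
      have "frag_extend (symb_val n W) (mcb_face X (x\<^sub>0, take i xss @ [xs ! i] # drop (Suc i) xss) (length (take i xss))) =
        cube_sum (W (snd x\<^sub>0)) (fst (under x\<^sub>0 (xs ! i))) (map (\<lambda>x. under x (xs ! i)) (map hd (take i xss)) @ map (\<lambda>x. over x (xs ! i)) (map hd (drop (Suc i) xss)))
        - cube_sum (W (snd x\<^sub>0)) (fst x\<^sub>0) (map hd (take i xss) @ map hd (drop (Suc i) xss))"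
      proof (rule symb_val_face_single[OF conj True _ s(2,3) x0 y(2)])
        show "length (take i xss) + length (drop (Suc i) xss) = n"
          using s(4,5) len by linarith
      qed
      then show ?thesis
        using s(1,4) y(1) by (simp add: xs_def take_map drop_map)
    qed
    moreover have "?L i = i" if "i < length xs" for i
      using that by (simp add: xss take_map comp_def sum_list_triv)
    ultimately have "frag_extend (symb_val n W) (mcb_boundary X (frag_of (x\<^sub>0, xss))) = (\<Sum>i<length xs. frag_cmul ((-1) ^ i)
      (cube_sum (W (snd x\<^sub>0)) (fst (under (fst x\<^sub>0, snd x\<^sub>0) (xs ! i))) (map (\<lambda>x. under x (xs ! i)) (take i xs) @ map (\<lambda>x. over x (xs ! i)) (drop (Suc i) xs))
      - cube_sum (W (snd x\<^sub>0)) (fst x\<^sub>0) (take i xs @ drop (Suc i) xs)))"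
      unfolding eq using len xs by (intro sum.cong) auto
    also have "\<dots> \<in> N"
      using x0 xs by (intro cube_sum_boundary_closed zero diff inv bd) auto
    finally show ?thesis .
  qed
next
  case False
  then show ?thesis
    using zero by (auto simp: symb_val_def frag_extend_def)
qed

lemma symb_val_in_free:
  assumes "\<And>ms g. \<lbrakk>ms \<in> tuples M (Suc n); g \<in> carrier G\<rbrakk> \<Longrightarrow> W g ms \<in> N"
    and zero: "0 \<in> N" and diff: "\<And>x y. x \<in> N \<Longrightarrow> y \<in> N \<Longrightarrow> x - y \<in> N"
    and "s \<in> mcb_symbols X n"
  shows "symb_val n W s \<in> N"
proof -
  obtain x\<^sub>0 xss where s: "s = (x\<^sub>0, xss)" by (cases s)
  have x0: "x\<^sub>0 \<in> points" and bl: "blocks xss"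
    using assms(4) by (auto simp: s mcb_symbols_def carrier_X)
  have "cube_sum (W (snd x\<^sub>0)) (fst x\<^sub>0) (map hd xss) \<in> N" if "length xss = n"
    using x0 that by (intro cube_sum_closed assms(1) diff hd_blocks[OF bl]) auto
  then show ?thesis
    by (simp add: s symb_val_def zero)
qed

text \<open>
  The blocks \<open>as\<close> and \<open>bs\<close> sit at the positions \<open>length uss + 1\<close> and \<open>length uss + 2\<close> when \<open>x\<^sub>0\<close> has
  position 0, so the zero entry of the tuple has index \<open>length uss + 1 < n\<close>.
\<close>
lemma symb_val_degenerate_closed:
  assumes deg: "\<And>ms g i. \<lbrakk>ms \<in> tuples M (Suc n); g \<in> carrier G; i < n; ms ! i = \<zero>\<^bsub>M\<^esub>\<rbrakk> \<Longrightarrow> W g ms \<in> N"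
    and zero: "0 \<in> N" and diff: "\<And>x y. x \<in> N \<Longrightarrow> y \<in> N \<Longrightarrow> x - y \<in> N"
    and symb: "(x\<^sub>0, uss @ [as, bs] @ vss) \<in> mcb_symbols X n" and one: "in_one_component X (set as \<union> set bs)"
  shows "symb_val n W (x\<^sub>0, uss @ [as, bs] @ vss) \<in> N"
proof -
  let ?xss = "uss @ [as, bs] @ vss"
  have x0: "x\<^sub>0 \<in> points" and bl: "blocks ?xss"
    using symb by (auto simp: mcb_symbols_def carrier_X)
  have "hd as \<in> set as" "hd bs \<in> set bs"
    using bl by auto
  then have hd: "fst (hd as) = fst (hd bs)"
    using one by (auto simp: in_one_component_iff dest!: subsetD)
  have "cube_sum (W (snd x\<^sub>0)) (fst x\<^sub>0) (map hd ?xss) \<in> N" if n: "length ?xss = n"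
    unfolding cube_sum_def
  proof (rule cube_closed[OF diff])
    fix ps assume "list_all2 (\<lambda>p x. p = (fst x, \<one>) \<or> p = x) ps (map hd ?xss)"
    from list_all2_cube_subset[OF this hd_blocks[OF bl] G.one_closed]
    have ps: "set ps \<subseteq> points" "length ps = n" "map fst ps = map fst (map hd ?xss)"
      using n by auto
    let ?i = "length uss"
    have "fst (ps ! j) = map fst (map hd ?xss) ! j" if "j < n" for j
      using that ps by (metis nth_map)
    from this[of ?i] this[of "Suc ?i"] have "fst (ps ! ?i) = fst (ps ! Suc ?i)"
      using n hd by (simp add: nth_append)
    then have "diff_tuple (fst x\<^sub>0) ps ! Suc ?i = \<zero>\<^bsub>M\<^esub>"
      using x0 ps n by (intro diff_tuple_zero) auto
    then show "W (snd x\<^sub>0) (diff_tuple (fst x\<^sub>0) ps) \<in> N"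
      using x0 ps n diff_tuple_in_tuples[of "fst x\<^sub>0" ps] by (intro deg[of _ _ "Suc ?i"]) auto
  qed
  then show ?thesis
    by (simp add: symb_val_def zero)
qed

end

section \<open>Quotients of free abelian groups\<close>

lemma normal_generate_free_Abelian_group:
  assumes "gens \<subseteq> carrier (free_Abelian_group S)"
  shows "generate (free_Abelian_group S) gens \<lhd> free_Abelian_group S"
  by (rule comm_group.subgroup_imp_normal[OF abelian_free_Abelian_group
        group.generate_is_subgroup[OF group_free_Abelian_group assms]])

lemma hom_generate_one:
  assumes "group F" "group B" "h \<in> hom F B" "gens \<subseteq> carrier F"
    and "\<And>x. x \<in> gens \<Longrightarrow> h x = \<one>\<^bsub>B\<^esub>" and "d \<in> generate F gens"
  shows "h d = \<one>\<^bsub>B\<^esub>"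
proof -
  interpret group_hom F B h
    using assms by (simp add: group_hom_def group_hom_axioms_def)
  have "generate F gens \<subseteq> kernel F B h"
    using assms by (intro G.generate_subgroup_incl subgroup_kernel) (auto simp: kernel_def)
  then show ?thesis
    using assms by (auto simp: kernel_def)
qed

text \<open>
  A homomorphism that is trivial on a normal subgroup is constant on its cosets, so the map it induces
  on the quotient can be described as taking the common value on a coset.
\<close>
lemma the_elem_image_coset:
  assumes "D \<lhd> F" "group B" "h \<in> hom F B" "\<And>d. d \<in> D \<Longrightarrow> h d = \<one>\<^bsub>B\<^esub>" "c \<in> carrier F"
  shows "the_elem (h ` (D #>\<^bsub>F\<^esub> c)) = h c"
proof -
  interpret D: normal D F by fact
  interpret B: group B by fact
  have "h x = h c" if "x \<in> D #>\<^bsub>F\<^esub> c" for x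
  proof -
    obtain d where "d \<in> D" "x = d \<otimes>\<^bsub>F\<^esub> c"
      using \<open>x \<in> D #>\<^bsub>F\<^esub> c\<close> by (auto simp: r_coset_def)
    then show ?thesis
      using hom_mult[OF assms(3), of d c] assms(4,5) hom_in_carrier[OF assms(3,5)] D.mem_carrier by simp
  qed
  moreover have "c \<in> D #>\<^bsub>F\<^esub> c"
    using D.rcos_self[OF assms(5) D.subgroup_axioms] .
  ultimately show ?thesis
    by (intro the_elem_image_unique) blast+
qed

lemma the_elem_image_hom:
  assumes "D \<lhd> F" "group B" "h \<in> hom F B" "\<And>d. d \<in> D \<Longrightarrow> h d = \<one>\<^bsub>B\<^esub>"
  shows "(\<lambda>C. the_elem (h ` C)) \<in> hom (F Mod D) B"
proof (rule homI)
  interpret D: normal D F by fact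
  note the = the_elem_image_coset[OF assms]
  fix C assume "C \<in> carrier (F Mod D)"
  then obtain c where c: "c \<in> carrier F" "C = D #>\<^bsub>F\<^esub> c"
    by (auto simp: carrier_FactGroup)
  then show "the_elem (h ` C) \<in> carrier B"
    using the hom_in_carrier[OF assms(3)] by simp
  fix C' assume "C' \<in> carrier (F Mod D)"
  then obtain c' where c': "c' \<in> carrier F" "C' = D #>\<^bsub>F\<^esub> c'"
    by (auto simp: carrier_FactGroup)
  have "C \<otimes>\<^bsub>F Mod D\<^esub> C' = D #>\<^bsub>F\<^esub> (c \<otimes>\<^bsub>F\<^esub> c')"
    using c c' by (simp add: D.rcos_sum)
  then show "the_elem (h ` (C \<otimes>\<^bsub>F Mod D\<^esub> C')) = the_elem (h ` C) \<otimes>\<^bsub>B\<^esub> the_elem (h ` C')"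
    using c c' the hom_mult[OF assms(3)] by simp
qed

text \<open>
  The sum of the subgroup \<open>K\<close> and the image of a coset of \<open>N\<close> is a single coset of \<open>K\<close> because \<open>h\<close> sends
  \<open>N\<close> into \<open>K\<close>.
\<close>
lemma induced_map_coset:
  assumes "K \<lhd> free_Abelian_group T"
    and add: "\<And>x y. h (x + y) = h x + h y"
    and N: "N \<lhd> free_Abelian_group S" "\<And>d. d \<in> N \<Longrightarrow> h d \<in> K"
  shows "induced_map (free_Abelian_group T) K h (N #>\<^bsub>free_Abelian_group S\<^esub> c) = K #>\<^bsub>free_Abelian_group T\<^esub> h c"
proof -
  interpret K: normal K "free_Abelian_group T" by fact
  interpret N: normal N "free_Abelian_group S" by fact
  have K: "x + y \<in> K" if "x \<in> K" "y \<in> K" for x y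
    using subgroup.m_closed[OF K.subgroup_axioms that] by simp
  have 0: "0 \<in> N"
    using subgroup.one_closed[OF N.subgroup_axioms] by simp
  show ?thesis
    unfolding induced_map_def set_mult_def r_coset_def
  proof (intro equalityI subsetI)
    fix x assume "x \<in> (\<Union>k\<in>K. \<Union>y\<in>h ` (\<Union>d\<in>N. {d \<otimes>\<^bsub>free_Abelian_group S\<^esub> c}). {k \<otimes>\<^bsub>free_Abelian_group T\<^esub> y})"
    then obtain k d where "k \<in> K" "d \<in> N" "x = (k + h d) + h c"
      by (auto simp: add add.assoc)
    then show "x \<in> (\<Union>k\<in>K. {k \<otimes>\<^bsub>free_Abelian_group T\<^esub> h c})"
      using K N(2) by auto
  next
    fix x assume "x \<in> (\<Union>k\<in>K. {k \<otimes>\<^bsub>free_Abelian_group T\<^esub> h c})"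
    then obtain k where "k \<in> K" "x = k + h (0 + c)"
      by auto
    then show "x \<in> (\<Union>k\<in>K. \<Union>y\<in>h ` (\<Union>d\<in>N. {d \<otimes>\<^bsub>free_Abelian_group S\<^esub> c}). {k \<otimes>\<^bsub>free_Abelian_group T\<^esub> y})"
      unfolding mult_free_Abelian_group using 0 by blast
  qed
qed

lemma hom_free_Abelian_kernel:
  assumes "group B" "h \<in> hom (free_Abelian_group S) B"
  defines "N \<equiv> {c. Poly_Mapping.keys c \<subseteq> S \<and> h c = \<one>\<^bsub>B\<^esub>}"
  shows "0 \<in> N" "\<And>x y. x \<in> N \<Longrightarrow> y \<in> N \<Longrightarrow> x - y \<in> N"
proof -
  interpret group_hom "free_Abelian_group S" B h
    using assms by (simp add: group_hom_def group_hom_axioms_def)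
  show "0 \<in> N"
    using hom_one by (simp add: N_def)
  fix x y assume "x \<in> N" "y \<in> N"
  then have "Poly_Mapping.keys x \<subseteq> S" "Poly_Mapping.keys y \<subseteq> S" "h x = \<one>\<^bsub>B\<^esub>" "h y = \<one>\<^bsub>B\<^esub>"
    by (auto simp: N_def)
  moreover from this have "h (x - y) = h x \<otimes>\<^bsub>B\<^esub> inv\<^bsub>B\<^esub> h y"
    using hom_mult[of x "- y"] hom_inv[of y] by simp
  ultimately show "x - y \<in> N"
    using keys_diff[of x y] by (auto simp: N_def)
qed

lemma frag_extend_hom:
  assumes "\<And>x. x \<in> S \<Longrightarrow> Poly_Mapping.keys (F x) \<subseteq> T"
  shows "frag_extend F \<in> hom (free_Abelian_group S) (free_Abelian_group T)"
proof (rule homI)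
  fix x assume "x \<in> carrier (free_Abelian_group S)"
  then have "(\<Union>a\<in>Poly_Mapping.keys x. Poly_Mapping.keys (F a)) \<subseteq> T"
    using assms by (auto dest!: subsetD)
  then show "frag_extend F x \<in> carrier (free_Abelian_group T)"
    unfolding carrier_free_Abelian_group_iff by (rule order_trans[OF keys_frag_extend])
next
  fix x y
  show "frag_extend F (x \<otimes>\<^bsub>free_Abelian_group S\<^esub> y) = frag_extend F x \<otimes>\<^bsub>free_Abelian_group T\<^esub> frag_extend F y"
    by (simp only: mult_free_Abelian_group frag_extend_add)
qed

lemma normal_free_closed:
  assumes "K \<lhd> free_Abelian_group T"
  shows "0 \<in> K" "x \<in> K \<Longrightarrow> y \<in> K \<Longrightarrow> x + y \<in> K" "x \<in> K \<Longrightarrow> - x \<in> K" "x \<in> K \<Longrightarrow> y \<in> K \<Longrightarrow> x - y \<in> K"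
    and "x \<in> K \<Longrightarrow> Poly_Mapping.keys x \<subseteq> T"
proof -
  note S = normal_imp_subgroup[OF assms]
  show 0: "0 \<in> K" and add: "\<And>x y. x \<in> K \<Longrightarrow> y \<in> K \<Longrightarrow> x + y \<in> K"
    using subgroup.one_closed[OF S] subgroup.m_closed[OF S] by simp_all
  show keys: "\<And>x. x \<in> K \<Longrightarrow> Poly_Mapping.keys x \<subseteq> T"
    using subgroup.mem_carrier[OF S] by simp
  show minus: "\<And>x. x \<in> K \<Longrightarrow> - x \<in> K"
    using subgroup.m_inv_closed[OF S] keys by fastforce
  show "\<And>x y. x \<in> K \<Longrightarrow> y \<in> K \<Longrightarrow> x - y \<in> K"
    using add minus by fastforce
qed

lemma coset_free_eqI:
  assumes "K \<lhd> free_Abelian_group T" "x - y \<in> K"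
  shows "K #>\<^bsub>free_Abelian_group T\<^esub> x = K #>\<^bsub>free_Abelian_group T\<^esub> y"
proof -
  note K = normal_free_closed[OF assms(1)]
  have "k + x \<in> (\<lambda>k. k + y) ` K" if "k \<in> K" for k
    using K(2)[OF that assms(2)] by (intro image_eqI[of _ _ "k + (x - y)"]) auto
  moreover have "k + y \<in> (\<lambda>k. k + x) ` K" if "k \<in> K" for k
    using K(4)[OF that assms(2)] by (intro image_eqI[of _ _ "k - (x - y)"]) auto
  ultimately have "(\<lambda>k. k + x) ` K = (\<lambda>k. k + y) ` K"
    by (intro equalityI image_subsetI)
  then show ?thesis
    by (simp add: r_coset_def UNION_singleton_eq_range)
qed

lemma frag_extend_generate:
  assumes K: "K \<lhd> free_Abelian_group T" and gens: "gens \<subseteq> carrier (free_Abelian_group S)"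
    and F: "\<And>x. x \<in> gens \<Longrightarrow> frag_extend F x \<in> K"
    and d: "d \<in> generate (free_Abelian_group S) gens"
  shows "frag_extend F d \<in> K"
  using d
proof (induction rule: generate.induct)
  case (inv h)
  then have "inv\<^bsub>free_Abelian_group S\<^esub> h = - h"
    using subsetD[OF gens inv] by simp
  then show ?case
    using F[OF inv] normal_free_closed(3)[OF K] by (simp add: frag_extend_minus)
qed (use normal_free_closed[OF K] F in \<open>auto simp: frag_extend_add\<close>)

lemma coset_hom_free:
  "K \<lhd> free_Abelian_group T \<Longrightarrow> (\<lambda>x. K #>\<^bsub>free_Abelian_group T\<^esub> x) \<in> hom (free_Abelian_group T) (free_Abelian_group T Mod K)"
  by (rule normal.r_coset_hom_Mod)

lemma coset_free_one:
  assumes "K \<lhd> free_Abelian_group T" "x \<in> K"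
  shows "K #>\<^bsub>free_Abelian_group T\<^esub> x = \<one>\<^bsub>free_Abelian_group T Mod K\<^esub>"
  using assms subgroup.rcos_const[OF normal_imp_subgroup group_free_Abelian_group] by simp

section \<open>Cocycles of the biquandle\<close>

lemma frag_cmul_in_free:
  "x \<in> carrier (free_Abelian_group S) \<Longrightarrow> frag_cmul c x \<in> carrier (free_Abelian_group S)"
  using keys_cmul[of c x] by auto

lemma gp_boundary_tuple_in_free:
  assumes "abelian_group M" "ms \<in> tuples M (Suc n)" "0 < n"
  shows "gp_boundary_tuple M ms \<in> carrier (free_Abelian_group (tuples M n))"
proof -
  interpret abelian_group M by fact
  interpret F: group "free_Abelian_group (tuples M n)" by simp
  have ms: "length ms = Suc n" "set ms \<subseteq> carrier M" "ms \<noteq> []"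
    using assms by (auto simp: tuples_def)
  have add: "x + y \<in> carrier (free_Abelian_group (tuples M n))"
    if "x \<in> carrier (free_Abelian_group (tuples M n))" "y \<in> carrier (free_Abelian_group (tuples M n))" for x y
    using F.m_closed[OF that] by simp
  have "set (tl ms) \<subseteq> set ms" "set (butlast ms) \<subseteq> set ms"
    by (auto dest: in_set_butlastD list.set_sel(2)[OF ms(3)])
  then have "tl ms \<in> tuples M n" "butlast ms \<in> tuples M n"
    using ms by (simp_all add: tuples_def)
  moreover have "take (i - 1) ms @ [ms ! (i - 1) \<oplus>\<^bsub>M\<^esub> ms ! i] @ drop (i + 1) ms \<in> tuples M n"
    if "i \<in> {1..<length ms}" for i
  proof -
    have "ms ! (i - 1) \<in> carrier M" "ms ! i \<in> carrier M"
      using ms that by (auto intro!: subsetD[OF ms(2)] nth_mem)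
    moreover have "set (take (i - 1) ms) \<subseteq> carrier M" "set (drop (i + 1) ms) \<subseteq> carrier M"
      using set_take_subset[of "i - 1" ms] set_drop_subset[of "i + 1" ms] ms(2) by (blast intro: order_trans)+
    ultimately show ?thesis
      using ms that by (auto simp: tuples_def)
  qed
  ultimately show ?thesis
    unfolding gp_boundary_tuple_def
    by (intro add sum_closed_free_Abelian_group frag_cmul_in_free) (simp_all only: frag_of_in_free_Abelian_group)
qed

text \<open>
  The boundary of the class of \<open>c\<close> is the set of all \<open>d + \<partial> c'\<close> with \<open>d\<close> in the degenerate subgroup and
  \<open>c'\<close> in the class of \<open>c\<close>.  The induced map takes the common value of \<open>H\<close> on this set, which the last
  assumption provides.
\<close>
lemma mcb_cocycle_of_hom:
  assumes gens: "mcb_D X n \<lhd> mcb_P X n" "mcb_D X (n + 1) \<subseteq> carrier (mcb_P X (n + 1))" and B: "group B" and H: "H \<in> hom (mcb_P X n) B"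
    and one: "\<And>d. d \<in> mcb_D X n \<Longrightarrow> H d = \<one>\<^bsub>B\<^esub>"
    and bd: "\<And>d c. d \<in> mcb_D X n \<Longrightarrow> c \<in> carrier (mcb_P X (n + 1)) \<Longrightarrow> H (d + mcb_boundary X c) = \<one>\<^bsub>B\<^esub>"
  shows "\<exists>\<Phi>. mcb_cocycle X n B \<Phi> \<and> (\<forall>c\<in>carrier (mcb_P X n). \<Phi> (mcb_D X n #>\<^bsub>mcb_P X n\<^esub> c) = H c)"
proof -
  let ?\<Phi> = "\<lambda>C. the_elem (H ` C)"
  have coset: "?\<Phi> (mcb_D X n #>\<^bsub>mcb_P X n\<^esub> c) = H c" if "c \<in> carrier (mcb_P X n)" for c
    by (rule the_elem_image_coset[OF gens(1) B H one that])
  have bdy: "?\<Phi> (mcb_C_boundary X (n + 1) C) = \<one>\<^bsub>B\<^esub>" if "C \<in> carrier (mcb_C X (n + 1))" for C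
  proof -
    interpret D: normal "mcb_D X n" "mcb_P X n" by fact
    obtain c where c: "c \<in> carrier (mcb_P X (n + 1))" "C = mcb_D X (n + 1) #>\<^bsub>mcb_P X (n + 1)\<^esub> c"
      using \<open>C \<in> carrier (mcb_C X (n + 1))\<close> by (auto simp: mcb_C_def carrier_FactGroup)
    have "group (mcb_P X (n + 1))"
      by (simp add: mcb_P_def)
    then have C: "C \<subseteq> carrier (mcb_P X (n + 1))"
      using c gens(2) by (simp add: group.is_monoid monoid.r_coset_subset_G)
    have "c \<in> C"
      using c(1) generate.one[of "mcb_P X (n + 1)"]
      unfolding c(2) mcb_D_def r_coset_def by (auto simp: mcb_P_def intro!: bexI[of _ 0])
    then have "0 + mcb_boundary X c \<in> mcb_C_boundary X (n + 1) C"
      using subgroup.one_closed[OF D.subgroup_axioms]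
      unfolding mcb_C_boundary_def induced_map_def set_mult_def mcb_P_def mult_free_Abelian_group one_free_Abelian_group
      by (intro UN_I[of 0] UN_I[of "mcb_boundary X c"] imageI) auto
    moreover have "H x = \<one>\<^bsub>B\<^esub>" if "x \<in> mcb_C_boundary X (n + 1) C" for x
    proof -
      have "x \<in> (\<Union>d\<in>mcb_D X n. \<Union>y\<in>mcb_boundary X ` C. {d + y})"
        using that unfolding mcb_C_boundary_def induced_map_def set_mult_def mcb_P_def mult_free_Abelian_group by simp
      then obtain d c' where "d \<in> mcb_D X n" "c' \<in> C" and x: "x = d + mcb_boundary X c'"
        by blast
      then have "H (d + mcb_boundary X c') = \<one>\<^bsub>B\<^esub>"
        by (intro bd subsetD[OF C])
      then show ?thesis
        unfolding x .
    qed
    ultimately have "H ` mcb_C_boundary X (n + 1) C = (\<lambda>x. \<one>\<^bsub>B\<^esub>) ` mcb_C_boundary X (n + 1) C" "mcb_C_boundary X (n + 1) C \<noteq> {}"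
      by (auto intro: image_cong)
    then show ?thesis
      by (simp add: image_constant_conv)
  qed
  have hom: "?\<Phi> \<in> hom (mcb_C X n) B"
    unfolding mcb_C_def by (rule the_elem_image_hom[OF gens(1) B H one])
  have "mcb_cocycle X n B ?\<Phi>"
    unfolding mcb_cocycle_def by (intro conjI ballI hom bdy)
  then show ?thesis
    by (intro exI[of _ ?\<Phi>] conjI ballI coset)
qed

text \<open>
  An injective map sends the indices \<open>l\<close> with \<open>\<mu> l > j\<close> into the remaining \<open>s + t - j\<close> places.  This keeps
  both indices \<open>\<lfloor>j;\<mu>\<rfloor>\<close> and \<open>j - \<lfloor>j;\<mu>\<rfloor>\<close> of a shuffle within the lengths of the two words.
\<close>
lemma card_above_increasing_map:
  assumes "\<mu> \<in> increasing_maps s (s + t)" "j \<le> s + t"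
  shows "card {l \<in> {1..s}. \<mu> l \<le> j} \<le> s" "j - card {l \<in> {1..s}. \<mu> l \<le> j} \<le> t"
proof -
  have mu: "\<mu> ` {1..s} \<subseteq> {1..s + t}" "inj_on \<mu> {1..s}"
    using assms strict_mono_on_imp_inj_on by (auto simp: increasing_maps_def)
  let ?A = "{l \<in> {1..s}. \<mu> l \<le> j}" and ?B = "{l \<in> {1..s}. j < \<mu> l}"
  have "card ?A + card ?B = card (?A \<union> ?B)"
    by (rule card_Un_disjoint[symmetric]) auto
  also have "?A \<union> ?B = {1..s}"
    by auto
  finally have sum: "card ?A + card ?B = s"
    by simp
  then show "card ?A \<le> s"
    by simp
  have "card ?B \<le> card {j<..s + t}"
  proof (rule card_inj_on_le)
    show "inj_on \<mu> ?B"
      by (rule inj_on_subset[OF mu(2)]) auto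
    show "\<mu> ` ?B \<subseteq> {j<..s + t}"
      using mu(1) by (auto simp: image_subset_iff)
  qed simp
  then show "j - card ?A \<le> t"
    using sum assms(2) unfolding card_greaterThanAtMost by linarith
qed

context twisted_mcb
begin

lemma shuffle_word_closed:
  assumes "set as \<subseteq> {m} \<times> carrier G" "set bs \<subseteq> {m} \<times> carrier G"
    and "\<mu> \<in> increasing_maps (length as) (length as + length bs)"
  shows "set (shuffle_word (alexander_component G m) as bs \<mu>) \<subseteq> {m} \<times> carrier G"
proof -
  have nth: "((m, \<one>) # cs) ! p \<in> {m} \<times> carrier G" if "set cs \<subseteq> {m} \<times> carrier G" "p \<le> length cs" for cs p
    using that by (cases p) (auto dest: nth_mem)
  interpret C: group "alexander_component G m"
    by (rule group_component)
  show ?thesis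
  proof
    fix x assume "x \<in> set (shuffle_word (alexander_component G m) as bs \<mu>)"
    then have "x \<in> (\<lambda>j. ((m, \<one>) # as) ! card {l \<in> {1..length as}. \<mu> l \<le> j} \<otimes>\<^bsub>alexander_component G m\<^esub>
        ((m, \<one>) # bs) ! (j - card {l \<in> {1..length as}. \<mu> l \<le> j})) ` {1..<Suc (length as + length bs)}"
      by (simp only: shuffle_word_def Let_def set_map set_upt component_simps)
    then obtain j where "j \<in> {1..<Suc (length as + length bs)}" and x: "x = ((m, \<one>) # as) ! card {l \<in> {1..length as}. \<mu> l \<le> j}
        \<otimes>\<^bsub>alexander_component G m\<^esub> ((m, \<one>) # bs) ! (j - card {l \<in> {1..length as}. \<mu> l \<le> j})"
      by (rule imageE)
    then have j: "j \<le> length as + length bs"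
      by simp
    have "x \<in> carrier (alexander_component G m)"
      unfolding x using nth[OF assms(1)] nth[OF assms(2)] card_above_increasing_map[OF assms(3) j]
      by (intro C.m_closed) auto
    then show "x \<in> {m} \<times> carrier G"
      by simp
  qed
qed

definition mcb_D_gens :: "nat \<Rightarrow> (('m \<times> 'g) symb \<Rightarrow>\<^sub>0 int) set" where
  "mcb_D_gens n = {frag_of (x\<^sub>0, uss @ [as, bs] @ vss) -
      (\<Sum>\<mu> \<in> increasing_maps (length as) (length as + length bs).
         frag_cmul (shuffle_sign (length as) \<mu>)
           (frag_of (x\<^sub>0, uss @ [shuffle_word (component X (hd as)) as bs \<mu>] @ vss)))
      | x\<^sub>0 uss as bs vss.
        (x\<^sub>0, uss @ [as, bs] @ vss) \<in> mcb_symbols X n \<and> in_one_component X (set as \<union> set bs)}"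

lemma mcb_D_eq: "mcb_D X n = generate (mcb_P X n) (mcb_D_gens n)"
  by (simp add: mcb_D_def mcb_D_gens_def)

lemma mcb_D_gens_subset: "mcb_D_gens n \<subseteq> carrier (mcb_P X n)"
proof
  fix c assume "c \<in> mcb_D_gens n"
  then obtain x\<^sub>0 uss as bs vss where c: "c = frag_of (x\<^sub>0, uss @ [as, bs] @ vss) -
      (\<Sum>\<mu> \<in> increasing_maps (length as) (length as + length bs).
         frag_cmul (shuffle_sign (length as) \<mu>)
           (frag_of (x\<^sub>0, uss @ [shuffle_word (component X (hd as)) as bs \<mu>] @ vss)))"
    and s: "(x\<^sub>0, uss @ [as, bs] @ vss) \<in> mcb_symbols X n" and o: "in_one_component X (set as \<union> set bs)"
    unfolding mcb_D_gens_def by blast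
  obtain m where m: "m \<in> carrier M" "set as \<subseteq> {m} \<times> carrier G" "set bs \<subseteq> {m} \<times> carrier G"
    using o by (auto simp: in_one_component_iff)
  have "as \<noteq> []"
    using s by (auto simp: mcb_symbols_def)
  then have comp: "component X (hd as) = alexander_component G m"
    using m(2) by (cases as) (auto simp: component_X)
  have "frag_of (x\<^sub>0, uss @ [shuffle_word (component X (hd as)) as bs \<mu>] @ vss) \<in> carrier (free_Abelian_group (mcb_symbols X n))"
    if mu: "\<mu> \<in> increasing_maps (length as) (length as + length bs)" for \<mu>
  proof -
    have l: "length (shuffle_word (component X (hd as)) as bs \<mu>) = length as + length bs"
      by (simp add: shuffle_word_def del: upt_Suc)
    then have "shuffle_word (component X (hd as)) as bs \<mu> \<noteq> []"
      using \<open>as \<noteq> []\<close> by auto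
    moreover have "in_one_component X (set (shuffle_word (component X (hd as)) as bs \<mu>))"
      using shuffle_word_closed[OF m(2,3) mu] m(1) by (auto simp: comp in_one_component_iff)
    ultimately show ?thesis
      using s l by (auto simp: mcb_symbols_def)
  qed
  then have "(\<Sum>\<mu> \<in> increasing_maps (length as) (length as + length bs).
         frag_cmul (shuffle_sign (length as) \<mu>)
           (frag_of (x\<^sub>0, uss @ [shuffle_word (component X (hd as)) as bs \<mu>] @ vss))) \<in> carrier (free_Abelian_group (mcb_symbols X n))"
    by (intro sum_closed_free_Abelian_group frag_cmul_in_free)
  then show "c \<in> carrier (mcb_P X n)"
    unfolding c mcb_P_def carrier_free_Abelian_group_iff using s
    by (intro order_trans[OF keys_diff] Un_least) auto
qed

lemma mcb_D_normal: "mcb_D X n \<lhd> mcb_P X n"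
  using mcb_D_gens_subset unfolding mcb_D_eq mcb_P_def by (rule normal_generate_free_Abelian_group)

lemma mcb_D_subset: "mcb_D X n \<subseteq> carrier (mcb_P X n)"
  using normal_imp_subgroup[OF mcb_D_normal] subgroup.subset by blast

text \<open>
  A shuffle replaces two blocks by one.  Since a symbol of degree \<open>n\<close> has at most \<open>n\<close> blocks, the
  shuffle has fewer than \<open>n\<close> and the projection kills it.
\<close>
lemma symb_val_gens_closed:
  assumes deg: "\<And>ms g i. \<lbrakk>ms \<in> tuples M (Suc n); g \<in> carrier G; i < n; ms ! i = \<zero>\<^bsub>M\<^esub>\<rbrakk> \<Longrightarrow> W g ms \<in> N"
    and zero: "0 \<in> N" and diff: "\<And>x y. x \<in> N \<Longrightarrow> y \<in> N \<Longrightarrow> x - y \<in> N"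
    and "c \<in> mcb_D_gens n"
  shows "frag_extend (symb_val n W) c \<in> N"
proof -
  obtain x\<^sub>0 uss as bs vss where c: "c = frag_of (x\<^sub>0, uss @ [as, bs] @ vss) -
      (\<Sum>\<mu> \<in> increasing_maps (length as) (length as + length bs).
         frag_cmul (shuffle_sign (length as) \<mu>)
           (frag_of (x\<^sub>0, uss @ [shuffle_word (component X (hd as)) as bs \<mu>] @ vss)))"
    and s: "(x\<^sub>0, uss @ [as, bs] @ vss) \<in> mcb_symbols X n" and o: "in_one_component X (set as \<union> set bs)"
    using assms(4) unfolding mcb_D_gens_def by blast
  have "length (uss @ [as, bs] @ vss) \<le> n"
    using s length_le_sum_list_length[of "uss @ [as, bs] @ vss"] by (auto simp: mcb_symbols_def)
  then have 0: "symb_val n W (x\<^sub>0, uss @ [w] @ vss) = 0" for w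
    by (simp add: symb_val_def)
  have "finite (increasing_maps (length as) (length as + length bs))"
    unfolding increasing_maps_def by (rule finite_subset[OF Collect_restrict finite_PiE]) auto
  then have "frag_extend (symb_val n W) c = symb_val n W (x\<^sub>0, uss @ [as, bs] @ vss)"
    unfolding c frag_extend_diff using 0
    by (simp add: frag_extend_sum frag_extend_cmul comp_def)
  then show ?thesis
    using symb_val_degenerate_closed[OF deg zero diff s o] by simp
qed

text \<open>
  A homomorphism \<open>h\<close> on labelled tuples that is invariant under \<open>G\<close>, normalized and closed for each
  fixed label pulls back to a cocycle of the biquandle.  All conditions are checked as membership in
  the kernel of \<open>h\<close>, an additive subgroup of the free abelian group, so that the target \<open>B\<close> enters only
  through its group structure.
\<close>
theorem cocycle_of_labelled_group_cocycle:
  assumes B: "group B" and h: "h \<in> hom (free_Abelian_group (tuples M (Suc n) \<times> L)) B"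
    and lam: "\<And>g. g \<in> carrier G \<Longrightarrow> lam g \<in> L"
    and conj: "\<And>g x. \<lbrakk>g \<in> carrier G; x \<in> carrier G\<rbrakk> \<Longrightarrow> lam (inv x \<otimes> g \<otimes> x) = lam g"
    and inv: "\<And>ms g b. \<lbrakk>ms \<in> tuples M (Suc n); g \<in> carrier G; b \<in> L\<rbrakk> \<Longrightarrow>
        h (frag_of (map (\<lambda>x. x \<triangleleft> g) ms, b) - frag_of (ms, b)) = \<one>\<^bsub>B\<^esub>"
    and deg: "\<And>ms i b. \<lbrakk>ms \<in> tuples M (Suc n); i < n; ms ! i = \<zero>\<^bsub>M\<^esub>; b \<in> L\<rbrakk> \<Longrightarrow> h (frag_of (ms, b)) = \<one>\<^bsub>B\<^esub>"
    and bd: "\<And>ms b. \<lbrakk>ms \<in> tuples M (Suc (Suc n)); b \<in> L\<rbrakk> \<Longrightarrow>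
        h (frag_extend (\<lambda>ms. frag_of (ms, b)) (gp_boundary_tuple M ms)) = \<one>\<^bsub>B\<^esub>"
  defines "W \<equiv> \<lambda>g ms. frag_of (ms, lam g)"
  shows "\<exists>\<Phi>. mcb_cocycle X n B \<Phi> \<and>
    (\<forall>c\<in>carrier (mcb_P X n). \<Phi> (mcb_D X n #>\<^bsub>mcb_P X n\<^esub> c) = h (frag_extend (symb_val n W) c))"
proof -
  let ?S = "tuples M (Suc n) \<times> L"
  let ?F = "frag_extend (symb_val n W)"
  define N where "N = {c. Poly_Mapping.keys c \<subseteq> ?S \<and> h c = \<one>\<^bsub>B\<^esub>}"
  note N = hom_free_Abelian_kernel[OF B h, folded N_def]
  have "Poly_Mapping.keys (symb_val n W s) \<subseteq> ?S" if "s \<in> mcb_symbols X n" for s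
  proof -
    have "symb_val n W s \<in> carrier (free_Abelian_group ?S)"
    proof (rule symb_val_in_free[OF _ _ _ that])
      fix x y assume "x \<in> carrier (free_Abelian_group ?S)" "y \<in> carrier (free_Abelian_group ?S)"
      then show "x - y \<in> carrier (free_Abelian_group ?S)"
        using keys_diff[of x y] by auto
    qed (auto simp: W_def lam)
    then show ?thesis
      by simp
  qed
  then have F: "?F \<in> hom (mcb_P X n) (free_Abelian_group ?S)"
    unfolding mcb_P_def by (rule frag_extend_hom)
  have gens: "?F c \<in> N" if "c \<in> mcb_D_gens n" for c
    by (rule symb_val_gens_closed[OF _ N that]) (auto simp: N_def W_def lam deg)
  have P: "group (mcb_P X n)" "mcb_P X n = free_Abelian_group (mcb_symbols X n)" for n
    by (simp_all add: mcb_P_def)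
  have hF: "h \<circ> ?F \<in> hom (mcb_P X n) B"
    by (rule hom_compose[OF F h])
  have one: "(h \<circ> ?F) d = \<one>\<^bsub>B\<^esub>" if "d \<in> mcb_D X n" for d
    using that hom_generate_one[OF P(1) B hF mcb_D_gens_subset, of d] gens unfolding mcb_D_eq by (simp add: N_def)
  have "?F (mcb_boundary X c) \<in> N" if "c \<in> carrier (mcb_P X (Suc n))" for c
  proof -
    have "Poly_Mapping.keys c \<subseteq> mcb_symbols X (Suc n)"
      using that by (simp add: mcb_P_def)
    then show ?thesis
    proof (induction c rule: frag_induction)
      case zero
      then show ?case using N(1) by (simp add: mcb_boundary_def)
    next
      case (one s)
      obtain x\<^sub>0 xss where s: "s = (x\<^sub>0, xss)" by (cases s)
      show ?case
        unfolding s
      proof (rule symb_val_boundary_closed[OF N])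
        show "(x\<^sub>0, xss) \<in> mcb_symbols X (Suc n)"
          using one s by simp
        show "W (inv h \<otimes> g \<otimes> h) = W g" if "g \<in> carrier G" "h \<in> carrier G" for g h
          using that by (simp add: W_def conj)
        show "W h (map (\<lambda>x. x \<triangleleft> g) ms) - W h ms \<in> N"
          if "ms \<in> tuples M (Suc n)" "g \<in> carrier G" "h \<in> carrier G" for ms g h
        proof -
          have "map (\<lambda>x. x \<triangleleft> g) ms \<in> tuples M (Suc n)"
            using that by (auto simp: tuples_def)
          then show ?thesis
            using that keys_diff[of "W h (map (\<lambda>x. x \<triangleleft> g) ms)" "W h ms"]
            by (auto simp: N_def W_def inv lam)
        qed
        show "frag_extend (W h) (gp_boundary_tuple M ms) \<in> N"
          if "ms \<in> tuples M (Suc (Suc n))" "h \<in> carrier G" for ms h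
        proof -
          have "Poly_Mapping.keys (frag_extend (W h) (gp_boundary_tuple M ms)) \<subseteq> ?S"
            using keys_frag_extend[of "W h" "gp_boundary_tuple M ms"] that lam
              gp_boundary_tuple_in_free[OF M.abelian_group_axioms that(1) zero_less_Suc]
            by (fastforce simp: W_def)
          then show ?thesis
            using that bd lam by (simp add: N_def W_def)
        qed
      qed
    next
      case (diff a b)
      then show ?case
        using N(2) by (simp add: mcb_boundary_def frag_extend_diff)
    qed
  qed
  then have "(h \<circ> ?F) (d + mcb_boundary X c) = \<one>\<^bsub>B\<^esub>" if "d \<in> mcb_D X n" "c \<in> carrier (mcb_P X (n + 1))" for c d
  proof -
    interpret B: group B by fact
    have "?F d \<in> carrier (free_Abelian_group ?S)"
      using that(1) mcb_D_subset hom_in_carrier[OF F] by blast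
    moreover have "?F (mcb_boundary X c) \<in> N"
      using \<open>\<And>c. c \<in> carrier (mcb_P X (Suc n)) \<Longrightarrow> ?F (mcb_boundary X c) \<in> N\<close> that(2) by simp
    ultimately show ?thesis
      using hom_mult[OF h, of "?F d" "?F (mcb_boundary X c)"] one[OF that(1)]
      by (simp add: N_def frag_extend_add)
  qed
  then show ?thesis
    using mcb_cocycle_of_hom[OF mcb_D_normal mcb_D_subset B hF one] by simp
qed

text \<open>
  To compare two homomorphisms of the form \<open>\<Psi> \<circ> \<gamma>\<^sub>n \<circ> proj\<^sub>n\<close> and \<open>\<Theta> \<circ> symb_val\<close> modulo a subgroup \<open>N\<close>, it
  is enough to do so on tuples of points.  For the first cocycle \<open>N\<close> is trivial; for the second it
  consists of the relations of the tensor product.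
\<close>
lemma comparison_closed:
  assumes zero: "0 \<in> N" and diff: "\<And>x y. x \<in> N \<Longrightarrow> y \<in> N \<Longrightarrow> x - y \<in> N"
    and H: "\<And>x\<^sub>0 xs. \<lbrakk>x\<^sub>0 \<in> points; set xs \<subseteq> points; length xs = n\<rbrakk> \<Longrightarrow>
      \<Psi> (map snd (x\<^sub>0 # xs), map (\<lambda>i. fst ((x\<^sub>0 # xs) ! i) \<ominus>\<^bsub>M\<^esub> fst ((x\<^sub>0 # xs) ! (i + 1))) [0..<n] @ [fst ((x\<^sub>0 # xs) ! n)])
      - frag_extend \<Theta> (cube_sum (W (snd x\<^sub>0)) (fst x\<^sub>0) xs) \<in> N"
    and c: "c \<in> carrier (mcb_P X n)"
  shows "frag_extend \<Psi> (gamma_map M n (proj_map n c)) - frag_extend \<Theta> (frag_extend (symb_val n W) c) \<in> N"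
proof (cases "2 \<le> n")
  case False
  have "frag_extend (symb_val n W) c = 0"
    using False by (intro frag_extend_eq_0) (auto simp: symb_val_def)
  then show ?thesis
    using False zero by (simp add: proj_map_def gamma_map_def)
next
  case True
  have n: "\<not> n \<le> 1"
    using True by simp
  show ?thesis
    using c unfolding mcb_P_def carrier_free_Abelian_group_iff
  proof (induction c rule: frag_induction)
    case zero
    then show ?case using assms(1) n by (simp add: proj_map_def gamma_map_def)
  next
    case (one s)
    obtain x\<^sub>0 xss where s: "s = (x\<^sub>0, xss)" by (cases s)
    have x: "x\<^sub>0 \<in> points" "set (map hd xss) \<subseteq> points"
      using one hd_blocks by (auto simp: s mcb_symbols_def carrier_X)
    show ?case
      using H[OF x] zero n True by (simp add: s proj_map_def gamma_map_def symb_val_def Let_def del: list.map set_map)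
  next
    case (diff a b)
    then show ?case
      using assms(2)[OF diff] n by (simp add: proj_map_def gamma_map_def frag_extend_diff algebra_simps)
  qed
qed

end

section \<open>Tensor products\<close>

lemma tensor_rel_normal:
  assumes "group A" "group B"
  shows "tensor_rel A B \<lhd> free_Abelian_group (carrier A \<times> carrier B)"
proof -
  interpret A: group A by fact
  interpret B: group B by fact
  show ?thesis
    unfolding tensor_rel_def
    by (rule normal_generate_free_Abelian_group) (auto dest!: subsetD[OF keys_diff])
qed

lemma tensor_rel_left:
  "\<lbrakk>a \<in> carrier A; a' \<in> carrier A; b \<in> carrier B\<rbrakk> \<Longrightarrow>
    frag_of (a \<otimes>\<^bsub>A\<^esub> a', b) - frag_of (a, b) - frag_of (a', b) \<in> tensor_rel A B"
  unfolding tensor_rel_def by (rule generate.incl) blast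

lemma tensor_rel_right:
  "\<lbrakk>a \<in> carrier A; b \<in> carrier B; b' \<in> carrier B\<rbrakk> \<Longrightarrow>
    frag_of (a, b \<otimes>\<^bsub>B\<^esub> b') - frag_of (a, b) - frag_of (a, b') \<in> tensor_rel A B"
  unfolding tensor_rel_def by (rule generate.incl) blast

lemma tensor_rel_one:
  assumes "group A" "group B" "b \<in> carrier B"
  shows "frag_of (\<one>\<^bsub>A\<^esub>, b) \<in> tensor_rel A B"
proof -
  interpret A: group A by fact
  show ?thesis
    using tensor_rel_left[of "\<one>\<^bsub>A\<^esub>" A "\<one>\<^bsub>A\<^esub>" b B] normal_free_closed(3)[OF tensor_rel_normal[OF assms(1,2)]] assms(3)
    by fastforce
qed

text \<open>
  Linearity of the left tensor factor: \<open>h(c) \<otimes> b\<close> can be expanded along the basis of the free group.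
\<close>
lemma tensor_rel_expand:
  assumes A: "group A" and B: "group B" and h: "h \<in> hom (free_Abelian_group S) A" and b: "b \<in> carrier B"
    and c: "Poly_Mapping.keys c \<subseteq> S"
  shows "frag_of (h c, b) - frag_extend (\<lambda>s. frag_of (h (frag_of s), b)) c \<in> tensor_rel A B"
proof (rule free_Abelian_group_induct[OF c])
  interpret h: group_hom "free_Abelian_group S" A h
    using A h by (simp add: group_hom_def group_hom_axioms_def)
  note R = normal_free_closed[OF tensor_rel_normal[OF A B]]
  let ?E = "frag_extend (\<lambda>s. frag_of (h (frag_of s), b))"
  show "frag_of (h 0, b) - ?E 0 \<in> tensor_rel A B"
    using h.hom_one tensor_rel_one[OF A B b] by simp
  show "frag_of (h (frag_of s), b) - ?E (frag_of s) \<in> tensor_rel A B" for s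
    using R(1) by simp
  fix x y
  assume keys: "Poly_Mapping.keys x \<subseteq> S" "Poly_Mapping.keys y \<subseteq> S"
    and IH: "frag_of (h x, b) - ?E x \<in> tensor_rel A B" "frag_of (h y, b) - ?E y \<in> tensor_rel A B"
  have "Poly_Mapping.keys (x - y) \<subseteq> S"
    using keys by (intro order_trans[OF keys_diff] Un_least)
  then have xy: "h (x - y) \<in> carrier A" "h y \<in> carrier A" "h x = h (x - y) \<otimes>\<^bsub>A\<^esub> h y"
    using h.hom_closed[of "x - y"] h.hom_closed[of y] h.hom_mult[of "x - y" y] keys by simp_all
  have "(frag_of (h x, b) - ?E x) - (frag_of (h y, b) - ?E y) -
      (frag_of (h x, b) - frag_of (h (x - y), b) - frag_of (h y, b)) \<in> tensor_rel A B"
    by (rule R(4)[OF R(4)[OF IH] tensor_rel_left[OF xy(1,2) b, folded xy(3)]])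
  then show "frag_of (h (x - y), b) - ?E (x - y) \<in> tensor_rel A B"
    by (simp add: frag_extend_diff algebra_simps)
qed

lemma tensor_map_coset:
  assumes "group C" "group D" "group A" "group B" "f \<in> hom C A" "g \<in> hom D B"
  shows "tensor_map A B f g (tensor_rel C D #>\<^bsub>free_Abelian_group (carrier C \<times> carrier D)\<^esub> c) =
    tensor_rel A B #>\<^bsub>free_Abelian_group (carrier A \<times> carrier B)\<^esub> frag_extend (\<lambda>(a, b). frag_of (f a, g b)) c"
  unfolding tensor_map_def
proof (rule induced_map_coset)
  show "tensor_rel A B \<lhd> free_Abelian_group (carrier A \<times> carrier B)" "tensor_rel C D \<lhd> free_Abelian_group (carrier C \<times> carrier D)"
    using assms by (simp_all add: tensor_rel_normal)
  fix d assume d: "d \<in> tensor_rel C D"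
  interpret C: group C by fact
  interpret D: group D by fact
  show "frag_extend (\<lambda>(a, b). frag_of (f a, g b)) d \<in> tensor_rel A B"
  proof (rule frag_extend_generate[OF tensor_rel_normal[OF assms(3,4)] _ _ d[unfolded tensor_rel_def]], goal_cases)
    case 1
    then show ?case
      by (auto dest!: subsetD[OF keys_diff])
  next
    case (2 x)
    then show ?case
      using hom_mult[OF assms(5)] hom_mult[OF assms(6)] hom_in_carrier[OF assms(5)] hom_in_carrier[OF assms(6)]
      by (auto simp: frag_extend_diff intro!: tensor_rel_left tensor_rel_right)
  qed
qed (simp add: frag_extend_add)

section \<open>Normalized group cocycles\<close>

locale group_chains = twisted_module G M "\<lambda>m g. act m (frag_of g)" \<phi>
  for G :: "('g, 'r) monoid_scheme" (structure) and M :: "('m, 's) ring_scheme"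
    and act :: "'m \<Rightarrow> ('g \<Rightarrow>\<^sub>0 int) \<Rightarrow> 'm" and \<phi> :: "'g \<Rightarrow> 'g"
begin

lemma map_act_tuples: "\<lbrakk>ms \<in> tuples M n; g \<in> carrier G\<rbrakk> \<Longrightarrow> map (\<lambda>m. act m (frag_of g)) ms \<in> tuples M n"
  by (auto simp: tuples_def)

lemma gp_rel_gens:
  "{frag_of (map (\<lambda>m. act m (frag_of g)) ms) - frag_of ms | ms g. ms \<in> tuples M n \<and> g \<in> carrier G}
    \<subseteq> carrier (free_Abelian_group (tuples M n))"
  using map_act_tuples by (auto dest!: subsetD[OF keys_diff])

lemma gp_rel_normal: "gp_rel G M act n \<lhd> free_Abelian_group (tuples M n)"
  unfolding gp_rel_def by (rule normal_generate_free_Abelian_group[OF gp_rel_gens])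

lemma gp_rel_incl:
  "\<lbrakk>ms \<in> tuples M n; g \<in> carrier G\<rbrakk> \<Longrightarrow> frag_of (map (\<lambda>m. act m (frag_of g)) ms) - frag_of ms \<in> gp_rel G M act n"
  unfolding gp_rel_def by (rule generate.incl) blast

lemma gp_class_hom: "gp_class G M act n \<in> hom (free_Abelian_group (tuples M n)) (gp_C G M act n)"
  unfolding gp_class_def[abs_def] gp_C_def by (rule coset_hom_free[OF gp_rel_normal])

lemma group_gp_C: "group (gp_C G M act n)"
  unfolding gp_C_def by (rule normal.factorgroup_is_group[OF gp_rel_normal])

text \<open>
  The relations that identify a basis tuple with its translates identify every chain with its
  translates.
\<close>
lemma gp_rel_act:
  assumes "Poly_Mapping.keys c \<subseteq> tuples M n" "g \<in> carrier G"
  shows "frag_extend (\<lambda>ms. frag_of (map (\<lambda>m. act m (frag_of g)) ms)) c - c \<in> gp_rel G M act n"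
  using assms(1)
proof (induction c rule: frag_induction)
  note R = normal_free_closed[OF gp_rel_normal]
  {
    case zero
    then show ?case using R(1) by simp
  next
    case (one ms)
    then show ?case using gp_rel_incl assms(2) by simp
  next
    case (diff a b)
    then show ?case using R(4)[OF diff]
      by (simp add: frag_extend_diff algebra_simps)
  }
qed

lemma gp_boundary_tuple_act:
  assumes "ms \<in> tuples M (Suc n)" "g \<in> carrier G"
  shows "gp_boundary_tuple M (map (\<lambda>m. act m (frag_of g)) ms) =
    frag_extend (\<lambda>ms. frag_of (map (\<lambda>m. act m (frag_of g)) ms)) (gp_boundary_tuple M ms)"
proof -
  let ?g = "map (\<lambda>m. act m (frag_of g))"
  have bd: "gp_boundary_tuple M ts = frag_of (tl ts) + (\<Sum>i = 1..<length ts. frag_cmul ((-1) ^ i) (frag_of (merge i ts))) +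
      frag_cmul ((-1) ^ length ts) (frag_of (butlast ts))" for ts
    by (simp add: gp_boundary_tuple_def merge_def)
  have "(\<Sum>i = 1..<length ms. frag_cmul ((-1) ^ i) (frag_of (merge i (?g ms)))) =
      (\<Sum>i = 1..<length ms. frag_cmul ((-1) ^ i) (frag_of (?g (merge i ms))))"
    using assms by (intro sum.cong refl arg_cong2[where f = frag_cmul] arg_cong[where f = frag_of] map_merge[symmetric])
      (auto simp: tuples_def)
  then show ?thesis
    unfolding bd frag_extend_add frag_extend_cmul frag_extend_of
    by (simp add: frag_extend_sum frag_extend_cmul comp_def map_tl map_butlast)
qed

text \<open>
  The boundary commutes with the action of \<open>G\<close>, so it respects the relations of the coinvariants and can
  be computed on representatives.
\<close>
lemma gp_boundary_class:
  assumes "0 < n"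
  shows "gp_boundary G M act (Suc n) (gp_class G M act (Suc n) c) = gp_class G M act n (frag_extend (gp_boundary_tuple M) c)"
proof -
  have *: "frag_extend (gp_boundary_tuple M) d \<in> gp_rel G M act n" if "d \<in> gp_rel G M act (Suc n)" for d
  proof (rule frag_extend_generate[OF gp_rel_normal gp_rel_gens _ that[unfolded gp_rel_def]])
    fix x assume "x \<in> {frag_of (map (\<lambda>m. act m (frag_of g)) ms) - frag_of ms | ms g. ms \<in> tuples M (Suc n) \<and> g \<in> carrier G}"
    then obtain ms g where "x = frag_of (map (\<lambda>m. act m (frag_of g)) ms) - frag_of ms" "ms \<in> tuples M (Suc n)" "g \<in> carrier G"
      by blast
    then show "frag_extend (gp_boundary_tuple M) x \<in> gp_rel G M act n"
      using gp_rel_act[of "gp_boundary_tuple M ms" n g] gp_boundary_tuple_in_free[OF M.abelian_group_axioms _ assms]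
      by (simp add: frag_extend_diff gp_boundary_tuple_act)
  qed
  show ?thesis
    unfolding gp_boundary_def gp_class_def diff_Suc_1
    by (rule induced_map_coset[OF gp_rel_normal frag_extend_add gp_rel_normal *])
qed

text \<open>
  A normalized cocycle regarded as a function on chains before passing to coinvariants.
\<close>
lemma normalized_cocycle_values:
  assumes A: "group A" and f: "normalized_gp_cocycle G M act (Suc n) A f"
    and F_def: "F = (\<lambda>c. f (gp_class G M act (Suc n) c))"
  shows "F \<in> hom (free_Abelian_group (tuples M (Suc n))) A"
    and "\<And>ms g. \<lbrakk>ms \<in> tuples M (Suc n); g \<in> carrier G\<rbrakk> \<Longrightarrow> F (frag_of (map (\<lambda>m. act m (frag_of g)) ms)) = F (frag_of ms)"
    and "\<And>ms i. \<lbrakk>ms \<in> tuples M (Suc n); i < n; ms ! i = \<zero>\<^bsub>M\<^esub>\<rbrakk> \<Longrightarrow> F (frag_of ms) = \<one>\<^bsub>A\<^esub>"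
    and "\<And>ms. ms \<in> tuples M (Suc (Suc n)) \<Longrightarrow> F (gp_boundary_tuple M ms) = \<one>\<^bsub>A\<^esub>"
proof -
  have f: "f \<in> hom (gp_C G M act (Suc n)) A" "\<And>c. c \<in> gp_D G M act (Suc n) \<Longrightarrow> f c = \<one>\<^bsub>A\<^esub>"
    "\<And>c. c \<in> carrier (gp_C G M act (Suc (Suc n))) \<Longrightarrow> f (gp_boundary G M act (Suc (Suc n)) c) = \<one>\<^bsub>A\<^esub>"
    using f by (simp_all add: normalized_gp_cocycle_def)
  show "F \<in> hom (free_Abelian_group (tuples M (Suc n))) A"
    using hom_compose[OF gp_class_hom f(1)] by (simp add: F_def comp_def)
  show "F (frag_of (map (\<lambda>m. act m (frag_of g)) ms)) = F (frag_of ms)" if "ms \<in> tuples M (Suc n)" "g \<in> carrier G" for ms g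
    unfolding F_def gp_class_def using coset_free_eqI[OF gp_rel_normal gp_rel_incl[OF that]] by simp
  show "F (frag_of ms) = \<one>\<^bsub>A\<^esub>" if "ms \<in> tuples M (Suc n)" "i < n" "ms ! i = \<zero>\<^bsub>M\<^esub>" for ms i
  proof -
    have "\<exists>j\<in>{1..Suc n - 1}. ms ! (j - 1) = \<zero>\<^bsub>M\<^esub>"
      using that by (intro bexI[of _ "Suc i"]) auto
    then show ?thesis
      using that(1) unfolding F_def gp_D_def by (intro f(2)[unfolded gp_D_def] generate.incl) blast
  qed
  show "F (gp_boundary_tuple M ms) = \<one>\<^bsub>A\<^esub>" if "ms \<in> tuples M (Suc (Suc n))" for ms
    using f(3)[of "gp_class G M act (Suc (Suc n)) (frag_of ms)"] gp_boundary_class[of "Suc n" "frag_of ms"]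
      hom_in_carrier[OF gp_class_hom, of "frag_of ms" "Suc (Suc n)"] that by (simp add: F_def)
qed

end

section \<open>The cocycles of the Alexander multiple conjugation biquandle\<close>

text \<open>
  The action of the group ring enters the biquandle only through group elements and through the
  elements \<open>\<phi>(h) - h\<close>, whose action is a difference by additivity in the ring argument.
\<close>
lemma twisted_mcb_alexander:
  assumes "group G" "right_module (group_ring G) M act" "\<phi> \<in> hom G (G\<lparr>carrier := group_center G\<rparr>)"
  shows "twisted_mcb G M (\<lambda>m g. act m (frag_of g)) \<phi> (alexander_mcb G M act \<phi>)"
proof -
  interpret G: group G by fact
  interpret RM: right_module "group_ring G" M act by fact
  have ring: "frag_of g \<in> carrier (group_ring G)" "c \<in> carrier (group_ring G) \<longleftrightarrow> Poly_Mapping.keys c \<subseteq> carrier G"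
    "frag_of g \<otimes>\<^bsub>group_ring G\<^esub> frag_of h = frag_of (g \<otimes>\<^bsub>G\<^esub> h)" "\<one>\<^bsub>group_ring G\<^esub> = frag_of \<one>\<^bsub>G\<^esub>"
    "c \<oplus>\<^bsub>group_ring G\<^esub> d = c + d"
    if "g \<in> carrier G" for g h c d
    using that by (simp_all add: group_ring_def)
  have center: "\<phi> g \<in> group_center G" if "g \<in> carrier G" for g
    using hom_in_carrier[OF assms(3) that] by simp
  have phi_closed: "\<phi> g \<in> carrier G" if "g \<in> carrier G" for g
    using center[OF that] by (simp add: group_center_def)
  have phi_central: "\<phi> g \<otimes>\<^bsub>G\<^esub> h = h \<otimes>\<^bsub>G\<^esub> \<phi> g" if "g \<in> carrier G" "h \<in> carrier G" for g h
    using center[OF that(1)] that(2) unfolding group_center_def by blast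
  have phi_mult: "\<phi> (g \<otimes>\<^bsub>G\<^esub> h) = \<phi> g \<otimes>\<^bsub>G\<^esub> \<phi> h" if "g \<in> carrier G" "h \<in> carrier G" for g h
    using hom_mult[OF assms(3) that] by simp
  interpret T: twisted_module G M "\<lambda>m g. act m (frag_of g)" \<phi>
  proof unfold_locales
    fix m n g h assume m: "m \<in> carrier M" and g: "g \<in> carrier G"
    show "act m (frag_of g) \<in> carrier M"
      using m g by (simp add: RM.act_closed ring)
    show "n \<in> carrier M \<Longrightarrow> act (m \<oplus>\<^bsub>M\<^esub> n) (frag_of g) = act m (frag_of g) \<oplus>\<^bsub>M\<^esub> act n (frag_of g)"
      using m g by (simp add: RM.act_add_left ring)
    show "h \<in> carrier G \<Longrightarrow> act (act m (frag_of g)) (frag_of h) = act m (frag_of (g \<otimes>\<^bsub>G\<^esub> h))"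
      using m g RM.act_mult[of m "frag_of g" "frag_of h"] by (simp add: ring)
  next
    fix m assume "m \<in> carrier M"
    then show "act m (frag_of \<one>\<^bsub>G\<^esub>) = m"
      using RM.act_one[of m] ring(4)[OF G.one_closed] by simp
  qed (rule phi_closed phi_mult phi_central; assumption)+
  have act_diff: "act n (frag_of (\<phi> h) - frag_of h) = act n (frag_of (\<phi> h)) \<ominus>\<^bsub>M\<^esub> act n (frag_of h)"
    if n: "n \<in> carrier M" and h: "h \<in> carrier G" for n h
  proof -
    have d: "frag_of (\<phi> h) - frag_of h \<in> carrier (group_ring G)"
      unfolding ring(2)[OF h] using phi_closed[OF h] h by (intro order_trans[OF keys_diff] Un_least) simp_all
    have "act n ((frag_of (\<phi> h) - frag_of h) \<oplus>\<^bsub>group_ring G\<^esub> frag_of h) =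
        act n (frag_of (\<phi> h) - frag_of h) \<oplus>\<^bsub>M\<^esub> act n (frag_of h)"
      using n h d by (intro RM.act_add_right ring)
    then have "act n (frag_of (\<phi> h)) = act n (frag_of (\<phi> h) - frag_of h) \<oplus>\<^bsub>M\<^esub> act n (frag_of h)"
      by (simp add: ring(5)[OF h])
    then show ?thesis
      using RM.act_closed[OF n d] n h by (simp add: RM.M.minus_eq RM.M.a_assoc RM.M.r_neg)
  qed
  show ?thesis
    by unfold_locales (auto simp: alexander_mcb_def T.under_def T.over_def act_diff)
qed

theorem theorem6p8:
  fixes G :: "('g, 'r) monoid_scheme"
    and M :: "('m, 's) ring_scheme"
    and act :: "'m \<Rightarrow> ('g \<Rightarrow>\<^sub>0 int) \<Rightarrow> 'm"
    and \<phi> :: "'g \<Rightarrow> 'g"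
    and A :: "('a, 't) monoid_scheme"
    and lam :: "'g \<Rightarrow> 'a"
    and n :: nat
    and f :: "('m list \<Rightarrow>\<^sub>0 int) set \<Rightarrow> 'a"
  assumes "group G"
    and "right_module (group_ring G) M act"
    and "\<phi> \<in> hom G (G\<lparr>carrier := group_center G\<rparr>)"
    and "comm_group A"
    and "lam \<in> hom G A"
    and "n \<ge> 1"
    and "normalized_gp_cocycle G M act (n + 1) A f"
  shows "(\<exists>\<Phi>. mcb_cocycle (alexander_mcb G M act \<phi>) n A \<Phi> \<and>
            (\<forall>c\<in>carrier (mcb_P (alexander_mcb G M act \<phi>) n).
               \<Phi> (mcb_D (alexander_mcb G M act \<phi>) n
                    #>\<^bsub>mcb_P (alexander_mcb G M act \<phi>) n\<^esub> c) =
               (f \<circ> psi_map G M act \<phi> n \<circ> gamma_map M n \<circ> proj_map n) c))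
       \<and> (\<exists>\<Phi>. mcb_cocycle (alexander_mcb G M act \<phi>) n (tensor A A) \<Phi> \<and>
            (\<forall>c\<in>carrier (mcb_P (alexander_mcb G M act \<phi>) n).
               \<Phi> (mcb_D (alexander_mcb G M act \<phi>) n
                    #>\<^bsub>mcb_P (alexander_mcb G M act \<phi>) n\<^esub> c) =
               (tensor_map A A f id \<circ> psi_lam_map G M act \<phi> A lam n
                  \<circ> gamma_map M n \<circ> proj_map n) c))"
proof
  let ?X = "alexander_mcb G M act \<phi>"
  interpret C: twisted_mcb G M "\<lambda>m g. act m (frag_of g)" \<phi> ?X
    by (rule twisted_mcb_alexander[OF assms(1-3)])
  interpret GC: group_chains G M act \<phi>
    by (rule group_chains.intro[OF C.twisted_module_axioms])
  interpret A: comm_group A by fact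
  interpret lam: group_hom G A lam
    using assms(1,5) A.is_group by (simp add: group_hom_def group_hom_axioms_def)
  define F where "F = (\<lambda>c. f (gp_class G M act (Suc n) c))"
  have f: "normalized_gp_cocycle G M act (Suc n) A f"
    using assms(7) by simp
  then have f_hom: "f \<in> hom (gp_C G M act (Suc n)) A"
    by (simp add: normalized_gp_cocycle_def)
  note F = GC.normalized_cocycle_values[OF A.is_group f F_def]
  have conj: "lam (inv\<^bsub>G\<^esub> x \<otimes>\<^bsub>G\<^esub> g \<otimes>\<^bsub>G\<^esub> x) = lam g" if "g \<in> carrier G" "x \<in> carrier G" for g x
  proof -
    have "lam (inv\<^bsub>G\<^esub> x \<otimes>\<^bsub>G\<^esub> g \<otimes>\<^bsub>G\<^esub> x) = inv\<^bsub>A\<^esub> lam x \<otimes>\<^bsub>A\<^esub> (lam g \<otimes>\<^bsub>A\<^esub> lam x)"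
      using that by (simp add: A.m_assoc)
    also have "\<dots> = lam g"
      using that by (simp add: A.m_comm[of "lam g" "lam x"] flip: A.m_assoc)
    finally show ?thesis .
  qed
  \<comment> \<open>The map \<open>\<psi>\<^sub>n\<close> on the chain level, before passing to coinvariants.\<close>
  define \<Psi> where "\<Psi> = (\<lambda>(gs :: 'g list, ms :: 'm list).
      \<Sum>k \<in> {1..n} \<rightarrow>\<^sub>E {0, 1}. frag_cmul ((-1) ^ (\<Sum>i = 1..n. k i))
        (frag_of (map (\<lambda>i. act (ms ! i) (frag_of (psi_weight G \<phi> n gs k i))) [0..<Suc n])))"
  have psi_map: "psi_map G M act \<phi> n c = gp_class G M act (Suc n) (frag_extend \<Psi> c)" for c
    by (simp add: psi_map_def \<Psi>_def)
  have Psi: "\<Psi> (map snd (x\<^sub>0 # xs), map (\<lambda>i. fst ((x\<^sub>0 # xs) ! i) \<ominus>\<^bsub>M\<^esub> fst ((x\<^sub>0 # xs) ! (i + 1))) [0..<n] @ [fst ((x\<^sub>0 # xs) ! n)])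
      = C.cube_sum frag_of (fst x\<^sub>0) xs"
    if "x\<^sub>0 \<in> C.points" "set xs \<subseteq> C.points" "length xs = n" for x\<^sub>0 xs
    unfolding \<Psi>_def prod.case by (rule C.cube_sum_conv_psi[OF that])
  \<comment> \<open>The label of a tuple is the image of \<open>g\<^sub>0\<close> in \<open>A\<close>.\<close>
  define W where "W = (\<lambda>g (ms :: 'm list). frag_of (ms, lam g))"
  have cube_W: "C.cube_sum (W g) m xs = frag_extend (\<lambda>ms. frag_of (ms, lam g)) (C.cube_sum frag_of m xs)" for g m xs
    unfolding C.cube_sum_def cube_frag_extend[symmetric] by (simp add: W_def)
  let ?S = "tuples M (Suc n) \<times> carrier A"
  show "\<exists>\<Phi>. mcb_cocycle ?X n A \<Phi> \<and> (\<forall>c\<in>carrier (mcb_P ?X n). \<Phi> (mcb_D ?X n #>\<^bsub>mcb_P ?X n\<^esub> c) =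
      (f \<circ> psi_map G M act \<phi> n \<circ> gamma_map M n \<circ> proj_map n) c)"
  proof -
    \<comment> \<open>The first cocycle forgets the labels.\<close>
    let ?fst = "frag_extend (\<lambda>(ms :: 'm list, b :: 'a). frag_of ms)"
    have fst_label: "?fst (frag_extend (\<lambda>ms. frag_of (ms, b)) c) = c" for b c
      using frag_extend_compose[of "\<lambda>(ms, b). frag_of ms" "\<lambda>ms. (ms, b)" c] frag_expansion[of c] by (simp add: comp_def)
    have h: "F \<circ> ?fst \<in> hom (free_Abelian_group ?S) A"
      by (rule hom_compose[OF frag_extend_hom F(1)]) auto
    have "\<exists>\<Phi>. mcb_cocycle ?X n A \<Phi> \<and>
      (\<forall>c\<in>carrier (mcb_P ?X n). \<Phi> (mcb_D ?X n #>\<^bsub>mcb_P ?X n\<^esub> c) = (F \<circ> ?fst) (frag_extend (C.symb_val n W) c))"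
      unfolding W_def
    proof (rule C.cocycle_of_labelled_group_cocycle[OF A.is_group h lam.hom_closed conj])
      fix ms g b assume ms: "ms \<in> tuples M (Suc n)" and g: "g \<in> carrier G"
      interpret F: group_hom "free_Abelian_group (tuples M (Suc n))" A F
        using A.is_group F(1) by (simp add: group_hom_def group_hom_axioms_def)
      have "F (frag_of (map (\<lambda>m. act m (frag_of g)) ms) - frag_of ms) = \<one>\<^bsub>A\<^esub>"
        using F.hom_mult[of "frag_of (map (\<lambda>m. act m (frag_of g)) ms)" "- frag_of ms"] F.hom_inv[of "frag_of ms"]
          F.hom_closed[of "frag_of ms"] F(2)[OF ms g] ms GC.map_act_tuples[OF ms g] by simp
      then show "(F \<circ> ?fst) (frag_of (map (\<lambda>m. act m (frag_of g)) ms, b) - frag_of (ms, b)) = \<one>\<^bsub>A\<^esub>"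
        by (simp add: frag_extend_diff)
    next
      fix ms i b assume "ms \<in> tuples M (Suc n)" "i < n" "ms ! i = \<zero>\<^bsub>M\<^esub>"
      then show "(F \<circ> ?fst) (frag_of (ms, b)) = \<one>\<^bsub>A\<^esub>"
        using F(3) by simp
    next
      fix ms b assume "ms \<in> tuples M (Suc (Suc n))"
      then show "(F \<circ> ?fst) (frag_extend (\<lambda>ms. frag_of (ms, b)) (gp_boundary_tuple M ms)) = \<one>\<^bsub>A\<^esub>"
        using F(4) fst_label by simp
    qed
    moreover have "(F \<circ> ?fst) (frag_extend (C.symb_val n W) c) = (f \<circ> psi_map G M act \<phi> n \<circ> gamma_map M n \<circ> proj_map n) c"
      if c: "c \<in> carrier (mcb_P ?X n)" for c
    proof -
      have "frag_extend \<Psi> (gamma_map M n (proj_map n c)) - ?fst (frag_extend (C.symb_val n W) c) \<in> {0}"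
        by (intro C.comparison_closed[OF _ _ _ c]) (simp_all only: Psi cube_W fst_label, auto)
      then show ?thesis
        by (simp add: psi_map F_def)
    qed
    ultimately show ?thesis
      by simp
  qed
  show "\<exists>\<Phi>. mcb_cocycle ?X n (tensor A A) \<Phi> \<and> (\<forall>c\<in>carrier (mcb_P ?X n). \<Phi> (mcb_D ?X n #>\<^bsub>mcb_P ?X n\<^esub> c) =
      (tensor_map A A f id \<circ> psi_lam_map G M act \<phi> A lam n \<circ> gamma_map M n \<circ> proj_map n) c)"
  proof -
    let ?R = "tensor_rel A A" and ?T = "carrier A \<times> carrier A"
    let ?cl = "\<lambda>x. ?R #>\<^bsub>free_Abelian_group ?T\<^esub> x"
    \<comment> \<open>The second cocycle sends a tuple with label \<open>b\<close> to the tensor of its value and \<open>b\<close>.\<close>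
    let ?E = "frag_extend (\<lambda>(ms :: 'm list, b). frag_of (F (frag_of ms), b))"
    have R: "?R \<lhd> free_Abelian_group ?T"
      by (rule tensor_rel_normal[OF A.is_group A.is_group])
    note R' = normal_free_closed[OF R]
    have F_closed: "F (frag_of ms) \<in> carrier A" if "ms \<in> tuples M (Suc n)" for ms
      using hom_in_carrier[OF F(1)] that by simp
    have "?E \<in> hom (free_Abelian_group ?S) (free_Abelian_group ?T)"
      by (rule frag_extend_hom) (auto simp: F_closed)
    then have h: "?cl \<circ> ?E \<in> hom (free_Abelian_group ?S) (tensor A A)"
      unfolding tensor_def by (rule hom_compose[OF _ coset_hom_free[OF R]])
    have one: "?cl x = \<one>\<^bsub>tensor A A\<^esub>" if "x \<in> ?R" for x
      unfolding tensor_def by (rule coset_free_one[OF R that])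
    have B: "group (tensor A A)"
      unfolding tensor_def by (rule normal.factorgroup_is_group[OF R])
    have E_label: "?E (frag_extend (\<lambda>ms. frag_of (ms, b)) c) = frag_extend (\<lambda>ms. frag_of (F (frag_of ms), b)) c" for b c
      using frag_extend_compose[of "\<lambda>(ms, b). frag_of (F (frag_of ms), b)" "\<lambda>ms. (ms, b)" c] by (simp add: comp_def)
    note expand = tensor_rel_expand[OF A.is_group A.is_group F(1)]
    have "\<exists>\<Phi>. mcb_cocycle ?X n (tensor A A) \<Phi> \<and>
      (\<forall>c\<in>carrier (mcb_P ?X n). \<Phi> (mcb_D ?X n #>\<^bsub>mcb_P ?X n\<^esub> c) = (?cl \<circ> ?E) (frag_extend (C.symb_val n W) c))"
      unfolding W_def
    proof (rule C.cocycle_of_labelled_group_cocycle[OF B h lam.hom_closed conj])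
      fix ms g and b :: 'a assume "ms \<in> tuples M (Suc n)" "g \<in> carrier G"
      then show "(?cl \<circ> ?E) (frag_of (map (\<lambda>m. act m (frag_of g)) ms, b) - frag_of (ms, b)) = \<one>\<^bsub>tensor A A\<^esub>"
        using one[OF R'(1)] F(2) by (simp add: frag_extend_diff)
    next
      fix ms i b assume "ms \<in> tuples M (Suc n)" "i < n" "ms ! i = \<zero>\<^bsub>M\<^esub>" "b \<in> carrier A"
      then show "(?cl \<circ> ?E) (frag_of (ms, b)) = \<one>\<^bsub>tensor A A\<^esub>"
        using F(3) one[OF tensor_rel_one[OF A.is_group A.is_group]] by simp
    next
      fix ms b assume ms: "ms \<in> tuples M (Suc (Suc n))" and b: "b \<in> carrier A"
      have "Poly_Mapping.keys (gp_boundary_tuple M ms) \<subseteq> tuples M (Suc n)"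
        using gp_boundary_tuple_in_free[OF C.M.abelian_group_axioms ms zero_less_Suc] by simp
      from expand[OF b this] have "frag_of (\<one>\<^bsub>A\<^esub>, b) - ?E (frag_extend (\<lambda>ms. frag_of (ms, b)) (gp_boundary_tuple M ms)) \<in> ?R"
        unfolding E_label F(4)[OF ms] .
      from R'(4)[OF tensor_rel_one[OF A.is_group A.is_group b] this]
      show "(?cl \<circ> ?E) (frag_extend (\<lambda>ms. frag_of (ms, b)) (gp_boundary_tuple M ms)) = \<one>\<^bsub>tensor A A\<^esub>"
        by (simp add: one)
    qed
    moreover have "(?cl \<circ> ?E) (frag_extend (C.symb_val n W) c) =
        (tensor_map A A f id \<circ> psi_lam_map G M act \<phi> A lam n \<circ> gamma_map M n \<circ> proj_map n) c"
      if c: "c \<in> carrier (mcb_P ?X n)" for c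
    proof -
      let ?L = "\<lambda>(gs, ms). frag_of (F (\<Psi> (gs, ms)), lam (gs ! 0))"
      have L: "?L (map snd (x\<^sub>0 # xs), map (\<lambda>i. fst ((x\<^sub>0 # xs) ! i) \<ominus>\<^bsub>M\<^esub> fst ((x\<^sub>0 # xs) ! (i + 1))) [0..<n] @ [fst ((x\<^sub>0 # xs) ! n)])
          - ?E (C.cube_sum (W (snd x\<^sub>0)) (fst x\<^sub>0) xs) \<in> ?R"
        if x: "x\<^sub>0 \<in> C.points" "set xs \<subseteq> C.points" "length xs = n" for x\<^sub>0 xs
      proof -
        have "C.cube_sum frag_of (fst x\<^sub>0) xs \<in> carrier (free_Abelian_group (tuples M (Suc n)))"
        proof (rule C.cube_sum_closed[OF _ _ _ x(2)])
          fix y z assume "y \<in> carrier (free_Abelian_group (tuples M (Suc n)))" "z \<in> carrier (free_Abelian_group (tuples M (Suc n)))"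
          then show "y - z \<in> carrier (free_Abelian_group (tuples M (Suc n)))"
            using keys_diff[of y z] by auto
        qed (use x in auto)
        then have "Poly_Mapping.keys (C.cube_sum frag_of (fst x\<^sub>0) xs) \<subseteq> tuples M (Suc n)"
          by simp
        moreover have "lam (snd x\<^sub>0) \<in> carrier A"
          using x by auto
        ultimately show ?thesis
          unfolding cube_W E_label prod.case Psi[OF x] using expand by simp
      qed
      have "tensor_map A A f id (psi_lam_map G M act \<phi> A lam n d) = ?cl (frag_extend ?L d)" for d
      proof -
        have "tensor_map A A f id (psi_lam_map G M act \<phi> A lam n d) =
          ?cl (frag_extend (\<lambda>(a, b). frag_of (f a, id b)) (frag_extend (\<lambda>(gs, ms). frag_of (psi_map G M act \<phi> n (frag_of (gs, ms)), lam (gs ! 0))) d))"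
          unfolding psi_lam_map_def Suc_eq_plus1[symmetric]
          by (rule tensor_map_coset[OF GC.group_gp_C A.is_group A.is_group A.is_group f_hom]) (simp add: hom_def)
        also have "\<dots> = ?cl (frag_extend ?L d)"
          using frag_extend_compose[of "\<lambda>(a, b). frag_of (f a, id b)" "\<lambda>(gs, ms). (psi_map G M act \<phi> n (frag_of (gs, ms)), lam (gs ! 0))" d]
          by (simp add: comp_def psi_map F_def case_prod_unfold)
        finally show ?thesis .
      qed
      moreover have "frag_extend ?L (gamma_map M n (proj_map n c)) - ?E (frag_extend (C.symb_val n W) c) \<in> ?R"
        by (rule C.comparison_closed[OF R'(1,4) L c])
      ultimately show ?thesis
        using coset_free_eqI[OF R] by simp
    qed
    ultimately show ?thesis
      by simp
  qed
qed

end
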